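(* Let $k$ be a field, $\lambda\in k$, $X$ a well-ordered set, and $\Omega=\{P\}$ with $P$ a unary operator. Let $S_B\subseteq Lie(\{P\};X)$ be the set of all Lie $\{P\}$-polynomials $$f^B_{u,v}=(P([u])P([v]))-P((P([u])[v]))-P(([u]P([v])))-\lambda([u][v]),$$ where $u,v\in ALSW(\{P\};X)$ and $u>_{Dl}v$. Then, with the order $>_{Dl}$ on $\langle\{P\};X\rangle$, the set $S_B$ is a Gröbner-Shirshov basis in $Lie(\{P\};X)$. It follows that the set $$Irr(S_B)=\left\{[w]\in NLSW(\{P\};X) : w\neq\pi|_{P(u)P(v)}\ \text{for all}\ \pi\in\langle\{P\};X\rangle^\star,\ u,v\in ALSW(\{P\};X)\ \text{with}\ u>_{Dl}v\right\}$$ is a linear basis of the free modified $\lambda$-Rota-Baxter Lie algebra $MRBL(X)=Lie(\{P\};X|S_B)=Lie(\{P\};X)/Id_{Lie}(S_B)$ on $X$.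
   Context: A modified $\lambda$-Rota-Baxter Lie algebra is a Lie algebra $L$ over $k$ with a linear map $P:L\to L$ satisfying $[P(x)P(y)]=P([P(x)y])+P([xP(y)])+\lambda[xy]$ for all $x,y\in L$; free objects on $X$ are in the usual sense (homomorphisms commute with $P$). The definitions below are for a general operator set $\Omega$; in the claim $\Omega=\{P\}$ with $P$ unary. **Words.** $k$ is a field, $X$ a set, $\Omega=\bigcup_{m\ge1}\Omega_m$ where $\Omega_m$ is a set of $m$-ary operator symbols; $X$ and $\Omega$ carry well orders. For a set $Y$: $S(Y)$ is the set of nonempty associative words on $Y$, $Y^*=S(Y)\cup\{1\}$ ($1$ the empty word), and $\Omega(Y)=\bigcup_m\{\omega(y_1,\dots,y_m): y_i\in Y,\ \omega\in\Omega_m\}$ (formal expressions). Put $\langle\Omega;X\rangle_0=S(X)$, $\langle\Omega;X\rangle_n=S(X\cup\Omega(\langle\Omega;X\rangle_{n-1}))$, $\langle\Omega;X\rangle=\bigcup_n\langle\Omega;X\rangle_n$ (associative $\Omega$-words). **Order.** Elements of $X\cup\Omega(\langle\Omega;X\rangle)$ are called prime; each $u\in\langle\Omega;X\rangle$ is uniquely $u=u_1\cdots u_n$ with $u_i$ prime, and $bre(u)=n$; $deg(u)$ is the total number of occurrences of elements of $X$ and $\Omega$ in $u$. Put $wt(u)=(deg(u),bre(u),u_1,\dots,u_n)$. The order $>_{Dl}$ on $\langle\Omega;X\rangle$: $u>_{Dl}v$ iff $wt(u)>wt(v)$ lexicographically, where primes are compared first by degree; primes of degree $1$ are elements of $X$,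 compared by the order of $X$; primes $\omega(a_1,\dots,a_t)$, $\theta(b_1,\dots,b_l)$ of equal degree are compared by comparing $(\omega,a_1,\dots,a_t)$ and $(\theta,b_1,\dots,b_l)$ lexicographically (operators by the order of $\Omega$, arguments recursively by $>_{Dl}$). Let $\succ$ be the restriction of $>_{Dl}$ to prime elements. **Lyndon-Shirshov words.** For an ordered set $Z$, the lex order on $Z^*$: $1>_{lex}u$ for every nonempty $u$, and $zu'>_{lex}z'v'$ ($z,z'\in Z$) iff $z>z'$, or $z=z'$ and $u'>_{lex}v'$. $ALSW(Z)$ is the set of nonempty words $w$ with $uv>_{lex}vu$ for every factorization $w=uv$ with $u,v\ne1$. $NLSW(Z)$ is the set of non-associative (fully bracketed) words $(u)$ such that: the underlying associative word $u$ is in $ALSW(Z)$; if $(u)=((v)(w))$ then $(v),(w)\in NLSW(Z)$; and if moreover $(v)=((v_1)(v_2))$ then $v_2\le_{lex}w$. Each $u\in ALSW(Z)$ has exactly one bracketing $[u]\in NLSW(Z)$ (the Shirshov standard bracketing). **Lyndon-Shirshov $\Omega$-words.** $ALSW(\Omega;X)_0=ALSW(X)$, $ALSW(\Omega;X)_n=ALSW(X\cup\Omega(ALSW(\Omega;X)_{n-1}))$ with respect to $\succ_{lex}$, and $ALSW(\Omega;X)=\bigcup_nALSW(\Omega;X)_n$. The bracketing $[u]$ of $u\in ALSW(\Omega;X)$: $[x]=x$ for $x\in X$; $[\omega(u_1,\dots,u_m)]=\omega([u_1],\dots,[u_m])$; for $u=u_1\cdots u_m$ with $u_i$ prime, $[u]$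 is the Shirshov standard bracketing of the word $[u_1][u_2]\cdots[u_m]$ in the letters $[u_1],\dots,[u_m]$, ordered by $[p]\succ[q]$ iff $p\succ q$. $NLSW(\Omega;X)=\{[u]:u\in ALSW(\Omega;X)\}$. **Algebras.** A Lie $\Omega$-algebra is a Lie $k$-algebra with, for each $\omega\in\Omega_m$, an $m$-ary multilinear operation; an ideal of it is a Lie ideal $I$ such that $\omega(a_1,\dots,a_m)\in I$ whenever some $a_i\in I$. $Id_{Lie}(S)$ is the ideal of $Lie(\Omega;X)$ generated by $S$. $k\langle\Omega;X\rangle$ is the $k$-space with basis $\langle\Omega;X\rangle$, with concatenation as product and operators extended multilinearly. $Lie(\Omega;X)$ is the Lie $\Omega$-subalgebra of $k\langle\Omega;X\rangle$ generated by $X$ under $(uv)=uv-vu$ (and all operators); the elements $[u]$ are regarded as elements of $Lie(\Omega;X)$ by reading brackets as commutators. For $0\ne f\in k\langle\Omega;X\rangle$, $\bar f$ is the leading (largest) $\Omega$-word of $f$ with respect to $>_{Dl}$; $f$ is monic if the coefficient of $\bar f$ is $1$; a set is monic if all its elements are. (For $0\neq f\in Lie(\Omega;X)$ one has $\bar f\in ALSW(\Omega;X)$.) **Special normal words.** $\langle\Omega;X\rangle^\star$ is the set of $\star$-$\Omega$-words: associative $\Omega$-words on $X\cup\{\star\}$ with exactly one occurrence of $\star\notin X$; $\pi|_s$ is the result of substituting $s$ for $\star$ in $\pi$ (expanded multilinearly). If $v,\pi|_v\in ALSW(\Omega;X)$, there are $\pi_1\in\langle\Omega;X\rangle^\star$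 and a possibly empty $\Omega$-word $c$ with $[\pi|_v]=[\pi_1|_{[vc]}]$, i.e. $\pi=\pi_1|_{\star c}$, $vc\in ALSW(\Omega;X)$, and the bracketed word $[\pi|_v]$ has $[vc]$ as a bracketed subword at the place of $\star$ in $\pi_1$. Write (uniquely) $c=c_1\cdots c_m$ with $c_i\in ALSW(\Omega;X)$, $c_t\preceq_{lex}c_{t+1}$, and let $[\pi|_v]_v$ be obtained from $[\pi|_v]$ by replacing this subword $[vc]$ by $[\cdots[[[v][c_1]][c_2]]\cdots[c_m]]$; a choice of $(\pi_1,c)$ is fixed for each $(\pi,v)$. For monic $f\in Lie(\Omega;X)$ with $\pi|_{\bar f}\in ALSW(\Omega;X)$, the special normal $f$-word $[\pi|_f]_{\bar f}\in Lie(\Omega;X)$ is obtained from $[\pi|_{\bar f}]_{\bar f}$ by replacing the distinguished factor $[\bar f]$ by $f$. **Compositions.** Let $f,g\in Lie(\Omega;X)$ be monic. (a) If $w=\bar fa=b\bar g$ with $a,b\in\langle\Omega;X\rangle$ and $bre(w)<bre(\bar f)+bre(\bar g)$, then $\langle f,g\rangle_w=[fa]_{\bar f}-[bg]_{\bar g}$ (intersection composition; $\pi=\star a$ and $\pi=b\star$ respectively). (b) If $w=\bar f=\pi|_{\bar g}$ with $\pi\in\langle\Omega;X\rangle^\star$, then $\langle f,g\rangle_w=f-[\pi|_g]_{\bar g}$ (inclusion composition). A composition is trivial modulo $(S,w)$ if it equals a finite sum $\sum\alpha_i[\pi_i|_{s_i}]_{\overline{s_i}}$ with $\alpha_i\in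 k$, $s_i\in S$, $[\pi_i|_{s_i}]_{\overline{s_i}}$ special normal $s_i$-words and $\pi_i|_{\overline{s_i}}<_{Dl}w$. A monic set $S\subseteq Lie(\Omega;X)$ is a Gröbner-Shirshov basis in $Lie(\Omega;X)$ if every composition $\langle f,g\rangle_w$ of $f,g\in S$ is trivial modulo $(S,w)$. *)

theory Defs
  imports
    "HOL-Algebra.QuotRing"
    "HOL-Algebra.Algebraic_Closure_Type"
    "HOL-Library.Poly_Mapping"
begin

(* frees the identifier X, which HOL-Algebra uses as notation for a polynomial variable *)
no_notation var (\<open>X\<index>\<close>)

section \<open>Associative words with one unary operator\<close>

text \<open>
  Throughout \<open>\<Omega> = {P}\<close> with \<open>P\<close> unary.  \<open>Op u\<close> is the formal expression \<open>P(u)\<close>.  The datatype also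
  contains the junk term \<open>Op []\<close>; the sets \<open>omega_words\<close> below exclude it hereditarily.
\<close>

datatype 'x prm = Gen 'x | Op "'x prm list"

type_synonym 'x word = "'x prm list"

definition nonempty_words :: "'z set \<Rightarrow> 'z list set" where
  "nonempty_words Y = {w. w \<noteq> [] \<and> set w \<subseteq> Y}"

primrec omega_words_n :: "'x set \<Rightarrow> nat \<Rightarrow> 'x word set" where
  "omega_words_n X 0 = nonempty_words (Gen ` X)"
| "omega_words_n X (Suc n) = nonempty_words (Gen ` X \<union> Op ` omega_words_n X n)"

definition omega_words :: "'x set \<Rightarrow> 'x word set" where
  "omega_words X = (\<Union>n. omega_words_n X n)"

primrec deg_prm :: "'x prm \<Rightarrow> nat" where
  "deg_prm (Gen x) = 1"
| "deg_prm (Op u) = Suc (sum_list (map deg_prm u))"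

definition deg :: "'x word \<Rightarrow> nat" where
  "deg u = sum_list (map deg_prm u)"

text \<open>
  \<open>Dl_less u v\<close> is \<open>v >\<^sub>D\<^sub>l u\<close>, and \<open>prm_less a b\<close> is \<open>b \<succ> a\<close>.  The breadth of a word is its length as a
  list of primes.  Since \<open>P\<close> is the only operator, two primes headed by \<open>P\<close> are compared by their
  arguments.
\<close>

inductive Dl_less :: "'x::wellorder word \<Rightarrow> 'x word \<Rightarrow> bool"
  and prm_less :: "'x::wellorder prm \<Rightarrow> 'x prm \<Rightarrow> bool"
where
  Dl_deg: "deg u < deg v \<Longrightarrow> Dl_less u v"
| Dl_bre: "deg u = deg v \<Longrightarrow> length u < length v \<Longrightarrow> Dl_less u v"
| Dl_lex: "deg (r @ a # s) = deg (r @ b # t) \<Longrightarrow> length s = length t \<Longrightarrow> prm_less a b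
    \<Longrightarrow> Dl_less (r @ a # s) (r @ b # t)"
| prm_deg: "deg_prm a < deg_prm b \<Longrightarrow> prm_less a b"
| prm_Gen: "x < y \<Longrightarrow> prm_less (Gen x) (Gen y)"
| prm_Op: "deg u = deg v \<Longrightarrow> Dl_less u v \<Longrightarrow> prm_less (Op u) (Op v)"

section \<open>Lyndon-Shirshov words over an ordered set of letters\<close>

text \<open>
  The order of the letters is given as the relation \<open>gt\<close> (``greater than'').  In \<open>lex_gt\<close> the empty
  word is the greatest one.
\<close>

fun lex_gt :: "('z \<Rightarrow> 'z \<Rightarrow> bool) \<Rightarrow> 'z list \<Rightarrow> 'z list \<Rightarrow> bool" where
  "lex_gt gt [] v \<longleftrightarrow> v \<noteq> []"
| "lex_gt gt (z # u) [] \<longleftrightarrow> False"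
| "lex_gt gt (z # u) (z' # v) \<longleftrightarrow> gt z z' \<or> (z = z' \<and> lex_gt gt u v)"

definition lex_le :: "('z \<Rightarrow> 'z \<Rightarrow> bool) \<Rightarrow> 'z list \<Rightarrow> 'z list \<Rightarrow> bool" where
  "lex_le gt u v \<longleftrightarrow> u = v \<or> lex_gt gt v u"

definition alsw :: "('z \<Rightarrow> 'z \<Rightarrow> bool) \<Rightarrow> 'z set \<Rightarrow> 'z list set" where
  "alsw gt Z = {w \<in> nonempty_words Z.
     \<forall>u v. w = u @ v \<and> u \<noteq> [] \<and> v \<noteq> [] \<longrightarrow> lex_gt gt (u @ v) (v @ u)}"

datatype 'z bword = Letter 'z | Br "'z bword" "'z bword"

primrec underlying :: "'z bword \<Rightarrow> 'z list" where
  "underlying (Letter z) = [z]"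
| "underlying (Br s t) = underlying s @ underlying t"

primrec is_nlsw :: "('z \<Rightarrow> 'z \<Rightarrow> bool) \<Rightarrow> 'z set \<Rightarrow> 'z bword \<Rightarrow> bool" where
  "is_nlsw gt Z (Letter z) \<longleftrightarrow> [z] \<in> alsw gt Z"
| "is_nlsw gt Z (Br s t) \<longleftrightarrow>
     underlying (Br s t) \<in> alsw gt Z \<and> is_nlsw gt Z s \<and> is_nlsw gt Z t \<and>
     (\<forall>s1 s2. s = Br s1 s2 \<longrightarrow> lex_le gt (underlying s2) (underlying t))"

definition std_bracket :: "('z \<Rightarrow> 'z \<Rightarrow> bool) \<Rightarrow> 'z list \<Rightarrow> 'z bword" where
  "std_bracket gt w = (THE t. is_nlsw gt (set w) t \<and> underlying t = w)"

section \<open>Lyndon-Shirshov \<open>\<Omega>\<close>-words\<close>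

abbreviation prm_gt :: "'x::wellorder prm \<Rightarrow> 'x prm \<Rightarrow> bool" where
  "prm_gt p q \<equiv> prm_less q p"

primrec ALSW_n :: "'x::wellorder set \<Rightarrow> nat \<Rightarrow> 'x word set" where
  "ALSW_n X 0 = alsw prm_gt (Gen ` X)"
| "ALSW_n X (Suc n) = alsw prm_gt (Gen ` X \<union> Op ` ALSW_n X n)"

definition ALSW :: "'x::wellorder set \<Rightarrow> 'x word set" where
  "ALSW X = (\<Union>n. ALSW_n X n)"

text \<open>Non-associative \<open>\<Omega>\<close>-words are bracketed words whose letters are the following primes.\<close>

datatype 'x bprm = BGen 'x | BOp "'x bprm bword"

type_synonym 'x nword = "'x bprm bword"

primrec erase_prm :: "'x bprm \<Rightarrow> 'x prm" where
  "erase_prm (BGen x) = Gen x"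
| "erase_prm (BOp t) = Op (underlying (map_bword erase_prm t))"

definition erase :: "'x nword \<Rightarrow> 'x word" where
  "erase t = underlying (map_bword erase_prm t)"

text \<open>
  Bracketed primes \<open>[p]\<close> inherit the order of the primes \<open>p\<close> they come from, and \<open>p\<close> is recovered
  from \<open>[p]\<close> by erasing brackets.
\<close>

definition bprm_gt :: "'x::wellorder bprm \<Rightarrow> 'x bprm \<Rightarrow> bool" where
  "bprm_gt p q \<longleftrightarrow> prm_gt (erase_prm p) (erase_prm q)"

primrec bracket_prm :: "'x::wellorder prm \<Rightarrow> 'x bprm" where
  "bracket_prm (Gen x) = BGen x"
| "bracket_prm (Op u) = BOp (std_bracket bprm_gt (map bracket_prm u))"

definition bracket :: "'x::wellorder word \<Rightarrow> 'x nword" where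
  "bracket u = std_bracket bprm_gt (map bracket_prm u)"

definition NLSW :: "'x::wellorder set \<Rightarrow> 'x nword set" where
  "NLSW X = bracket ` ALSW X"

section \<open>Lie algebras with an operator\<close>

text \<open>
  The scalars form a type of class \<open>field\<close>; \<open>scalars\<close> is this field as a structure of HOL-Algebra.
  In a structure of type \<open>lie_op\<close> the product \<open>\<otimes>\<close> is the Lie bracket and the field \<open>one\<close> is
  meaningless (as it is for \<open>module\<close>).
\<close>

abbreviation scalars :: "'k::field ring" where
  "scalars \<equiv> ring_of_type_algebra"

record ('k, 'a) lie_op = "('k, 'a) module" +
  opr :: "'a \<Rightarrow> 'a"

locale lie_op_algebra = module "scalars :: 'k::field ring" L
  for L :: "('k::field, 'a, 'm) lie_op_scheme" (structure) +
  assumes bracket_closed: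
      "x \<in> carrier L \<Longrightarrow> y \<in> carrier L \<Longrightarrow> x \<otimes> y \<in> carrier L"
    and bracket_add_left:
      "x \<in> carrier L \<Longrightarrow> y \<in> carrier L \<Longrightarrow> z \<in> carrier L \<Longrightarrow>
        (x \<oplus> y) \<otimes> z = (x \<otimes> z) \<oplus> (y \<otimes> z)"
    and bracket_add_right:
      "x \<in> carrier L \<Longrightarrow> y \<in> carrier L \<Longrightarrow> z \<in> carrier L \<Longrightarrow>
        x \<otimes> (y \<oplus> z) = (x \<otimes> y) \<oplus> (x \<otimes> z)"
    and bracket_smult_left:
      "x \<in> carrier L \<Longrightarrow> y \<in> carrier L \<Longrightarrow> (c \<odot> x) \<otimes> y = c \<odot> (x \<otimes> y)"
    and bracket_smult_right:
      "x \<in> carrier L \<Longrightarrow> y \<in> carrier L \<Longrightarrow> x \<otimes> (c \<odot> y) = c \<odot> (x \<otimes> y)"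
    and bracket_alternating:
      "x \<in> carrier L \<Longrightarrow> x \<otimes> x = \<zero>"
    and jacobi:
      "x \<in> carrier L \<Longrightarrow> y \<in> carrier L \<Longrightarrow> z \<in> carrier L \<Longrightarrow>
        (x \<otimes> (y \<otimes> z)) \<oplus> (y \<otimes> (z \<otimes> x)) \<oplus> (z \<otimes> (x \<otimes> y)) = \<zero>"
    and opr_closed:
      "x \<in> carrier L \<Longrightarrow> opr L x \<in> carrier L"
    and opr_add:
      "x \<in> carrier L \<Longrightarrow> y \<in> carrier L \<Longrightarrow> opr L (x \<oplus> y) = opr L x \<oplus> opr L y"
    and opr_smult:
      "x \<in> carrier L \<Longrightarrow> opr L (c \<odot> x) = c \<odot> opr L x"

locale modified_RB_lie_algebra = lie_op_algebra L
  for lam :: "'k::field" and L :: "('k::field, 'a, 'm) lie_op_scheme" (structure) +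
  assumes modified_RB:
    "x \<in> carrier L \<Longrightarrow> y \<in> carrier L \<Longrightarrow>
      opr L x \<otimes> opr L y
        = opr L (opr L x \<otimes> y) \<oplus> opr L (x \<otimes> opr L y) \<oplus> lam \<odot> (x \<otimes> y)"

definition lie_op_hom ::
  "('k, 'a, 'm) lie_op_scheme \<Rightarrow> ('k, 'b, 'n) lie_op_scheme \<Rightarrow> ('a \<Rightarrow> 'b) set" where
  "lie_op_hom L M = {h \<in> carrier L \<rightarrow> carrier M.
     (\<forall>x\<in>carrier L. \<forall>y\<in>carrier L. h (x \<oplus>\<^bsub>L\<^esub> y) = h x \<oplus>\<^bsub>M\<^esub> h y) \<and>
     (\<forall>c. \<forall>x\<in>carrier L. h (c \<odot>\<^bsub>L\<^esub> x) = c \<odot>\<^bsub>M\<^esub> h x) \<and>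
     (\<forall>x\<in>carrier L. \<forall>y\<in>carrier L. h (x \<otimes>\<^bsub>L\<^esub> y) = h x \<otimes>\<^bsub>M\<^esub> h y) \<and>
     (\<forall>x\<in>carrier L. h (opr L x) = opr M (h x))}"

text \<open>
  The argument of type \<open>'b itself\<close> names the type of the elements of the test algebras \<open>A\<close>; a
  statement with \<open>'b\<close> a free type variable covers all of them.
\<close>

definition free_modified_RB ::
  "'b itself \<Rightarrow> 'k::field \<Rightarrow> 'x set \<Rightarrow> ('x \<Rightarrow> 'a) \<Rightarrow> ('k, 'a) lie_op \<Rightarrow> bool" where
  "free_modified_RB T lam X i L \<longleftrightarrow>
     modified_RB_lie_algebra lam L \<and> i \<in> X \<rightarrow> carrier L \<and>
     (\<forall>(A :: ('k, 'b) lie_op) \<phi>. modified_RB_lie_algebra lam A \<and> \<phi> \<in> X \<rightarrow> carrier A \<longrightarrow>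
       (\<exists>h \<in> lie_op_hom L A. (\<forall>x\<in>X. h (i x) = \<phi> x) \<and>
         (\<forall>h' \<in> lie_op_hom L A. (\<forall>x\<in>X. h' (i x) = \<phi> x) \<longrightarrow> (\<forall>a\<in>carrier L. h' a = h a))))"

definition lie_op_ideal :: "('k::field, 'a, 'm) lie_op_scheme \<Rightarrow> 'a set \<Rightarrow> bool" where
  "lie_op_ideal L I \<longleftrightarrow> submodule I scalars L \<and>
     (\<forall>a\<in>carrier L. \<forall>x\<in>I. a \<otimes>\<^bsub>L\<^esub> x \<in> I \<and> x \<otimes>\<^bsub>L\<^esub> a \<in> I) \<and>
     (\<forall>x\<in>I. opr L x \<in> I)"

definition generated_ideal :: "('k::field, 'a, 'm) lie_op_scheme \<Rightarrow> 'a set \<Rightarrow> 'a set" where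
  "generated_ideal L S = \<Inter> {I. lie_op_ideal L I \<and> S \<subseteq> I}"

definition lie_quot :: "('k, 'a, 'm) lie_op_scheme \<Rightarrow> 'a set \<Rightarrow> ('k, 'a set) lie_op" where
  "lie_quot L I = \<lparr>carrier = a_rcosets\<^bsub>L\<^esub> I, monoid.mult = rcoset_mult L I, one = I +>\<^bsub>L\<^esub> \<one>\<^bsub>L\<^esub>,
     zero = I, add = set_add L, module.smult = (\<lambda>c A. \<Union>a\<in>A. I +>\<^bsub>L\<^esub> (c \<odot>\<^bsub>L\<^esub> a)),
     opr = (\<lambda>A. \<Union>a\<in>A. I +>\<^bsub>L\<^esub> opr L a)\<rparr>"

text \<open>
  Bases are indexed families \<open>b\<close> over \<open>J\<close>; independence includes injectivity of \<open>b\<close> on \<open>J\<close>.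
\<close>

definition linear_basis :: "('k::field, 'a, 'm) lie_op_scheme \<Rightarrow> 'j set \<Rightarrow> ('j \<Rightarrow> 'a) \<Rightarrow> bool" where
  "linear_basis L J b \<longleftrightarrow> b \<in> J \<rightarrow> carrier L \<and>
     (\<forall>F c. finite F \<and> F \<subseteq> J \<and> (\<Oplus>\<^bsub>L\<^esub>j\<in>F. c j \<odot>\<^bsub>L\<^esub> b j) = \<zero>\<^bsub>L\<^esub> \<longrightarrow> (\<forall>j\<in>F. c j = 0)) \<and>
     (\<forall>a\<in>carrier L. \<exists>F c. finite F \<and> F \<subseteq> J \<and> a = (\<Oplus>\<^bsub>L\<^esub>j\<in>F. c j \<odot>\<^bsub>L\<^esub> b j))"

section \<open>The free associative and the free Lie \<open>\<Omega>\<close>-algebra\<close>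

text \<open>
  Elements of \<open>k\<langle>\<Omega>;X\<rangle>\<close> are finitely supported functions on words (with support in
  \<open>omega_words X\<close>).  Lists carry no monoid class, so the convolution product is spelled out.
\<close>

type_synonym ('x, 'k) omega_poly = "'x word \<Rightarrow>\<^sub>0 'k"

definition pmul :: "('x, 'k::field) omega_poly \<Rightarrow> ('x, 'k) omega_poly \<Rightarrow> ('x, 'k) omega_poly" where
  "pmul f g = (\<Sum>u\<in>Poly_Mapping.keys f. \<Sum>v\<in>Poly_Mapping.keys g.
     Poly_Mapping.single (u @ v) (Poly_Mapping.lookup f u * Poly_Mapping.lookup g v))"

definition pop :: "('x, 'k::field) omega_poly \<Rightarrow> ('x, 'k) omega_poly" where
  "pop f = (\<Sum>u\<in>Poly_Mapping.keys f. Poly_Mapping.single [Op u] (Poly_Mapping.lookup f u))"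

definition pscale :: "'k::field \<Rightarrow> ('x, 'k) omega_poly \<Rightarrow> ('x, 'k) omega_poly" where
  "pscale c f = Poly_Mapping.map ((*) c) f"

definition pcomm :: "('x, 'k::field) omega_poly \<Rightarrow> ('x, 'k) omega_poly \<Rightarrow> ('x, 'k) omega_poly" where
  "pcomm f g = pmul f g - pmul g f"

definition pgen :: "'x \<Rightarrow> ('x, 'k::field) omega_poly" where
  "pgen x = Poly_Mapping.single [Gen x] 1"

inductive_set Lie_set :: "'x set \<Rightarrow> ('x, 'k::field) omega_poly set" for X where
  Lie_gen: "x \<in> X \<Longrightarrow> pgen x \<in> Lie_set X"
| Lie_zero: "0 \<in> Lie_set X"
| Lie_add: "f \<in> Lie_set X \<Longrightarrow> g \<in> Lie_set X \<Longrightarrow> f + g \<in> Lie_set X"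
| Lie_scale: "f \<in> Lie_set X \<Longrightarrow> pscale c f \<in> Lie_set X"
| Lie_comm: "f \<in> Lie_set X \<Longrightarrow> g \<in> Lie_set X \<Longrightarrow> pcomm f g \<in> Lie_set X"
| Lie_op: "f \<in> Lie_set X \<Longrightarrow> pop f \<in> Lie_set X"

definition Lie :: "'x set \<Rightarrow> ('k::field, ('x, 'k) omega_poly) lie_op" where
  "Lie X = \<lparr>carrier = Lie_set X, monoid.mult = pcomm, one = 0, zero = 0, add = (+),
     module.smult = pscale, opr = pop\<rparr>"

text \<open>
  Evaluation of a non-associative \<open>\<Omega>\<close>-word, reading brackets as commutators and the generator
  \<open>y\<close> as \<open>\<sigma> y\<close>.
\<close>

primrec comm_eval :: "('x, 'k::field) omega_poly bword \<Rightarrow> ('x, 'k) omega_poly" where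
  "comm_eval (Letter f) = f"
| "comm_eval (Br s t) = pcomm (comm_eval s) (comm_eval t)"

primrec eval_prm :: "('y \<Rightarrow> ('x, 'k::field) omega_poly) \<Rightarrow> 'y bprm \<Rightarrow> ('x, 'k) omega_poly" where
  "eval_prm \<sigma> (BGen y) = \<sigma> y"
| "eval_prm \<sigma> (BOp t) = pop (comm_eval (map_bword (eval_prm \<sigma>) t))"

definition nword_eval :: "('y \<Rightarrow> ('x, 'k::field) omega_poly) \<Rightarrow> 'y nword \<Rightarrow> ('x, 'k) omega_poly" where
  "nword_eval \<sigma> t = comm_eval (map_bword (eval_prm \<sigma>) t)"

definition lie_poly :: "'x nword \<Rightarrow> ('x, 'k::field) omega_poly" where
  "lie_poly t = nword_eval pgen t"

definition lead :: "('x::wellorder, 'k::field) omega_poly \<Rightarrow> 'x word" where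
  "lead f = (THE w. w \<in> Poly_Mapping.keys f \<and>
     (\<forall>v \<in> Poly_Mapping.keys f. v \<noteq> w \<longrightarrow> Dl_less v w))"

definition monic :: "('x::wellorder, 'k::field) omega_poly \<Rightarrow> bool" where
  "monic f \<longleftrightarrow> f \<noteq> 0 \<and> Poly_Mapping.lookup f (lead f) = 1"

section \<open>Star words and special normal words\<close>

text \<open>
  The alphabet \<open>X \<union> {\<star>}\<close> is realised in \<open>'x option\<close>, with \<open>\<star>\<close> as \<open>None\<close>.
\<close>

primrec star_count_prm :: "'x option prm \<Rightarrow> nat" where
  "star_count_prm (Gen y) = (if y = None then 1 else 0)"
| "star_count_prm (Op u) = sum_list (map star_count_prm u)"

definition star_words :: "'x set \<Rightarrow> 'x option word set" where
  "star_words X = {\<pi> \<in> omega_words (insert None (Some ` X)).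
     sum_list (map star_count_prm \<pi>) = 1}"

abbreviation star :: "'x option prm" where
  "star \<equiv> Gen None"

abbreviation lift_word :: "'x word \<Rightarrow> 'x option word" where
  "lift_word \<equiv> map (map_prm Some)"

primrec subst_prm :: "('y \<Rightarrow> 'z word) \<Rightarrow> 'y prm \<Rightarrow> 'z word" where
  "subst_prm \<sigma> (Gen y) = \<sigma> y"
| "subst_prm \<sigma> (Op u) = [Op (concat (map (subst_prm \<sigma>) u))]"

definition subst_word :: "('y \<Rightarrow> 'z word) \<Rightarrow> 'y word \<Rightarrow> 'z word" where
  "subst_word \<sigma> u = concat (map (subst_prm \<sigma>) u)"

text \<open>
  \<open>plug \<pi> v\<close> is \<open>\<pi>|\<^sub>v\<close> for a word \<open>v\<close> on \<open>X\<close>, whereas \<open>plug_star \<pi> v\<close> is \<open>\<pi>|\<^sub>v\<close> for a word \<open>v\<close> on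
  \<open>X \<union> {\<star>}\<close>.
\<close>

definition plug :: "'x option word \<Rightarrow> 'x word \<Rightarrow> 'x word" where
  "plug \<pi> v = subst_word (case_option v (\<lambda>x. [Gen x])) \<pi>"

definition plug_star :: "'x option word \<Rightarrow> 'x option word \<Rightarrow> 'x option word" where
  "plug_star \<pi> v = subst_word (case_option v (\<lambda>x. [Gen (Some x)])) \<pi>"

primrec join_bword :: "'z bword bword \<Rightarrow> 'z bword" where
  "join_bword (Letter t) = t"
| "join_bword (Br s t) = Br (join_bword s) (join_bword t)"

primrec tsubst_prm :: "('y \<Rightarrow> 'z nword) \<Rightarrow> 'y bprm \<Rightarrow> 'z nword" where
  "tsubst_prm \<sigma> (BGen y) = \<sigma> y"
| "tsubst_prm \<sigma> (BOp t) = Letter (BOp (join_bword (map_bword (tsubst_prm \<sigma>) t)))"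

definition tplug :: "'x option nword \<Rightarrow> 'x nword \<Rightarrow> 'x nword" where
  "tplug T s = join_bword (map_bword (tsubst_prm (case_option s (\<lambda>x. Letter (BGen x)))) T)"

definition lyndon_factors :: "'x::wellorder set \<Rightarrow> 'x word \<Rightarrow> 'x word list" where
  "lyndon_factors X c = (THE cs. concat cs = c \<and> set cs \<subseteq> ALSW X \<and>
     (\<forall>t. Suc t < length cs \<longrightarrow> lex_le prm_gt (cs ! t) (cs ! Suc t)))"

text \<open>
  The fixed choice of \<open>(\<pi>\<^sub>1, c)\<close> for each \<open>(\<pi>, v)\<close>.  It is given as \<open>(T, c)\<close>, where \<open>T\<close> is the
  bracketed word \<open>[\<pi>|\<^sub>v]\<close> with its subword \<open>[vc]\<close> replaced by \<open>\<star>\<close>, and \<open>\<pi>\<^sub>1\<close> is \<open>T\<close> without brackets;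
  the place of \<open>\<star>\<close> in \<open>\<pi>\<^sub>1\<close> determines the subword, so \<open>\<pi>\<^sub>1\<close> determines \<open>T\<close>.
\<close>

type_synonym 'x normal_choice = "'x option word \<Rightarrow> 'x word \<Rightarrow> 'x option nword \<times> 'x word"

definition valid_choice :: "'x::wellorder set \<Rightarrow> 'x normal_choice \<Rightarrow> bool" where
  "valid_choice X ch \<longleftrightarrow>
     (\<forall>\<pi> \<in> star_words X. \<forall>v \<in> ALSW X. plug \<pi> v \<in> ALSW X \<longrightarrow>
       (case ch \<pi> v of (T, c) \<Rightarrow>
          erase T \<in> star_words X \<and> (c = [] \<or> c \<in> omega_words X) \<and>
          \<pi> = plug_star (erase T) (star # lift_word c) \<and>
          v @ c \<in> ALSW X \<and>
          bracket (plug \<pi> v) = tplug T (bracket (v @ c))))"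

text \<open>
  The two replacements defining the special normal \<open>f\<close>-word are done in one step: the subword
  \<open>[vc]\<close> of \<open>[\<pi>|\<^sub>v]\<close>, with \<open>v\<close> the leading word of \<open>f\<close>, is replaced by the left-normed commutator
  of \<open>f, [c\<^sub>1], \<dots>, [c\<^sub>m]\<close>.
\<close>

definition special_normal ::
  "'x::wellorder set \<Rightarrow> 'x normal_choice \<Rightarrow> 'x option word \<Rightarrow> ('x, 'k::field) omega_poly
    \<Rightarrow> ('x, 'k) omega_poly" where
  "special_normal X ch \<pi> f =
     (case ch \<pi> (lead f) of (T, c) \<Rightarrow>
        nword_eval
          (case_option (foldl pcomm f (map (\<lambda>d. lie_poly (bracket d)) (lyndon_factors X c))) pgen) T)"

section \<open>Groebner-Shirshov bases\<close>

inductive is_composition ::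
  "'x::wellorder set \<Rightarrow> 'x normal_choice \<Rightarrow> ('x, 'k::field) omega_poly \<Rightarrow> ('x, 'k) omega_poly
    \<Rightarrow> 'x word \<Rightarrow> ('x, 'k) omega_poly \<Rightarrow> bool"
  for X ch f g
where
  intersection:
    "a \<in> omega_words X \<Longrightarrow> b \<in> omega_words X \<Longrightarrow> w = lead f @ a \<Longrightarrow> w = b @ lead g \<Longrightarrow>
     length w < length (lead f) + length (lead g) \<Longrightarrow>
     is_composition X ch f g w
       (special_normal X ch (star # lift_word a) f - special_normal X ch (lift_word b @ [star]) g)"
| inclusion:
    "\<pi> \<in> star_words X \<Longrightarrow> w = lead f \<Longrightarrow> w = plug \<pi> (lead g) \<Longrightarrow>
     is_composition X ch f g w (f - special_normal X ch \<pi> g)"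

definition trivial_modulo ::
  "'x::wellorder set \<Rightarrow> 'x normal_choice \<Rightarrow> ('x, 'k::field) omega_poly set \<Rightarrow> 'x word
    \<Rightarrow> ('x, 'k) omega_poly \<Rightarrow> bool" where
  "trivial_modulo X ch S w h \<longleftrightarrow>
     (\<exists>(n::nat) \<alpha> \<pi> s.
        (\<forall>i<n. s i \<in> S \<and> \<pi> i \<in> star_words X \<and> plug (\<pi> i) (lead (s i)) \<in> ALSW X \<and>
               Dl_less (plug (\<pi> i) (lead (s i))) w) \<and>
        h = (\<Sum>i<n. pscale (\<alpha> i) (special_normal X ch (\<pi> i) (s i))))"

definition GS_basis ::
  "'x::wellorder set \<Rightarrow> 'x normal_choice \<Rightarrow> ('x, 'k::field) omega_poly set \<Rightarrow> bool" where
  "GS_basis X ch S \<longleftrightarrow> S \<subseteq> Lie_set X \<and> (\<forall>f\<in>S. monic f) \<and>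
     (\<forall>f\<in>S. \<forall>g\<in>S. \<forall>w h. is_composition X ch f g w h \<longrightarrow> trivial_modulo X ch S w h)"

section \<open>The modified Rota-Baxter relations\<close>

definition f_B :: "'k::field \<Rightarrow> 'x::wellorder word \<Rightarrow> 'x word \<Rightarrow> ('x, 'k) omega_poly" where
  "f_B lam u v = (let U = lie_poly (bracket u); V = lie_poly (bracket v) in
     pcomm (pop U) (pop V) - pop (pcomm (pop U) V) - pop (pcomm U (pop V)) - pscale lam (pcomm U V))"

definition S_B :: "'k::field \<Rightarrow> 'x::wellorder set \<Rightarrow> ('x, 'k) omega_poly set" where
  "S_B lam X = {f_B lam u v | u v. u \<in> ALSW X \<and> v \<in> ALSW X \<and> Dl_less v u}"

definition Irr_B :: "'x::wellorder set \<Rightarrow> 'x nword set" where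
  "Irr_B X = {bracket w | w. w \<in> ALSW X \<and>
     (\<forall>\<pi> \<in> star_words X. \<forall>u \<in> ALSW X. \<forall>v \<in> ALSW X. Dl_less v u \<longrightarrow> w \<noteq> plug \<pi> [Op u, Op v])}"

definition Id_B :: "'k::field \<Rightarrow> 'x::wellorder set \<Rightarrow> ('x, 'k) omega_poly set" where
  "Id_B lam X = generated_ideal (Lie X) (S_B lam X)"

definition MRBL :: "'k::field \<Rightarrow> 'x::wellorder set \<Rightarrow> ('k, ('x, 'k) omega_poly set) lie_op" where
  "MRBL lam X = lie_quot (Lie X) (Id_B lam X)"

definition MRBL_class ::
  "'k::field \<Rightarrow> 'x::wellorder set \<Rightarrow> ('x, 'k) omega_poly \<Rightarrow> ('x, 'k) omega_poly set" where
  "MRBL_class lam X f = Id_B lam X +>\<^bsub>Lie X\<^esub> f"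

end

theory Submission
  imports Defs
begin

text \<open>
  Everything follows from two facts: the leading word of a nonzero element of \<open>Id(S\<^sub>B)\<close> contains some
  \<open>P(u)P(v)\<close> with \<open>u > v\<close>, and conversely every Lyndon-Shirshov \<open>\<Omega>\<close>-word containing such a subword is the
  leading word of an element of the ideal, for instance of a special normal word.  The second fact is
  Shirshov's theory of Lyndon words.  For the first one the free Lie \<open>\<Omega>\<close>-algebra is embedded into
  \<open>k\<langle>\<Omega>;X\<rangle>\<close>, where \<open>P(f)P(g) - P(g)P(f)\<close> is rewritten for all polynomials \<open>f\<close>, \<open>g\<close>.  This rewriting
  system is confluent: its only essential overlap \<open>P(u)P(v)P(t)\<close> resolves by the Jacobi identity.
  Hence a composition, which lies in the ideal and has only words below \<open>w\<close>, is reduced to \<open>0\<close> by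
  special normal words with leading words below \<open>w\<close>, and no composition has to be computed.
\<close>

text \<open>The envelope has far more relations than \<open>S_B\<close>: its pairs \<open>u\<close>,
  \<open>v\<close> run over all words, and its ideal is two-sided. This creates no new reducible
  Lyndon-Shirshov words, because inside such a word every argument of P is again a Lyndon-Shirshov
  word; a redex \<open>P(u)P(v)\<close> found there by associative rewriting is therefore the
  leading word of an element of \<open>S_B\<close>. Plain words also avoid rewriting in bracketings,
  where a redex need not appear as a subtree. The rewriting respects the order because
  \<open>P(P(u)v)\<close> and \<open>P(u)P(v)\<close> have the same degree and are separated by
  breadth. Special normal words enter through two properties, their leading word and their
  membership in the ideal, and both hold for every valid choice. Freeness of the quotient requires
  in addition the universal property of \<open>Lie X\<close>. This algebra is defined as a
  subalgebra of polynomials, so homomorphisms out of it have to be constructed; they come from the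
  linear independence of the Lyndon-Shirshov bracketings.\<close>

lemma append_eq_append_cases:
  assumes "a @ b = u @ x"
  shows "(\<exists>c. b = c @ x \<and> u = a @ c) \<or> (\<exists>c. c \<noteq> [] \<and> a = u @ c \<and> x = c @ b)"
proof -
  obtain c where "a = u @ c \<and> c @ b = x \<or> a @ c = u \<and> b = c @ x"
    using assms unfolding append_eq_append_conv2 by blast
  then show ?thesis by (cases "c = []") auto
qed

section \<open>The order of words\<close>

lemma deg_Nil [simp]: "deg [] = 0"
  and deg_Cons [simp]: "deg (p # u) = deg_prm p + deg u"
  and deg_append [simp]: "deg (u @ v) = deg u + deg v"
  by (simp_all add: deg_def)

lemma deg_prm_Op: "deg_prm (Op u) = Suc (deg u)"
  by (simp add: deg_def)

declare deg_prm.simps(2) [simp del]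
declare deg_prm_Op [simp]

lemma deg_prm_pos: "0 < deg_prm p"
  by (cases p) auto

lemma lex_gt_decomp: "lex_gt R (r @ a # s) (r @ b # t)" if "R a b"
  using that by (induction r) auto

text \<open>At equal lengths the comparison is decided by the first differing letters, so the
  convention on prefixes has no effect. The same function therefore also serves for the last stage
  of \<open>Dl_less\<close>.\<close>

lemma lex_gt_same_length:
  "length u = length v \<Longrightarrow> lex_gt R u v \<Longrightarrow>
    \<exists>r a s b t. u = r @ a # s \<and> v = r @ b # t \<and> length s = length t \<and> R a b"
proof (induction R u v rule: lex_gt.induct)
  case (3 gt z u z' v)
  show ?case
  proof (cases "gt z z'")
    case True
    then show ?thesis using 3 by (intro exI[of _ "[]"]) auto
  next
    case False
    then obtain r a s b t where "u = r @ a # s" "v = r @ b # t" "length s = length t" "gt a b" "z = z'"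
      using 3 by auto
    then show ?thesis by (intro exI[of _ "z # r"]) auto
  qed
qed auto

lemma prm_less_iff:
  "prm_less p q \<longleftrightarrow> deg_prm p < deg_prm q \<or> (\<exists>x y. p = Gen x \<and> q = Gen y \<and> x < y) \<or>
     (\<exists>u v. p = Op u \<and> q = Op v \<and> deg u = deg v \<and> Dl_less u v)"
  by (auto elim: prm_less.cases intro: Dl_less_prm_less.intros)

text \<open>\<open>lex_gt\<close> is used here with \<open>prm_less\<close> in the place of a
  greater-than relation: \<open>lex_gt prm_less u v\<close> then says that \<open>u\<close> is the
  smaller word, which is correct since the lengths agree.\<close>

lemma Dl_less_iff:
  "Dl_less u v \<longleftrightarrow> deg u < deg v \<or> deg u = deg v \<and>
     (length u < length v \<or> length u = length v \<and> lex_gt prm_less u v)"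
proof
  assume "Dl_less u v"
  then show "deg u < deg v \<or> deg u = deg v \<and>
     (length u < length v \<or> length u = length v \<and> lex_gt prm_less u v)"
    by cases (auto intro: lex_gt_decomp)
next
  assume *: "deg u < deg v \<or> deg u = deg v \<and>
     (length u < length v \<or> length u = length v \<and> lex_gt prm_less u v)"
  then consider "deg u < deg v" | "deg u = deg v" "length u < length v"
    | "deg u = deg v" "length u = length v" "lex_gt prm_less u v" by blast
  then show "Dl_less u v"
  proof cases
    case 3
    then obtain r a s b t where "u = r @ a # s" "v = r @ b # t" "length s = length t" "prm_less a b"
      using lex_gt_same_length by blast
    then show ?thesis using 3 by (auto intro: Dl_lex)
  qed (auto intro: Dl_deg Dl_bre)
qed

section \<open>Transitivity, well-foundedness and monotonicity of the order\<close>

lemma Dl_less_deg_le: "Dl_less u v \<Longrightarrow> deg u \<le> deg v"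
  by (auto simp: Dl_less_iff)

lemma prm_less_deg_le: "prm_less p q \<Longrightarrow> deg_prm p \<le> deg_prm q"
  by (auto simp: prm_less_iff)

text \<open>Transitivity is asked of the letters of the three words only, so that the lemma can be
  applied inside an induction on the degree of primes, where it is known just for smaller
  letters.\<close>

lemma lex_gt_trans_on:
  assumes "\<And>a b c. a \<in> set u \<Longrightarrow> b \<in> set v \<Longrightarrow> c \<in> set w \<Longrightarrow> R a b \<Longrightarrow> R b c \<Longrightarrow> R a c"
    and "lex_gt R u v" "lex_gt R v w"
  shows "lex_gt R u w"
  using assms
proof (induction u arbitrary: v w)
  case Nil
  show ?case using Nil(2,3) by (cases v; cases w) simp_all
next
  case (Cons a u)
  obtain b v' where v: "v = b # v'" using Cons.prems(2) by (cases v) auto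
  obtain c w' where w: "w = c # w'" using Cons.prems(3) v by (cases w) auto
  have "lex_gt R u w'" if "lex_gt R u v'" "lex_gt R v' w'"
  proof (rule Cons.IH[OF _ that])
    fix a' b' c' assume "a' \<in> set u" "b' \<in> set v'" "c' \<in> set w'" "R a' b'" "R b' c'"
    then show "R a' c'" by (intro Cons.prems(1)[of a' b' c']) (simp_all add: v w)
  qed
  moreover have "R a b \<Longrightarrow> R b c \<Longrightarrow> R a c" using Cons.prems(1)[of a b c] v w by simp
  ultimately show ?case using Cons.prems(2,3) unfolding v w by auto
qed

lemma deg_prm_le_deg: "p \<in> set u \<Longrightarrow> deg_prm p \<le> deg u"
  by (induction u) auto

lemma prm_less_trans: "prm_less a b \<Longrightarrow> prm_less b c \<Longrightarrow> prm_less a c"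
proof (induction "deg_prm c" arbitrary: a b c rule: less_induct)
  case less
  have le: "deg_prm a \<le> deg_prm b" "deg_prm b \<le> deg_prm c"
    using less.prems prm_less_deg_le by auto
  show ?case
  proof (cases "deg_prm a < deg_prm c")
    case False
    then have eq: "deg_prm a = deg_prm b" "deg_prm b = deg_prm c" using le by auto
    consider x y z where "a = Gen x" "b = Gen y" "c = Gen z" "x < y" "y < z"
      | u v w where "a = Op u" "b = Op v" "c = Op w" "Dl_less u v" "Dl_less v w"
      using less.prems eq unfolding prm_less_iff by auto
    then show ?thesis
    proof cases
      case 1
      then show ?thesis by (auto intro: prm_Gen)
    next
      case 2
      have d: "deg u = deg v" "deg v = deg w" using 2 eq by auto
      have l: "length u \<le> length v" "length v \<le> length w" using 2 d by (auto simp: Dl_less_iff)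
      have "Dl_less u w"
      proof (cases "length u < length w")
        case False
        then have "lex_gt prm_less u v" "lex_gt prm_less v w" using 2 d l by (auto simp: Dl_less_iff)
        then have "lex_gt prm_less u w"
        proof (rule lex_gt_trans_on[rotated])
          fix a' b' c' assume "c' \<in> set w" "prm_less a' b'" "prm_less b' c'"
          \<comment> \<open>A letter of \<open>w\<close> has smaller degree than
            \<open>Op w\<close>, so the induction hypothesis applies to it.\<close>
          moreover from \<open>c' \<in> set w\<close> have "deg_prm c' < deg_prm c" using 2 deg_prm_le_deg by fastforce
          ultimately show "prm_less a' c'" using less.hyps by blast
        qed
        then show ?thesis using False d l by (auto simp: Dl_less_iff)
      qed (use d in \<open>simp add: Dl_less_iff\<close>)
      then show ?thesis using 2 d by (auto intro: prm_Op)
    qed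
  qed (rule prm_deg)
qed

lemma Dl_less_trans: "Dl_less u v \<Longrightarrow> Dl_less v w \<Longrightarrow> Dl_less u w"
proof -
  assume a: "Dl_less u v" "Dl_less v w"
  have "lex_gt prm_less u v \<Longrightarrow> lex_gt prm_less v w \<Longrightarrow> lex_gt prm_less u w"
    using lex_gt_trans_on[of u v w prm_less, OF prm_less_trans] by this
  then show "Dl_less u w" using a unfolding Dl_less_iff by linarith
qed

text \<open>The two orders are mutually recursive, and the degree bound \<open>n\<close> breaks the
  circle: the letters of a word of degree at most \<open>n\<close> have degree at most
  \<open>n\<close>, and the argument of a prime of degree at most \<open>n + 1\<close> has degree at
  most \<open>n\<close>.\<close>

lemma wf_prm_less_bounded: "wf {(p, q :: 'x::wellorder prm). prm_less p q \<and> deg_prm q \<le> n}"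
  and wf_Dl_less_bounded: "wf {(u, v :: 'x word). Dl_less u v \<and> deg v \<le> n}"
proof -
  let ?P = "\<lambda>n. {(p, q::'x prm). prm_less p q \<and> deg_prm q \<le> n}"
  let ?D = "\<lambda>n. {(u, v::'x word). Dl_less u v \<and> deg v \<le> n}"
  have D: "wf (?D n)" if P: "wf (?P n)" for n
  proof (rule wf_subset)
    show "wf (inv_image (less_than <*lex*> lenlex (?P n)) (\<lambda>u. (deg u, u)))"
      using P by (intro wf_inv_image wf_lex_prod wf_less_than wf_lenlex)
    show "?D n \<subseteq> inv_image (less_than <*lex*> lenlex (?P n)) (\<lambda>u. (deg u, u))"
    proof (clarify)
      fix u v :: "'x word" assume a: "Dl_less u v" "deg v \<le> n"
      show "(u, v) \<in> inv_image (less_than <*lex*> lenlex (?P n)) (\<lambda>u. (deg u, u))"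
        using a(1)
      proof cases
        case (Dl_lex r p s q t)
        have "deg_prm q \<le> n" using a(2) Dl_lex by auto
        then have "(p, q) \<in> ?P n" using Dl_lex by simp
        then have "(r @ p # s, r @ q # t) \<in> lex (?P n)"
          using \<open>length s = length t\<close> by (induction r) simp_all
        then have "(u, v) \<in> lenlex (?P n)"
          using Dl_lex(1,2,4) unfolding lenlex_conv by simp
        then show ?thesis using Dl_lex(3) by (simp add: Dl_lex(1,2))
      qed (auto simp: lenlex_conv)
    qed
  qed
  have P: "wf (?P n)" for n
  proof (induction n)
    case 0
    have "deg_prm q \<noteq> 0" for q :: "'x prm" using deg_prm_pos[of q] by simp
    then have e: "?P 0 = {}" by simp
    show ?case unfolding e by simp
  next
    case (Suc n)
    \<comment> \<open>A generator and an operator prime are comparable by degree only, so in the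
      pairs of \<open>?P\<close> of equal degree the dummy entries \<open>[]\<close> and
      \<open>undefined\<close> meet only each other.\<close>
    let ?R = "inv_image (less_than <*lex*> {(x::'x, y). x < y} <*lex*> ?D n)
      (\<lambda>p. case p of Gen x \<Rightarrow> (deg_prm p, x, []) | Op u \<Rightarrow> (deg_prm p, undefined, u))"
    show ?case
    proof (rule wf_subset)
      show "wf ?R" using D[OF Suc.IH] by (intro wf_inv_image wf_lex_prod wf_less_than wf)
      show "?P (Suc n) \<subseteq> ?R"
        unfolding prm_less_iff by (auto split: prm.splits)
    qed
  qed
  show "wf (?P n)" by (rule P)
  show "wf (?D n)" by (rule D[OF P])
qed

text \<open>A word below \<open>z\<close> has at most the degree of \<open>z\<close>, so a minimal
  element may be sought among the words of bounded degree.\<close>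

lemma wf_Dl_less: "wf {(u, v). Dl_less u v}"
proof (rule wfI_min)
  fix z and Q :: "'x::wellorder word set" assume z: "z \<in> Q"
  obtain m where m0: "m \<in> {u \<in> Q. deg u \<le> deg z}"
    "\<And>y. (y, m) \<in> {(u, v). Dl_less u v \<and> deg v \<le> deg z} \<Longrightarrow> y \<notin> {u \<in> Q. deg u \<le> deg z}"
    by (rule wfE_min[OF wf_Dl_less_bounded[of "deg z"], of z "{u \<in> Q. deg u \<le> deg z}"])
      (use z in simp_all)
  then have m: "m \<in> Q" "deg m \<le> deg z" by simp_all
  have "y \<notin> Q" if "Dl_less y m" for y
    using m0(2)[of y] Dl_less_deg_le[OF that] m(2) that by simp
  then show "\<exists>m\<in>Q. \<forall>y. (y, m) \<in> {(u, v). Dl_less u v} \<longrightarrow> y \<notin> Q" using m(1) by blast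
qed

lemma Dl_less_irrefl [simp]: "\<not> Dl_less u u"
  using wf_not_refl[OF wf_Dl_less] by auto

lemma prm_less_irrefl [simp]: "\<not> prm_less p p"
  by (cases p) (auto simp: prm_less_iff)

text \<open>Together with \<open>Dl_less_Op\<close> this makes the order monomial: degree and
  breadth are additive, and the first differing letters stay aligned since both sides receive the
  same context.\<close>

lemma Dl_less_context: "Dl_less u v \<Longrightarrow> Dl_less (a @ u @ b) (a @ v @ b)"
proof (induction rule: Dl_less_prm_less.inducts(1)[where ?P2.0 = "\<lambda>_ _. True"])
  case (Dl_lex r p s q t)
  then show ?case using Dl_less_prm_less.Dl_lex[of "a @ r" p "s @ b" q "t @ b"] by simp
qed (auto simp: Dl_less_iff)

lemma Dl_less_Op: "Dl_less u v \<Longrightarrow> Dl_less [Op u] [Op v]"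
  using Dl_less_deg_le[of u v] by (auto simp: Dl_less_iff prm_less_iff)

lemma Dl_less_append_mono:
  assumes "Dl_less u u' \<or> u = u'" "Dl_less v v' \<or> v = v'" "u \<noteq> u' \<or> v \<noteq> v'"
  shows "Dl_less (u @ v) (u' @ v')"
proof -
  have 1: "Dl_less (u @ v) (u' @ v) \<or> u = u'"
    using assms(1) Dl_less_context[of u u' "[]" v] by auto
  have 2: "Dl_less (u' @ v) (u' @ v') \<or> v = v'"
    using assms(2) Dl_less_context[of v v' u' "[]"] by auto
  show ?thesis using 1 2 assms(3) Dl_less_trans[of "u @ v" "u' @ v" "u' @ v'"] by auto
qed

section \<open>Words over a set of generators\<close>

text \<open>Membership in \<open>omega_words\<close> without levels; demanding nonempty arguments
  hereditarily is what excludes \<open>Op []\<close>. Quantifying over a mapped list is the shape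
  that primitive recursion through lists takes.\<close>

primrec prm_over :: "'x set \<Rightarrow> 'x prm \<Rightarrow> bool" where
  "prm_over X (Gen x) \<longleftrightarrow> x \<in> X"
| "prm_over X (Op u) \<longleftrightarrow> u \<noteq> [] \<and> (\<forall>b \<in> set (map (prm_over X) u). b)"

definition word_over :: "'x set \<Rightarrow> 'x word \<Rightarrow> bool" where
  "word_over X u \<longleftrightarrow> (\<forall>p \<in> set u. prm_over X p)"

lemma prm_over_Op [simp]: "prm_over X (Op u) \<longleftrightarrow> u \<noteq> [] \<and> word_over X u"
  by (simp add: word_over_def)

declare prm_over.simps(2) [simp del]

lemma word_over_simps [simp]:
  "word_over X []"
  "word_over X (p # u) \<longleftrightarrow> prm_over X p \<and> word_over X u"
  "word_over X (u @ v) \<longleftrightarrow> word_over X u \<and> word_over X v"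
  by (auto simp: word_over_def)

lemma prm_over_mono: "prm_over X p \<Longrightarrow> X \<subseteq> Y \<Longrightarrow> prm_over Y p"
  by (induction p) (auto simp: word_over_def)

lemma word_over_mono: "word_over X u \<Longrightarrow> X \<subseteq> Y \<Longrightarrow> word_over Y u"
  using prm_over_mono[of X _ Y] by (auto simp: word_over_def)

lemma omega_words_n_Suc: "omega_words_n X n \<subseteq> omega_words_n X (Suc n)"
proof (induction n)
  case (Suc n)
  then have "Gen ` X \<union> Op ` omega_words_n X n \<subseteq> Gen ` X \<union> Op ` omega_words_n X (Suc n)"
    by blast
  then show ?case unfolding omega_words_n.simps(2) nonempty_words_def by blast
qed (auto simp: nonempty_words_def)

lemma omega_words_n_mono: "m \<le> n \<Longrightarrow> omega_words_n X m \<subseteq> omega_words_n X n"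
  using omega_words_n_Suc by (rule lift_Suc_mono_le)

lemma omega_words_n_over: "u \<in> omega_words_n X n \<Longrightarrow> u \<noteq> [] \<and> word_over X u"
proof (induction n arbitrary: u)
  case (Suc n)
  have u: "u \<noteq> []" "set u \<subseteq> Gen ` X \<union> Op ` omega_words_n X n"
    using Suc.prems by (auto simp: nonempty_words_def)
  have "prm_over X p" if "p \<in> set u" for p
    using u(2) that Suc.IH by auto
  then show ?case using u(1) by (simp add: word_over_def)
next
  case 0
  then have u: "u \<noteq> []" "set u \<subseteq> Gen ` X" by (auto simp: nonempty_words_def)
  have "prm_over X p" if "p \<in> set u" for p
    using u(2) that by auto
  then show ?case using u(1) by (simp add: word_over_def)
qed

lemma finite_bounded_level:
  assumes "finite A" "\<forall>a\<in>A. \<exists>n. a \<in> F (n::nat)" "\<And>m n. m \<le> n \<Longrightarrow> F m \<subseteq> F n"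
  shows "\<exists>n. A \<subseteq> F n"
  using assms(1,2)
proof (induction rule: finite_induct)
  case (insert a A)
  then obtain m n where "a \<in> F m" "A \<subseteq> F n" by auto
  then show ?case using assms(3)[of m "max m n"] assms(3)[of n "max m n"]
    by (intro exI[of _ "max m n"]) auto
qed simp

lemma omega_words_iff: "u \<in> omega_words X \<longleftrightarrow> u \<noteq> [] \<and> word_over X u"
proof
  assume "u \<in> omega_words X"
  then show "u \<noteq> [] \<and> word_over X u" unfolding omega_words_def using omega_words_n_over by blast
next
  let ?F = "\<lambda>n. Gen ` X \<union> Op ` omega_words_n X n"
  have mono: "?F m \<subseteq> ?F n" if "m \<le> n" for m n
    using omega_words_n_mono[OF that, of X] by auto
  have word: "\<exists>n. u \<in> omega_words_n X n"
    if ne: "\<forall>p\<in>set u. \<exists>n. p \<in> ?F n" "u \<noteq> []" for u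
  proof -
    obtain n where "set u \<subseteq> ?F n"
      using finite_bounded_level[of "set u" ?F, OF finite_set ne(1) mono] by blast
    then show ?thesis using ne(2) by (intro exI[of _ "Suc n"]) (simp add: nonempty_words_def)
  qed
  have prm: "\<exists>n. p \<in> ?F n" if "prm_over X p" for p
    using that
  proof (induction p)
    case (Op u)
    then have "\<exists>n. u \<in> omega_words_n X n" by (intro word) (auto simp: word_over_def)
    then show ?case by auto
  qed auto
  assume "u \<noteq> [] \<and> word_over X u"
  then show "u \<in> omega_words X" using word[of u] prm by (auto simp: word_over_def omega_words_def)
qed

lemma lex_gt_total_on:
  "length u = length v \<Longrightarrow> (\<And>p q. p \<in> set u \<Longrightarrow> q \<in> set v \<Longrightarrow> p = q \<or> R p q \<or> R q p) \<Longrightarrow>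
    u = v \<or> lex_gt R u v \<or> lex_gt R v u"
proof (induction u v rule: list_induct2)
  case (Cons a u b v)
  have "u = v \<or> lex_gt R u v \<or> lex_gt R v u" by (rule Cons.IH) (use Cons.prems in auto)
  then show ?case using Cons.prems[of a b] by auto
qed simp

text \<open>The restriction to \<open>prm_over\<close> matters: \<open>Op []\<close> has degree 1
  like a generator and is comparable with no generator.\<close>

lemma prm_less_total: "prm_over X p \<Longrightarrow> prm_over X q \<Longrightarrow> p = q \<or> prm_less p q \<or> prm_less q p"
proof (induction p arbitrary: q)
  case (Gen x)
  show ?case
  proof (cases q)
    case (Op v)
    then obtain r v' where "v = r # v'" using Gen by (cases v) auto
    then show ?thesis using Op deg_prm_pos[of r] by (auto simp: prm_less_iff)
  qed (auto simp: prm_less_iff)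
next
  case (Op u)
  show ?case
  proof (cases q)
    case (Gen y)
    then obtain r u' where "u = r # u'" using Op by (cases u) auto
    then show ?thesis using Gen deg_prm_pos[of r] by (auto simp: prm_less_iff)
  next
    case q: (Op v)
    have "u = v \<or> lex_gt prm_less u v \<or> lex_gt prm_less v u" if "length u = length v"
      by (rule lex_gt_total_on[OF that]) (use Op q in \<open>auto simp: word_over_def\<close>)
    then have "u = v \<or> Dl_less u v \<or> Dl_less v u"
      unfolding Dl_less_iff by linarith
    then show ?thesis unfolding q prm_less_iff using Dl_less_deg_le[of u v] Dl_less_deg_le[of v u]
      by (auto simp: less_le)
  qed
qed

lemma Dl_less_total:
  assumes "word_over X u" "word_over X v"
  shows "u = v \<or> Dl_less u v \<or> Dl_less v u"
proof -
  have "u = v \<or> lex_gt prm_less u v \<or> lex_gt prm_less v u" if "length u = length v"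
    by (rule lex_gt_total_on[OF that], rule prm_less_total[of X])
      (use assms in \<open>auto simp: word_over_def\<close>)
  then show ?thesis unfolding Dl_less_iff by linarith
qed

section \<open>Lyndon-Shirshov words\<close>

lemma lex_gt_append_same [simp]:
  "(\<And>z. \<not> gt z z) \<Longrightarrow> lex_gt gt (a @ u) (a @ v) = lex_gt gt u v"
  by (induction a) auto

lemma lex_gt_append_right: "v \<noteq> [] \<Longrightarrow> lex_gt gt u (u @ v)"
  by (induction u) auto

text \<open>A word exceeds its proper extensions, and inequalities of this kind are the only ones
  that appending further letters can destroy.\<close>

lemma lex_gt_prefix_or_strong:
  "lex_gt gt u v \<Longrightarrow> (\<exists>x. x \<noteq> [] \<and> v = u @ x) \<or> (\<forall>a b. lex_gt gt (u @ a) (v @ b))"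
  by (induction gt u v rule: lex_gt.induct) auto

text \<open>The suffix form of the Lyndon condition; \<open>alsw_iff\<close> identifies it with the
  rotation form of \<open>alsw\<close>. The order \<open>lex_gt\<close> is the usual lexicographic
  order reversed, prefixes included, so the classical theory of words smaller than their proper
  suffixes applies with all inequalities turned round.\<close>

definition lyndon :: "('z \<Rightarrow> 'z \<Rightarrow> bool) \<Rightarrow> 'z list \<Rightarrow> bool" where
  "lyndon gt w \<longleftrightarrow> w \<noteq> [] \<and> (\<forall>u v. w = u @ v \<and> u \<noteq> [] \<and> v \<noteq> [] \<longrightarrow> lex_gt gt w v)"

lemma lyndon_not_Nil: "lyndon gt w \<Longrightarrow> w \<noteq> []"
  by (simp add: lyndon_def)

lemma lyndon_Nil [simp]: "\<not> lyndon gt []"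
  by (simp add: lyndon_def)

lemma lyndon_suffix: "lyndon gt (u @ v) \<Longrightarrow> u \<noteq> [] \<Longrightarrow> v \<noteq> [] \<Longrightarrow> lex_gt gt (u @ v) v"
  by (auto simp: lyndon_def)

lemma lyndon_single [simp]: "lyndon gt [z]"
  by (auto simp: lyndon_def append_eq_Cons_conv Cons_eq_append_conv)

text \<open>Totality is confined to \<open>Z\<close> because the type of primes contains junk that
  the order leaves incomparable.\<close>

locale letter_order =
  fixes gt :: "'z \<Rightarrow> 'z \<Rightarrow> bool" and Z :: "'z set"
  assumes irrefl: "\<not> gt z z"
    and trans: "gt x y \<Longrightarrow> gt y z \<Longrightarrow> gt x z"
    and total: "x \<in> Z \<Longrightarrow> y \<in> Z \<Longrightarrow> x = y \<or> gt x y \<or> gt y x"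
begin

abbreviation lgt (infix \<open>\<ggreater>\<close> 50) where "u \<ggreater> v \<equiv> lex_gt gt u v"

lemma lex_irrefl: "\<not> u \<ggreater> u"
  by (induction u) (auto simp: irrefl)

lemma lex_trans: "u \<ggreater> v \<Longrightarrow> v \<ggreater> w \<Longrightarrow> u \<ggreater> w"
proof (induction u arbitrary: v w)
  case (Cons z u)
  then obtain y v' where v: "v = y # v'" by (cases v) auto
  then obtain x w' where w: "w = x # w'" using Cons.prems by (cases w) auto
  show ?case using Cons.prems Cons.IH[of v' w'] trans[of z y x] unfolding v w by auto
next
  case Nil
  then show ?case by (cases v; cases w) auto
qed

lemma lex_total: "set u \<subseteq> Z \<Longrightarrow> set v \<subseteq> Z \<Longrightarrow> u = v \<or> u \<ggreater> v \<or> v \<ggreater> u"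
proof (induction u arbitrary: v)
  case (Cons z u)
  then show ?case using total by (cases v) auto
qed auto

lemma lex_asym: "u \<ggreater> v \<Longrightarrow> \<not> v \<ggreater> u"
  using lex_irrefl lex_trans by blast

lemma lex_append_same [simp]: "a @ u \<ggreater> a @ v \<longleftrightarrow> u \<ggreater> v"
  by (simp add: irrefl)

lemma lex_cancel_prefix: "u @ x \<ggreater> v \<Longrightarrow> u \<ggreater> v"
  by (metis append_Nil2 lex_gt_append_right lex_trans)

lemma lex_append_smaller: "u \<ggreater> v \<Longrightarrow> u \<ggreater> v @ x"
  by (metis append_Nil2 lex_gt_append_right lex_trans)

lemma lex_le_trans: "lex_le gt u v \<Longrightarrow> lex_le gt v w \<Longrightarrow> lex_le gt u w"
  unfolding lex_le_def using lex_trans[of w v u] by auto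

lemma lex_less_le_trans: "v \<ggreater> u \<Longrightarrow> lex_le gt w u \<Longrightarrow> v \<ggreater> w"
  unfolding lex_le_def using lex_trans[of v u w] by auto

lemma lex_le_append: "lex_le gt u v \<Longrightarrow> x \<noteq> [] \<Longrightarrow> v \<ggreater> u @ x"
  unfolding lex_le_def using lex_append_smaller lex_gt_append_right by blast

lemma lex_le_imp_not_gt: "lex_le gt u v \<Longrightarrow> \<not> u \<ggreater> v"
  unfolding lex_le_def using lex_asym lex_irrefl by blast

lemma lex_strong: "u \<ggreater> v \<Longrightarrow> length v \<le> length u \<Longrightarrow> u @ a \<ggreater> v @ b"
  using lex_gt_prefix_or_strong[of gt u v] by auto

lemma lyndon_rotation:
  assumes "lyndon gt (u @ v)" "u \<noteq> []" "v \<noteq> []"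
  shows "u @ v \<ggreater> v @ u"
  using lex_strong[OF lyndon_suffix[OF assms], of "[]" u] assms by simp

text \<open>Suppose a proper suffix \<open>v\<close> of \<open>w = uv\<close> exceeds
  \<open>w\<close>. If they differ at a letter, \<open>vu\<close> exceeds \<open>uv\<close>.
  Otherwise \<open>w = vx\<close> with \<open>x\<close> as long as \<open>u\<close>; cancelling
  \<open>v\<close> from \<open>uv > vu\<close> gives \<open>x > u\<close>, hence
  \<open>xv > uv = vx\<close>, against the rotation \<open>vx > xv\<close>.\<close>

lemma rotation_imp_lyndon:
  assumes Z: "set w \<subseteq> Z" and "w \<noteq> []"
    and rot: "\<And>u v. w = u @ v \<Longrightarrow> u \<noteq> [] \<Longrightarrow> v \<noteq> [] \<Longrightarrow> u @ v \<ggreater> v @ u"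
  shows "lyndon gt w"
  unfolding lyndon_def
proof (intro conjI allI impI)
  fix u v assume uv: "w = u @ v \<and> u \<noteq> [] \<and> v \<noteq> []"
  show "w \<ggreater> v"
  proof (rule ccontr)
    assume "\<not> w \<ggreater> v"
    moreover have "w \<noteq> v" using uv by auto
    ultimately have vw: "v \<ggreater> w" using lex_total[of w v] Z uv by auto
    have r: "u @ v \<ggreater> v @ u" using rot uv by blast
    consider x where "x \<noteq> []" "w = v @ x" | "v @ u \<ggreater> w @ []"
      using lex_gt_prefix_or_strong[OF vw] by blast
    then show False
    proof cases
      case 1
      then have len: "length x = length u"
      proof -
        have "length (u @ v) = length (v @ x)" using uv 1 by metis
        then show ?thesis by simp
      qed
      have "x \<ggreater> u" using r 1 uv by (metis lex_append_same)
      then have "x @ v \<ggreater> u @ v" using lex_strong len by simp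
      moreover have "v @ x \<ggreater> x @ v" using rot 1 uv by blast
      ultimately show False using 1 uv lex_asym[of "x @ v" "u @ v"] by simp
    next
      case 2
      then show False using r uv lex_asym by auto
    qed
  qed
qed (use assms in auto)

lemma alsw_iff: "w \<in> alsw gt Z \<longleftrightarrow> set w \<subseteq> Z \<and> lyndon gt w"
  using lyndon_rotation rotation_imp_lyndon lyndon_not_Nil
  unfolding alsw_def nonempty_words_def by blast

lemma lyndon_append:
  assumes u: "lyndon gt u" and v: "lyndon gt v" and uv: "u \<ggreater> v"
  shows "lyndon gt (u @ v)"
proof -
  \<comment> \<open>If \<open>v = ux\<close>, then \<open>v > x\<close> because \<open>v\<close> is
    Lyndon, and prefixing \<open>u\<close> gives \<open>uv > v\<close>.\<close>
  have uvv: "u @ v \<ggreater> v"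
    using lex_gt_prefix_or_strong[OF uv]
  proof
    assume "\<exists>x. x \<noteq> [] \<and> v = u @ x"
    then obtain x where "x \<noteq> []" "v = u @ x" by blast
    then show ?thesis using lyndon_suffix[of gt u x] v lyndon_not_Nil[OF u] by simp
  qed (metis append_Nil2)
  show ?thesis
    unfolding lyndon_def
  proof (intro conjI allI impI)
    fix a b assume ab: "u @ v = a @ b \<and> a \<noteq> [] \<and> b \<noteq> []"
    then consider c where "u = a @ c" "b = c @ v" | c where "a = u @ c" "v = c @ b"
      by (auto simp: append_eq_append_conv2)
    then show "u @ v \<ggreater> b"
    proof cases
      case 1
      show ?thesis
      proof (cases "c = []")
        case False
        then have "u \<ggreater> c" using 1 ab lyndon_suffix u by metis
        \<comment> \<open>The suffix \<open>c\<close> is shorter than \<open>u\<close>, so the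
          inequality survives appending \<open>v\<close> on both sides.\<close>
        then show ?thesis using lex_strong[of u c v v] 1 by simp
      qed (use uvv 1 in simp)
    next
      case 2
      show ?thesis
      proof (cases "c = []")
        case False
        then have "v \<ggreater> b" using 2 ab lyndon_suffix v by metis
        then show ?thesis using uvv lex_trans by blast
      qed (use uvv 2 in simp)
    qed
  qed (use lyndon_not_Nil[OF u] in simp)
qed

lemma lyndon_gt_of_append:
  assumes "lyndon gt (u @ v)" "set u \<subseteq> Z" "set v \<subseteq> Z" "u \<noteq> []" "v \<noteq> []"
  shows "u \<ggreater> v"
  using lex_cancel_prefix lyndon_suffix assms by blast

lemma finite_lex_max:
  assumes "finite A" "A \<noteq> {}" "\<And>x. x \<in> A \<Longrightarrow> set x \<subseteq> Z"
  shows "\<exists>m\<in>A. \<forall>x\<in>A. x \<noteq> m \<longrightarrow> m \<ggreater> x"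
  using assms
proof (induction rule: finite_ne_induct)
  case (singleton a)
  show ?case by (intro bexI[of _ a]) simp_all
next
  case (insert a A)
  have "\<exists>m\<in>A. \<forall>x\<in>A. x \<noteq> m \<longrightarrow> m \<ggreater> x" by (rule insert.IH) (simp add: insert.prems)
  then obtain m where m: "m \<in> A" "\<forall>x\<in>A. x \<noteq> m \<longrightarrow> m \<ggreater> x" by blast
  have "a \<noteq> m" using insert.hyps m by blast
  moreover have "set a \<subseteq> Z" "set m \<subseteq> Z" using m(1) by (simp_all add: insert.prems)
  ultimately consider "a \<ggreater> m" | "m \<ggreater> a" using lex_total[of a m] by blast
  then show ?case
  proof cases
    case 1
    have "a \<ggreater> x" if "x \<in> A" for x
      using m(2) 1 lex_trans[OF 1, of x] that by (cases "x = m") simp_all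
    then show ?thesis by (intro bexI[of _ a]) simp_all
  next
    case 2
    then show ?thesis using m by (intro bexI[of _ m]) simp_all
  qed
qed

section \<open>Greatest proper suffixes and the standard factorization\<close>

definition proper_suffix :: "'z list \<Rightarrow> 'z list \<Rightarrow> bool" where
  "proper_suffix s w \<longleftrightarrow> s \<noteq> [] \<and> (\<exists>u. u \<noteq> [] \<and> w = u @ s)"

text \<open>In a Lyndon word this is the right factor of the standard factorization.\<close>

definition max_suffix :: "'z list \<Rightarrow> 'z list \<Rightarrow> bool" where
  "max_suffix s w \<longleftrightarrow> proper_suffix s w \<and> (\<forall>x. proper_suffix x w \<longrightarrow> lex_le gt x s)"

lemma max_suffix_unique: "max_suffix s w \<Longrightarrow> max_suffix s' w \<Longrightarrow> s = s'"
  unfolding max_suffix_def lex_le_def using lex_asym by blast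

lemma max_suffix_exists:
  assumes "set w \<subseteq> Z" "length w \<ge> 2"
  shows "\<exists>s. max_suffix s w"
proof -
  have eq: "{s. proper_suffix s w} \<subseteq> (\<lambda>n. drop n w) ` {..length w}"
  proof
    fix s assume "s \<in> {s. proper_suffix s w}"
    then obtain u where "w = u @ s" by (auto simp: proper_suffix_def)
    then show "s \<in> (\<lambda>n. drop n w) ` {..length w}" by (intro image_eqI[of _ _ "length u"]) auto
  qed
  obtain a b v where w: "w = a # b # v" using assms(2) by (cases w; cases "tl w") auto
  have "proper_suffix (b # v) w" unfolding proper_suffix_def w by (auto intro: exI[of _ "[a]"])
  then have ne: "{s. proper_suffix s w} \<noteq> {}" by blast
  have "\<And>x. x \<in> {s. proper_suffix s w} \<Longrightarrow> set x \<subseteq> Z"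
    using assms(1) by (auto simp: proper_suffix_def)
  from finite_lex_max[OF finite_subset[OF eq] ne this] obtain m where
    "proper_suffix m w" "\<forall>x. proper_suffix x w \<longrightarrow> x \<noteq> m \<longrightarrow> m \<ggreater> x" by auto
  then show ?thesis unfolding max_suffix_def lex_le_def by blast
qed

lemma max_suffix_lyndon:
  assumes "max_suffix v w" shows "lyndon gt v"
proof -
  obtain a where a: "a \<noteq> []" "w = a @ v" "v \<noteq> []"
    and m: "\<And>x. proper_suffix x w \<Longrightarrow> lex_le gt x v"
    using assms by (auto simp: max_suffix_def proper_suffix_def)
  show ?thesis unfolding lyndon_def
  proof (intro conjI allI impI)
    fix p q assume pq: "v = p @ q \<and> p \<noteq> [] \<and> q \<noteq> []"
    then have "proper_suffix q w" unfolding proper_suffix_def using a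
      by (auto intro!: exI[of _ "a @ p"])
    moreover have "q \<noteq> v" using pq by auto
    ultimately show "v \<ggreater> q" using m unfolding lex_le_def by blast
  qed (use a in simp)
qed

text \<open>Let \<open>s\<close> be a proper suffix of \<open>u\<close> with \<open>s > u\<close>. A
  difference at a letter would give \<open>sv > uv\<close>, although \<open>uv\<close> is Lyndon; if
  \<open>u = st\<close>, cancelling \<open>s\<close> from \<open>uv > sv\<close> yields
  \<open>tv > v\<close>, against the maximality of \<open>v\<close>. For the last claim, a Lyndon
  suffix \<open>x > v\<close> of \<open>u\<close> would make \<open>xv\<close> Lyndon, hence a
  suffix greater than \<open>v\<close>.\<close>

lemma standard_factorization:
  assumes w: "lyndon gt (u @ v)" and Z: "set (u @ v) \<subseteq> Z" and m: "max_suffix v (u @ v)"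
  shows "u \<noteq> []" "lyndon gt u" "lyndon gt v" "u \<ggreater> v"
    "\<And>x. proper_suffix x u \<Longrightarrow> lyndon gt x \<Longrightarrow> lex_le gt x v"
proof -
  have u: "u \<noteq> []" and v: "v \<noteq> []"
    and mx: "\<And>x. proper_suffix x (u @ v) \<Longrightarrow> lex_le gt x v"
    using m by (auto simp: max_suffix_def proper_suffix_def)
  show "u \<noteq> []" by fact
  show lv: "lyndon gt v" using max_suffix_lyndon m by blast
  show ugv: "u \<ggreater> v" using lyndon_gt_of_append w Z u v by auto
  show "lyndon gt u" unfolding lyndon_def
  proof (intro conjI allI impI)
    fix r s assume rs: "u = r @ s \<and> r \<noteq> [] \<and> s \<noteq> []"
    have wsv: "u @ v \<ggreater> s @ v" using lyndon_suffix[of gt r "s @ v"] w rs v by auto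
    show "u \<ggreater> s"
    proof (rule ccontr)
      assume "\<not> u \<ggreater> s"
      moreover have "u \<noteq> s" using rs by auto
      ultimately have "s \<ggreater> u" using lex_total[of u s] Z rs by auto
      then consider t where "t \<noteq> []" "u = s @ t" | "s @ v \<ggreater> u @ v"
        using lex_gt_prefix_or_strong by blast
      then show False
      proof cases
        case 1
        then have "t @ v \<ggreater> v" using wsv by (metis append_assoc lex_append_same)
        moreover have "proper_suffix (t @ v) (u @ v)"
          using 1 rs v by (auto simp: proper_suffix_def)
        ultimately show False using mx lex_le_imp_not_gt by blast
      qed (use wsv lex_asym in blast)
    qed
  qed fact
  fix x assume x: "proper_suffix x u" "lyndon gt x"
  then obtain r where r: "u = r @ x" "r \<noteq> []" "x \<noteq> []" by (auto simp: proper_suffix_def)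
  show "lex_le gt x v"
  proof (rule ccontr)
    assume "\<not> lex_le gt x v"
    then have "x \<ggreater> v" using lex_total[of x v] Z r by (auto simp: lex_le_def)
    then have "x @ v \<ggreater> v"
      using lyndon_append[OF x(2) lv] lyndon_suffix v r by blast
    moreover have "proper_suffix (x @ v) (u @ v)" using r v by (auto simp: proper_suffix_def)
    ultimately show False using mx lex_le_imp_not_gt by blast
  qed
qed

section \<open>Existence and uniqueness of the standard bracketing\<close>

lemma underlying_not_Nil [simp]: "underlying t \<noteq> []"
  by (induction t) auto

lemma is_nlsw_iff:
  "is_nlsw gt Z (Letter z) \<longleftrightarrow> z \<in> Z"
  "is_nlsw gt Z (Br s t) \<longleftrightarrow> set (underlying (Br s t)) \<subseteq> Z \<and> lyndon gt (underlying (Br s t)) \<and>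
     is_nlsw gt Z s \<and> is_nlsw gt Z t \<and>
     (\<forall>s1 s2. s = Br s1 s2 \<longrightarrow> lex_le gt (underlying s2) (underlying t))"
  by (simp_all add: alsw_iff)

lemma is_nlsw_lyndon: "is_nlsw gt Z t \<Longrightarrow> lyndon gt (underlying t) \<and> set (underlying t) \<subseteq> Z"
  by (cases t) (auto simp: alsw_iff)

text \<open>This is why the bracketing is unique: the cut at the root is determined by the word. A
  suffix that reaches into the left factor has the form \<open>ct\<close> with
  \<open>c \<le> s2\<close> by induction and \<open>s2 \<le> t\<close> by the condition on
  bracketings, and appending \<open>t\<close> to \<open>c\<close> only lowers it.\<close>

lemma nlsw_max_suffix: "is_nlsw gt Z (Br s t) \<Longrightarrow> max_suffix (underlying t) (underlying (Br s t))"
proof (induction s arbitrary: t)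
  case (Letter z)
  have lt: "lyndon gt (underlying t)" using Letter is_nlsw_lyndon by auto
  show ?case unfolding max_suffix_def
  proof (intro conjI allI impI)
    show "proper_suffix (underlying t) (underlying (Br (Letter z) t))"
      by (auto simp: proper_suffix_def)
    fix x assume "proper_suffix x (underlying (Br (Letter z) t))"
    then obtain u where u: "z # underlying t = u @ x" "u \<noteq> []" "x \<noteq> []"
      by (auto simp: proper_suffix_def)
    then obtain u' where "underlying t = u' @ x" by (auto simp: Cons_eq_append_conv)
    then show "lex_le gt x (underlying t)"
      using lyndon_suffix[of gt u' x] lt u by (cases "u' = []") (auto simp: lex_le_def)
  qed
next
  case (Br s1 s2)
  have lt: "lyndon gt (underlying t)" using Br is_nlsw_lyndon by auto
  have m: "max_suffix (underlying s2) (underlying (Br s1 s2))"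
    using Br.IH(1) Br.prems by auto
  have le: "lex_le gt (underlying s2) (underlying t)" using Br.prems by auto
  show ?case unfolding max_suffix_def
  proof (intro conjI allI impI)
    show "proper_suffix (underlying t) (underlying (Br (Br s1 s2) t))"
      by (auto simp: proper_suffix_def)
    fix x assume "proper_suffix x (underlying (Br (Br s1 s2) t))"
    then obtain u where u: "underlying (Br s1 s2) @ underlying t = u @ x" "u \<noteq> []" "x \<noteq> []"
      by (auto simp: proper_suffix_def)
    consider c where "underlying t = c @ x"
      | c where "c \<noteq> []" "underlying (Br s1 s2) = u @ c" "x = c @ underlying t"
      by (metis (no_types) append_eq_append_cases[OF u(1)])
    then show "lex_le gt x (underlying t)"
    proof cases
      case 1
      then show ?thesis
        using lyndon_suffix[of gt c x] lt u by (cases "c = []") (auto simp: lex_le_def)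
    next
      case 2
      then have "proper_suffix c (underlying (Br s1 s2))" using u by (auto simp: proper_suffix_def)
      then have "lex_le gt c (underlying s2)" using m by (auto simp: max_suffix_def)
      then have "lex_le gt c (underlying t)" using le lex_le_trans by blast
      then show ?thesis using 2 lex_le_append[OF _ underlying_not_Nil] by (simp add: lex_le_def)
    qed
  qed
qed

lemma nlsw_unique:
  "is_nlsw gt Z s \<Longrightarrow> is_nlsw gt Z t \<Longrightarrow> underlying s = underlying t \<Longrightarrow> s = t"
proof (induction s arbitrary: t)
  case (Letter z)
  then show ?case by (cases t) (auto simp: Cons_eq_append_conv)
next
  case (Br s1 s2)
  show ?case
  proof (cases t)
    case (Letter z)
    then show ?thesis using Br.prems by (auto simp: append_eq_Cons_conv)
  next
    case (Br t1 t2)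
    have "underlying s2 = underlying t2"
      by (rule max_suffix_unique[OF nlsw_max_suffix[OF Br.prems(1)]])
        (use nlsw_max_suffix[of t1 t2] Br Br.prems in simp)
    then show ?thesis using Br.IH Br.prems Br by auto
  qed
qed

lemma nlsw_exists:
  "lyndon gt w \<Longrightarrow> set w \<subseteq> Z \<Longrightarrow> \<exists>t. is_nlsw gt Z t \<and> underlying t = w"
proof (induction "length w" arbitrary: w rule: less_induct)
  case less
  show ?case
  proof (cases "length w \<ge> 2")
    case False
    then obtain z where "w = [z]" using lyndon_not_Nil[OF less.prems(1)]
      by (cases w) (auto simp: not_le less_Suc_eq)
    then show ?thesis using less.prems by (intro exI[of _ "Letter z"]) (simp add: alsw_iff)
  next
    case True
    obtain v where v: "max_suffix v w" using max_suffix_exists True less.prems by blast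
    then obtain u where w: "w = u @ v" "u \<noteq> []" "v \<noteq> []" by (auto simp: max_suffix_def proper_suffix_def)
    note f = standard_factorization[of u v, folded w(1), OF less.prems(1,2) v]
    obtain s t where s: "is_nlsw gt Z s" "underlying s = u" and t: "is_nlsw gt Z t" "underlying t = v"
      using less.hyps[of u] less.hyps[of v] f w less.prems by auto
    have "lex_le gt (underlying s2) (underlying t)" if "s = Br s1 s2" for s1 s2
    proof -
      have "proper_suffix (underlying s2) u" using that s by (auto simp: proper_suffix_def)
      moreover have "lyndon gt (underlying s2)" using that s is_nlsw_lyndon by auto
      ultimately show ?thesis using f(5) t by auto
    qed
    then have "is_nlsw gt Z (Br s t)" using s t w less.prems by (auto simp: alsw_iff)
    then show ?thesis using s t w by (intro exI[of _ "Br s t"]) simp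
  qed
qed

lemma std_bracket_spec:
  assumes "lyndon gt w" "set w \<subseteq> Z"
  shows "is_nlsw gt (set w) (std_bracket gt w)" "underlying (std_bracket gt w) = w"
proof -
  interpret W: letter_order gt "set w"
    using assms irrefl trans total by unfold_locales blast+
  have "\<exists>!t. is_nlsw gt (set w) t \<and> underlying t = w"
    using W.nlsw_exists[of w] W.nlsw_unique assms by blast
  from theI'[OF this] show "is_nlsw gt (set w) (std_bracket gt w)" "underlying (std_bracket gt w) = w"
    by (auto simp: std_bracket_def)
qed

lemma is_nlsw_mono:
  assumes "is_nlsw gt Y t" "Y \<subseteq> Z" shows "is_nlsw gt Z t"
  using assms(1)
proof -
  have sub: "w \<in> alsw gt Z" if "w \<in> alsw gt Y" for w
    using that assms(2) by (auto simp: alsw_def nonempty_words_def)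
  show ?thesis using assms(1) by (induction t) (auto intro: sub)
qed

lemma std_bracket_nlsw:
  assumes "lyndon gt w" "set w \<subseteq> Z" shows "is_nlsw gt Z (std_bracket gt w)"
  using std_bracket_spec[OF assms] is_nlsw_mono assms by blast

lemma std_bracket_eq: "is_nlsw gt Z t \<Longrightarrow> std_bracket gt (underlying t) = t"
  using is_nlsw_lyndon[of t] std_bracket_spec[of "underlying t"] std_bracket_nlsw[of "underlying t"]
  by (intro nlsw_unique) auto

lemma std_bracket_single: "z \<in> Z \<Longrightarrow> std_bracket gt [z] = Letter z"
  using std_bracket_eq[of "Letter z"] by (simp add: alsw_iff)

lemma std_bracket_split:
  assumes "lyndon gt w" "set w \<subseteq> Z" "length w \<ge> 2"
  obtains u v where "w = u @ v" "u \<noteq> []" "v \<noteq> []" "lyndon gt u" "lyndon gt v" "u \<ggreater> v"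
    "max_suffix v w" "std_bracket gt w = Br (std_bracket gt u) (std_bracket gt v)"
proof -
  have n: "is_nlsw gt Z (std_bracket gt w)" and uw: "underlying (std_bracket gt w) = w"
    using std_bracket_nlsw std_bracket_spec assms by blast+
  obtain s t where st: "std_bracket gt w = Br s t"
    using uw assms(3) by (cases "std_bracket gt w") auto
  have m: "max_suffix (underlying t) w"
    using nlsw_max_suffix n uw st by auto
  note f = standard_factorization[of "underlying s" "underlying t"]
  show thesis
    by (rule that[of "underlying s" "underlying t"])
      (use f m n uw st std_bracket_eq assms is_nlsw_lyndon in auto)
qed

text \<open>The recursion behind the rewriting of \<open>[[u],[v]]\<close>: if \<open>[u][v]\<close> is not standard, \<open>u\<close> splits.\<close>

lemma std_bracket_append:
  assumes "lyndon gt u" "lyndon gt v" "set u \<subseteq> Z" "set v \<subseteq> Z" "u \<ggreater> v"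
  shows "std_bracket gt (u @ v) = Br (std_bracket gt u) (std_bracket gt v) \<or>
    (\<exists>u1 u2. u = u1 @ u2 \<and> lyndon gt u1 \<and> lyndon gt u2 \<and> u1 \<ggreater> u2 \<and> u2 \<ggreater> v \<and>
       std_bracket gt u = Br (std_bracket gt u1) (std_bracket gt u2))"
proof (cases "length u \<ge> 2 \<and> (\<exists>u1 u2. u = u1 @ u2 \<and> lyndon gt u1 \<and> lyndon gt u2 \<and> u1 \<ggreater> u2 \<and>
    u2 \<ggreater> v \<and> std_bracket gt u = Br (std_bracket gt u1) (std_bracket gt u2))")
  case False
  let ?t = "Br (std_bracket gt u) (std_bracket gt v)"
  have U: "underlying (std_bracket gt u) = u" "underlying (std_bracket gt v) = v"
    using std_bracket_spec assms by blast+
  have "lex_le gt (underlying s2) v" if s: "std_bracket gt u = Br s1 s2" for s1 s2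
  proof -
    have len: "length u \<ge> 2"
    proof -
      have "u = underlying s1 @ underlying s2" using s U(1) by simp
      moreover have "length (underlying s1) \<ge> 1" "length (underlying s2) \<ge> 1"
        by (simp_all add: Suc_le_eq)
      ultimately show ?thesis by simp
    qed
    obtain u1 u2 where u12: "u = u1 @ u2" "lyndon gt u1" "lyndon gt u2" "u1 \<ggreater> u2"
      "std_bracket gt u = Br (std_bracket gt u1) (std_bracket gt u2)"
      using std_bracket_split[OF assms(1,3) len] by blast
    then have "underlying s2 = u2" using s std_bracket_spec assms by auto
    moreover have "\<not> u2 \<ggreater> v" using False u12 len by blast
    ultimately show ?thesis using lex_total[of u2 v] assms u12 by (auto simp: lex_le_def)
  qed
  then have "is_nlsw gt Z ?t"
    using assms U std_bracket_nlsw lyndon_append by (auto simp: alsw_iff)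
  from std_bracket_eq[OF this] show ?thesis using U by simp
qed blast

text \<open>If \<open>c\<close> is not Lyndon, its greatest proper suffix \<open>s\<close> becomes
  the last factor, and the rest \<open>u\<close> is factored by induction. Were some factor of
  \<open>u\<close> greater than \<open>s\<close>, so would be the last factor \<open>b\<close> of
  \<open>u\<close>; then \<open>bs\<close> is Lyndon and exceeds \<open>s\<close>, so it is either a
  greater proper suffix or all of \<open>c\<close>, both impossible.\<close>

lemma lyndon_factors_exist:
  "set c \<subseteq> Z \<Longrightarrow> \<exists>cs. concat cs = c \<and> (\<forall>d\<in>set cs. lyndon gt d) \<and> sorted_wrt (lex_le gt) cs"
proof (induction "length c" arbitrary: c rule: less_induct)
  case less
  show ?case
  proof (cases "c = []")
    case True
    then show ?thesis by (intro exI[of _ "[]"]) simp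
  next
    case False
    consider "lyndon gt c" | "\<not> lyndon gt c" by blast
    then show ?thesis
    proof cases
      case 1
      then show ?thesis by (intro exI[of _ "[c]"]) simp
    next
      case 2
      then have len: "length c \<ge> 2" using False by (cases c; cases "tl c") auto
      obtain s where s: "max_suffix s c" using max_suffix_exists len less.prems by blast
      then obtain u where u: "c = u @ s" "u \<noteq> []" "s \<noteq> []"
        by (auto simp: max_suffix_def proper_suffix_def)
      obtain cs where cs: "concat cs = u" "\<forall>d\<in>set cs. lyndon gt d" "sorted_wrt (lex_le gt) cs"
        using less.hyps[of u] less.prems u by auto
      have ls: "lyndon gt s" using max_suffix_lyndon s by blast
      have "lex_le gt d s" if d: "d \<in> set cs" for d
      proof -
        obtain cs1 cs2 where e: "cs = cs1 @ d # cs2" using d by (auto simp: in_set_conv_decomp)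
        then have c: "c = concat cs1 @ d @ concat cs2 @ s" using cs u by auto
        have dne: "d \<noteq> []" using cs d lyndon_not_Nil by blast
        show ?thesis
        proof (rule ccontr)
          assume "\<not> lex_le gt d s"
          then have ds: "d \<ggreater> s"
            using lex_total[of d s] less.prems c by (auto simp: lex_le_def)
          define b where "b = last cs"
          have b: "b \<in> set cs" "lex_le gt d b"
            using cs(3) e unfolding b_def by (auto simp: sorted_wrt_append lex_le_def)
          then have bs: "b \<ggreater> s" using b(2) ds lex_trans[of b d s] by (auto simp: lex_le_def)
          have lb: "lyndon gt b" using b cs by blast
          have bs_l: "lyndon gt (b @ s)" using lyndon_append lb ls bs by blast
          define cs' where "cs' = butlast cs"
          have "cs \<noteq> []" using e by auto
          then have cs': "cs = cs' @ [b]" unfolding b_def cs'_def by simp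
          have "concat (cs' @ [b]) = u" using cs(1) cs' by simp
          then have ucs: "u = concat cs' @ b" by simp
          show False
          proof (cases "concat cs' = []")
            case True
            then have "u = b" using ucs by simp
            then show False using 2 bs_l u by simp
          next
            case False
            then have "proper_suffix (b @ s) c"
              unfolding proper_suffix_def using ucs u(1,3) by (intro conjI exI[of _ "concat cs'"]) simp_all
            then have "lex_le gt (b @ s) s" using s by (auto simp: max_suffix_def)
            moreover have "b @ s \<ggreater> s" using lyndon_suffix bs_l u lyndon_not_Nil[OF lb] by blast
            ultimately show False using lex_le_imp_not_gt by blast
          qed
        qed
      qed
      then show ?thesis using cs ls u
        by (intro exI[of _ "cs @ [s]"]) (auto simp: sorted_wrt_append)
    qed
  qed
qed

text \<open>The last factor is thus the greatest suffix of the product and is determined by the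
  word, which yields uniqueness of the factorization. A suffix starting inside a factor
  \<open>d\<close> begins with a suffix of \<open>d\<close>; that is at most \<open>d\<close>, hence
  at most \<open>m\<close>.\<close>

lemma lyndon_factors_suffix_le:
  assumes "\<forall>d\<in>set cs. lyndon gt d" "lyndon gt m" "sorted_wrt (lex_le gt) (cs @ [m])"
    "concat (cs @ [m]) = u @ s" "s \<noteq> []"
  shows "lex_le gt s m"
  using assms
proof (induction cs arbitrary: u)
  case Nil
  then show ?case using lyndon_suffix[of gt u s] by (cases "u = []") (auto simp: lex_le_def)
next
  case (Cons d cs)
  have dm: "lex_le gt d m" and d: "lyndon gt d" using Cons.prems by auto
  consider x where "u = d @ x" "concat (cs @ [m]) = x @ s"
    | x where "x \<noteq> []" "d = u @ x" "s = x @ concat (cs @ [m])"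
    using append_eq_append_cases[of d "concat (cs @ [m])" u s] Cons.prems(4) by auto
  then show ?case
  proof cases
    case 1
    then show ?thesis using Cons.IH[of x] Cons.prems by auto
  next
    case 2
    have "lex_le gt x d"
      using lyndon_suffix[of gt u x] 2 d by (cases "u = []") (auto simp: lex_le_def)
    then have "lex_le gt x m" using dm lex_le_trans by blast
    moreover have "concat (cs @ [m]) \<noteq> []" using lyndon_not_Nil[OF assms(2)] by simp
    ultimately show ?thesis unfolding 2(3) using lex_le_append by (simp add: lex_le_def)
  qed
qed

lemma lyndon_factors_unique:
  assumes "\<forall>d\<in>set cs. lyndon gt d" "sorted_wrt (lex_le gt) cs"
    "\<forall>d\<in>set ds. lyndon gt d" "sorted_wrt (lex_le gt) ds" "concat cs = concat ds"
  shows "cs = ds"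
  using assms
proof (induction cs arbitrary: ds rule: rev_induct)
  case Nil
  have "d = []" if "d \<in> set ds" for d using Nil(5) that by simp
  moreover have "d \<noteq> []" if "d \<in> set ds" for d
    using bspec[OF Nil(3) that] by (rule lyndon_not_Nil)
  ultimately show ?case by (cases ds) auto
next
  case (snoc m cs)
  have "ds \<noteq> []" using snoc.prems(1,5) lyndon_not_Nil[of gt m] by fastforce
  then obtain ds' n where ds: "ds = ds' @ [n]" by (metis rev_exhaust)
  have ly: "lyndon gt m" "lyndon gt n" "\<forall>d\<in>set cs. lyndon gt d" "\<forall>d\<in>set ds'. lyndon gt d"
    using snoc.prems(1,3) ds by simp_all
  have eq: "concat (cs @ [m]) = concat ds' @ n" "concat (ds' @ [n]) = concat cs @ m"
    using snoc.prems(5) ds by simp_all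
  have "lex_le gt n m"
    using lyndon_factors_suffix_le[OF ly(3,1) snoc.prems(2) eq(1)] lyndon_not_Nil ly by blast
  moreover have "lex_le gt m n"
    using lyndon_factors_suffix_le[OF ly(4,2) _ eq(2)] snoc.prems(4) ds lyndon_not_Nil ly by blast
  ultimately have "m = n" using lex_asym unfolding lex_le_def by blast
  moreover from this have "concat cs = concat ds'" using eq(1) by simp
  then have "cs = ds'"
    by (intro snoc.IH) (use ly snoc.prems(2,4) ds in \<open>simp_all add: sorted_wrt_append\<close>)
  ultimately show ?case using ds by simp
qed

text \<open>
  Multiplying \<open>v\<close> successively by the factors of \<open>c\<close> keeps every intermediate word Lyndon: each factor
  is at most the last one, which is a proper suffix of \<open>vc\<close>.
\<close>

lemma lyndon_mult_factors:
  assumes "lyndon gt v" "lyndon gt (v @ concat cs)" "set v \<subseteq> Z" "\<forall>d\<in>set cs. set d \<subseteq> Z"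
    "\<forall>d\<in>set cs. lyndon gt d" "sorted_wrt (lex_le gt) cs" "cs = ds @ d # es"
  shows "lyndon gt (v @ concat ds) \<and> v @ concat ds \<ggreater> d"
proof -
  have gt: "v @ concat ds \<ggreater> d" if e: "cs = ds @ d # es" for ds d es
  proof -
    define m where "m = last cs"
    have m: "m \<in> set cs" "lex_le gt d m"
      using assms(6) e unfolding m_def by (auto simp: sorted_wrt_append lex_le_def)
    define cs' where "cs' = butlast cs"
    have "cs \<noteq> []" using e by auto
    then have cs': "cs = cs' @ [m]" unfolding m_def cs'_def by simp
    have "(v @ concat cs') @ m \<ggreater> m"
    proof (rule lyndon_suffix)
      show "lyndon gt ((v @ concat cs') @ m)" using assms(2) cs' by simp
    qed (use assms(1,5) m lyndon_not_Nil[of gt] in auto)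
    moreover have "concat cs' @ m = concat ds @ d @ concat es"
    proof -
      have "concat (cs' @ [m]) = concat (ds @ d # es)" using cs' e by metis
      then show ?thesis by simp
    qed
    ultimately have "(v @ concat ds) @ d @ concat es \<ggreater> m" by simp
    \<comment> \<open>A prefix is greater than its extensions, so the part
      \<open>d @ concat es\<close> may be dropped on the greater side.\<close>
    then have "v @ concat ds \<ggreater> m" using lex_cancel_prefix by blast
    then show ?thesis using m(2) lex_less_le_trans by blast
  qed
  show ?thesis using assms(7)
  proof (induction ds arbitrary: d es rule: rev_induct)
    case Nil
    have "lex_le gt (v @ concat []) (v @ concat [])" by (simp add: lex_le_def)
    then show ?case using gt[of "[]" d es] Nil assms(1) by simp
  next
    case (snoc x ds)
    then have "lyndon gt (v @ concat ds)" "v @ concat ds \<ggreater> x" "lyndon gt x"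
      using assms(5) by auto
    then have "lyndon gt (v @ concat (ds @ [x]))" using lyndon_append by fastforce
    then show ?case using gt[of "ds @ [x]" d es] snoc by simp
  qed
qed

end

section \<open>The algebra of \<open>\<Omega>\<close>-polynomials\<close>

abbreviation coef :: "('a \<Rightarrow>\<^sub>0 'b::zero) \<Rightarrow> 'a \<Rightarrow> 'b" where
  "coef \<equiv> Poly_Mapping.lookup"

abbreviation supp :: "('a \<Rightarrow>\<^sub>0 'b::zero) \<Rightarrow> 'a set" where
  "supp \<equiv> Poly_Mapping.keys"

abbreviation mon :: "'x word \<Rightarrow> ('x, 'k::field) omega_poly" where
  "mon u \<equiv> Poly_Mapping.single u 1"

lemma coef_pscale [simp]: "coef (pscale c f) w = c * coef f w"
  by (simp add: pscale_def Poly_Mapping.map.rep_eq when_def)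

interpretation PV: vector_space "pscale :: 'k::field \<Rightarrow> ('x, 'k) omega_poly \<Rightarrow> _"
  by unfold_locales (auto intro!: poly_mapping_eqI simp: lookup_add algebra_simps)

lemma pscale_single: "pscale c (Poly_Mapping.single u a) = Poly_Mapping.single u (c * a)"
  by (rule poly_mapping_eqI) (simp add: lookup_single when_def)

lemma supp_pscale: "supp (pscale c f) \<subseteq> supp f"
  by (auto simp: in_keys_iff)

lemma omega_poly_induct [case_names zero add]:
  assumes "P 0" "\<And>u a f. P f \<Longrightarrow> P (Poly_Mapping.single u a + f)"
  shows "P (f :: ('x, 'k::field) omega_poly)"
proof (induction f rule: update_induct)
  case const
  show ?case by fact
next
  case (update f a b)
  have "Poly_Mapping.update a b f = Poly_Mapping.single a b + f"
    using update(1) by (intro poly_mapping_eqI)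
      (auto simp: lookup_update lookup_add lookup_single when_def in_keys_iff)
  then show ?case using assms(2) update(3) by simp
qed

lemma poly_sum_mon: "f = (\<Sum>u\<in>supp f. pscale (coef f u) (mon u))"
proof (rule poly_mapping_eqI)
  fix w
  have "coef (\<Sum>u\<in>supp f. pscale (coef f u) (mon u)) w = (\<Sum>u\<in>supp f. if u = w then coef f u else 0)"
    unfolding lookup_sum by (intro sum.cong) (simp_all add: lookup_single when_def)
  then show "coef f w = coef (\<Sum>u\<in>supp f. pscale (coef f u) (mon u)) w"
    by (simp add: in_keys_iff)
qed

lemma pmul_superset:
  assumes "finite A" "finite B" "supp f \<subseteq> A" "supp g \<subseteq> B"
  shows "pmul f g = (\<Sum>u\<in>A. \<Sum>v\<in>B. Poly_Mapping.single (u @ v) (coef f u * coef g v))"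
proof -
  have "pmul f g = (\<Sum>u\<in>supp f. \<Sum>v\<in>B. Poly_Mapping.single (u @ v) (coef f u * coef g v))"
    unfolding pmul_def
    by (intro sum.cong refl sum.mono_neutral_left assms) (simp add: in_keys_iff)
  also have "\<dots> = (\<Sum>u\<in>A. \<Sum>v\<in>B. Poly_Mapping.single (u @ v) (coef f u * coef g v))"
    by (intro sum.mono_neutral_left assms) (simp add: in_keys_iff)
  finally show ?thesis .
qed

lemma pmul_add_left: "pmul (f + f') g = pmul f g + pmul f' g"
proof -
  let ?A = "supp f \<union> supp f'"
  note s = pmul_superset[of ?A "supp g"]
  show ?thesis
    by (subst (1 2 3) s)
      (use keys_add[of f f'] in \<open>auto simp: lookup_add distrib_right single_add sum.distrib\<close>)
qed

lemma pmul_add_right: "pmul f (g + g') = pmul f g + pmul f g'"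
proof -
  let ?A = "supp g \<union> supp g'"
  note s = pmul_superset[of "supp f" ?A]
  show ?thesis
    by (subst (1 2 3) s)
      (use keys_add[of g g'] in \<open>auto simp: lookup_add distrib_left single_add sum.distrib\<close>)
qed

lemma pop_superset:
  assumes "finite A" "supp f \<subseteq> A"
  shows "pop f = (\<Sum>u\<in>A. Poly_Mapping.single [Op u] (coef f u))"
  unfolding pop_def by (intro sum.mono_neutral_left assms) (simp add: in_keys_iff)

lemma pop_add: "pop (f + g) = pop f + pop g"
proof -
  let ?A = "supp f \<union> supp g"
  show ?thesis
    by (subst (1 2 3) pop_superset[of ?A])
      (use keys_add[of f g] in \<open>auto simp: lookup_add single_add sum.distrib\<close>)
qed

lemma pmul_single: "pmul (Poly_Mapping.single u a) (Poly_Mapping.single v b) = Poly_Mapping.single (u @ v) (a * b)"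
  by (simp add: pmul_superset[of "{u}" "{v}"])

lemma pop_single: "pop (Poly_Mapping.single u a) = Poly_Mapping.single [Op u] a"
  by (simp add: pop_superset[of "{u}"])

lemma additive_pmul_left: "additive (\<lambda>f. pmul f g)"
  and additive_pmul_right: "additive (pmul f)"
  and additive_pop: "additive pop"
  by (simp_all add: additive_def pmul_add_left pmul_add_right pop_add)

lemmas pmul_zero [simp] = additive.zero[OF additive_pmul_left] additive.zero[OF additive_pmul_right]
lemmas pmul_minus = additive.minus[OF additive_pmul_left] additive.minus[OF additive_pmul_right]
lemmas pmul_diff_left = additive.diff[OF additive_pmul_left]
lemmas pmul_diff_right = additive.diff[OF additive_pmul_right]
lemmas pop_zero [simp] = additive.zero[OF additive_pop]
lemmas pop_minus = additive.minus[OF additive_pop]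
lemmas pop_diff = additive.diff[OF additive_pop]

lemma pmul_pscale_left: "pmul (pscale c f) g = pscale c (pmul f g)"
proof (induction f rule: omega_poly_induct)
  case (add u a f)
  have "pmul (pscale c (Poly_Mapping.single u a)) g = pscale c (pmul (Poly_Mapping.single u a) g)"
    by (induction g rule: omega_poly_induct)
      (simp_all add: pmul_add_right PV.scale_right_distrib pmul_single pscale_single mult.assoc)
  then show ?case using add by (simp add: PV.scale_right_distrib pmul_add_left)
qed simp

lemma pmul_pscale_right: "pmul f (pscale c g) = pscale c (pmul f g)"
proof (induction f rule: omega_poly_induct)
  case (add u a f)
  have "pmul (Poly_Mapping.single u a) (pscale c g) = pscale c (pmul (Poly_Mapping.single u a) g)"
    by (induction g rule: omega_poly_induct)
      (simp_all add: pmul_add_right PV.scale_right_distrib pmul_single pscale_single mult.left_commute)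
  then show ?case using add by (simp add: PV.scale_right_distrib pmul_add_left)
qed simp

lemma pop_pscale: "pop (pscale c f) = pscale c (pop f)"
  by (induction f rule: omega_poly_induct)
    (simp_all add: PV.scale_right_distrib pop_add pop_single pscale_single)

lemma pmul_assoc: "pmul (pmul f g) h = pmul f (pmul g h)"
proof (induction f rule: omega_poly_induct)
  case (add u a f)
  let ?f = "Poly_Mapping.single u a"
  have "pmul (pmul ?f g) h = pmul ?f (pmul g h)"
  proof (induction g rule: omega_poly_induct)
    case (add v b g)
    let ?g = "Poly_Mapping.single v b"
    have "pmul (pmul ?f ?g) h = pmul ?f (pmul ?g h)"
      by (induction h rule: omega_poly_induct) (simp_all add: pmul_add_right pmul_single mult.assoc)
    then show ?case using add by (simp add: pmul_add_left pmul_add_right)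
  qed simp
  then show ?case using add by (simp add: pmul_add_left)
qed simp

lemma pmul_Nil [simp]: "pmul (mon []) f = f" "pmul f (mon []) = f"
  by (induction f rule: omega_poly_induct) (simp_all add: pmul_add_left pmul_add_right pmul_single)

lemmas pmul_distribs = pmul_add_left pmul_add_right pmul_diff_left pmul_diff_right pmul_minus
  pmul_pscale_left pmul_pscale_right

lemmas pop_distribs = pop_add pop_diff pop_minus pop_pscale

lemmas pscale_distribs = PV.scale_right_distrib PV.scale_right_diff_distrib PV.scale_minus_right

lemma pcomm_add_left: "pcomm (f + f') g = pcomm f g + pcomm f' g"
  and pcomm_add_right: "pcomm f (g + g') = pcomm f g + pcomm f g'"
  and pcomm_diff_left: "pcomm (f - f') g = pcomm f g - pcomm f' g"
  and pcomm_diff_right: "pcomm f (g - g') = pcomm f g - pcomm f g'"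
  and pcomm_pscale_left: "pcomm (pscale c f) g = pscale c (pcomm f g)"
  and pcomm_pscale_right: "pcomm f (pscale c g) = pscale c (pcomm f g)"
  and pcomm_swap: "pcomm g f = - pcomm f g"
  by (simp_all add: pcomm_def pmul_distribs pscale_distribs)

lemma pcomm_zero [simp]: "pcomm 0 f = 0" "pcomm f 0 = 0" and pcomm_self [simp]: "pcomm f f = 0"
  by (simp_all add: pcomm_def)

lemmas pcomm_distribs = pcomm_add_left pcomm_add_right pcomm_diff_left pcomm_diff_right
  pcomm_pscale_left pcomm_pscale_right

lemma pcomm_jacobi: "pcomm f (pcomm g h) + pcomm g (pcomm h f) + pcomm h (pcomm f g) = 0"
  by (simp add: pcomm_def pmul_distribs pmul_assoc)

lemma supp_pmul: "supp (pmul f g) \<subseteq> {u @ v | u v. u \<in> supp f \<and> v \<in> supp g}"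
proof
  fix w assume "w \<in> supp (pmul f g)"
  then obtain u where u: "u \<in> supp f"
    "w \<in> supp (\<Sum>v\<in>supp g. Poly_Mapping.single (u @ v) (coef f u * coef g v))"
    unfolding pmul_def using keys_sum by fast
  then obtain v where "v \<in> supp g" "w \<in> supp (Poly_Mapping.single (u @ v) (coef f u * coef g v))"
    using keys_sum by fast
  then show "w \<in> {u @ v | u v. u \<in> supp f \<and> v \<in> supp g}"
    using u(1) by (auto split: if_splits)
qed

lemma supp_pop: "supp (pop f) \<subseteq> {[Op u] | u. u \<in> supp f}"
proof
  fix w assume "w \<in> supp (pop f)"
  then obtain u where "u \<in> supp f" "w \<in> supp (Poly_Mapping.single [Op u] (coef f u))"
    unfolding pop_def using keys_sum by fast
  then show "w \<in> {[Op u] | u. u \<in> supp f}" by (auto split: if_splits)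
qed

lemma coef_pmul: "coef (pmul f g) w = (\<Sum>u\<in>supp f. \<Sum>v\<in>supp g. (coef f u * coef g v when u @ v = w))"
  by (simp add: pmul_def lookup_sum lookup_single)

lemma coef_pop: "coef (pop f) [Op u] = coef f u"
proof -
  have "coef (pop f) [Op u] = (\<Sum>v\<in>supp f. if v = u then coef f v else 0)"
    unfolding pop_def lookup_sum by (intro sum.cong) (simp_all add: lookup_single when_def)
  then show ?thesis by (simp add: in_keys_iff)
qed

subsection \<open>Leading words\<close>

text \<open>Leading word and monicity in one relation; it avoids the description operator of
  \<open>lead\<close> and composes directly under products, commutators and
  \<open>pop\<close>.\<close>

definition has_lead :: "('x::wellorder, 'k::field) omega_poly \<Rightarrow> 'x word \<Rightarrow> bool" where
  "has_lead f w \<longleftrightarrow> coef f w = 1 \<and> (\<forall>v\<in>supp f. v = w \<or> Dl_less v w)"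

definition below :: "('x::wellorder, 'k::field) omega_poly \<Rightarrow> 'x word \<Rightarrow> bool" where
  "below f w \<longleftrightarrow> (\<forall>v\<in>supp f. Dl_less v w)"

lemma has_leadD: "has_lead f w \<Longrightarrow> v \<in> supp f \<Longrightarrow> v = w \<or> Dl_less v w"
  by (simp add: has_lead_def)

lemma has_lead_in_supp: "has_lead f w \<Longrightarrow> w \<in> supp f"
  by (simp add: has_lead_def in_keys_iff)

lemma has_lead_not_zero: "has_lead f w \<Longrightarrow> f \<noteq> 0"
  using has_lead_in_supp by fastforce

lemma lead_eqI:
  assumes "w \<in> supp f" "\<forall>v\<in>supp f. v = w \<or> Dl_less v w"
  shows "lead f = w"
  unfolding lead_def
proof (rule the_equality)
  fix w' assume w': "w' \<in> supp f \<and> (\<forall>v\<in>supp f. v \<noteq> w' \<longrightarrow> Dl_less v w')"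
  show "w' = w"
  proof (rule ccontr)
    assume "w' \<noteq> w"
    then have "Dl_less w' w" "Dl_less w w'" using assms w' by auto
    then show False using Dl_less_trans[of w' w w'] by simp
  qed
qed (use assms in auto)

lemma has_lead_lead: "has_lead f w \<Longrightarrow> lead f = w"
  by (intro lead_eqI has_lead_in_supp) (simp_all add: has_lead_def)

lemma has_lead_monic: "has_lead f w \<Longrightarrow> monic f"
  using has_lead_lead[of f w] has_lead_not_zero[of f w] by (simp add: monic_def has_lead_def)

lemma has_lead_mon: "has_lead (mon u) u"
  by (simp add: has_lead_def lookup_single)

lemma below_zero [simp]: "below 0 w"
  by (simp add: below_def)

lemma below_add: "below f w \<Longrightarrow> below g w \<Longrightarrow> below (f + g) w"
  using keys_add[of f g] by (auto simp: below_def)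

lemma below_diff: "below f w \<Longrightarrow> below g w \<Longrightarrow> below (f - g) w"
  using keys_diff[of f g] by (auto simp: below_def)

lemma below_pscale: "below f w \<Longrightarrow> below (pscale c f) w"
  using supp_pscale[of c f] by (auto simp: below_def)

lemma below_single: "below (Poly_Mapping.single u a) w \<longleftrightarrow> a = 0 \<or> Dl_less u w"
  by (simp add: below_def)

lemma has_lead_below: "has_lead f u \<Longrightarrow> Dl_less u w \<Longrightarrow> below f w"
  unfolding below_def has_lead_def by (auto intro: Dl_less_trans[of _ u w])

lemma has_lead_add_below:
  assumes "has_lead f w" "below g w" shows "has_lead (f + g) w"
proof -
  have "w \<notin> supp g" using assms(2) Dl_less_irrefl by (auto simp: below_def)
  then have "coef (f + g) w = 1" using assms(1) by (simp add: has_lead_def lookup_add in_keys_iff)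
  moreover have "\<forall>v\<in>supp (f + g). v = w \<or> Dl_less v w"
    using keys_add[of f g] assms by (auto simp: has_lead_def below_def)
  ultimately show ?thesis by (simp add: has_lead_def)
qed

lemma has_lead_diff_below:
  assumes "has_lead f w" "below g w" shows "has_lead (f - g) w"
  using has_lead_add_below[OF assms(1) below_diff[OF below_zero assms(2)]] by simp

lemma has_lead_diff_scaled:
  assumes "\<forall>v\<in>supp f. v = w \<or> Dl_less v w" "has_lead g w"
  shows "below (f - pscale (coef f w) g) w"
  unfolding below_def
proof
  fix v assume v: "v \<in> supp (f - pscale (coef f w) g)"
  then have "v = w \<or> Dl_less v w"
    using keys_diff[of f "pscale (coef f w) g"] supp_pscale[of "coef f w" g] assms
    unfolding has_lead_def by blast
  moreover have "v \<noteq> w" using v assms(2) by (auto simp: in_keys_iff lookup_minus has_lead_def)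
  ultimately show "Dl_less v w" by simp
qed

lemma has_lead_diff: "has_lead f w \<Longrightarrow> has_lead g w \<Longrightarrow> below (f - g) w"
  using has_lead_diff_scaled[of f w g] by (simp add: has_lead_def)

lemma has_lead_pmul:
  assumes f: "has_lead f u" and g: "has_lead g v"
  shows "has_lead (pmul f g) (u @ v)"
proof -
  have less: "Dl_less (u' @ v') (u @ v)" if "u' \<in> supp f" "v' \<in> supp g" "u' \<noteq> u \<or> v' \<noteq> v" for u' v'
    using Dl_less_append_mono has_leadD[OF f that(1)] has_leadD[OF g that(2)] that(3) by blast
  \<comment> \<open>Every other pair of words gives a smaller product, so the leading product arises
    only once and cannot cancel.\<close>
  have eq: "u' @ v' = u @ v \<longleftrightarrow> u' = u \<and> v' = v" if "u' \<in> supp f" "v' \<in> supp g" for u' v'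
    using less[OF that] by (metis Dl_less_irrefl)
  have "coef (pmul f g) (u @ v) = (\<Sum>u'\<in>supp f. \<Sum>v'\<in>supp g. if u' = u \<and> v' = v then 1 else 0)"
    unfolding coef_pmul when_def
    by (intro sum.cong refl) (use f g eq in \<open>auto simp: has_lead_def\<close>)
  also have "\<dots> = (\<Sum>u'\<in>supp f. if u' = u then (\<Sum>v'\<in>supp g. if v' = v then 1 else 0) else 0)"
    by (intro sum.cong refl) simp
  also have "\<dots> = 1" using has_lead_in_supp[OF f] has_lead_in_supp[OF g] by simp
  finally have c: "coef (pmul f g) (u @ v) = 1" .
  have "w = u @ v \<or> Dl_less w (u @ v)" if "w \<in> supp (pmul f g)" for w
  proof -
    obtain u' v' where "w = u' @ v'" "u' \<in> supp f" "v' \<in> supp g"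
      using \<open>w \<in> supp (pmul f g)\<close> supp_pmul[of f g] by blast
    then show ?thesis using less[of u' v'] by auto
  qed
  then show ?thesis unfolding has_lead_def using c by blast
qed

lemma has_lead_pcomm:
  assumes "has_lead f u" "has_lead g v" "Dl_less (v @ u) (u @ v)"
  shows "has_lead (pcomm f g) (u @ v)"
  unfolding pcomm_def
  by (rule has_lead_diff_below[OF has_lead_pmul[OF assms(1,2)]
    has_lead_below[OF has_lead_pmul[OF assms(2,1)] assms(3)]])

lemma has_lead_pop:
  assumes "has_lead f u" shows "has_lead (pop f) [Op u]"
proof -
  have "v = [Op u] \<or> Dl_less v [Op u]" if "v \<in> supp (pop f)" for v
  proof -
    obtain u' where u': "v = [Op u']" "u' \<in> supp f" using \<open>v \<in> supp (pop f)\<close> supp_pop[of f] by blast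
    show ?thesis using has_leadD[OF assms u'(2)] Dl_less_Op[of u' u] u'(1) by blast
  qed
  then show ?thesis using assms by (simp add: has_lead_def coef_pop)
qed

definition poly_over :: "'x set \<Rightarrow> ('x, 'k::field) omega_poly \<Rightarrow> bool" where
  "poly_over X f \<longleftrightarrow> (\<forall>u\<in>supp f. u \<noteq> [] \<and> word_over X u)"

lemma poly_over_add: "poly_over X f \<Longrightarrow> poly_over X g \<Longrightarrow> poly_over X (f + g)"
  using keys_add[of f g] by (auto simp: poly_over_def)

lemma poly_over_diff: "poly_over X f \<Longrightarrow> poly_over X g \<Longrightarrow> poly_over X (f - g)"
  using keys_diff[of f g] by (auto simp: poly_over_def)

lemma poly_over_pscale: "poly_over X f \<Longrightarrow> poly_over X (pscale c f)"
  using supp_pscale[of c f] by (auto simp: poly_over_def)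

lemma poly_over_pmul: "poly_over X f \<Longrightarrow> poly_over X g \<Longrightarrow> poly_over X (pmul f g)"
  using supp_pmul[of f g] by (fastforce simp: poly_over_def)

lemma poly_over_pcomm: "poly_over X f \<Longrightarrow> poly_over X g \<Longrightarrow> poly_over X (pcomm f g)"
  unfolding pcomm_def by (intro poly_over_diff poly_over_pmul)

lemma poly_over_pop: "poly_over X f \<Longrightarrow> poly_over X (pop f)"
  using supp_pop[of f] by (fastforce simp: poly_over_def)

lemma Lie_set_poly_over: "f \<in> Lie_set X \<Longrightarrow> poly_over X f"
proof (induction rule: Lie_set.induct)
  case (Lie_gen x)
  then show ?case by (simp add: poly_over_def pgen_def)
qed (simp_all add: poly_over_add poly_over_pscale poly_over_pcomm poly_over_pop,
  simp add: poly_over_def)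

section \<open>An associative envelope and its normal forms\<close>

text \<open>
  In the envelope \<open>P(f)P(g) - P(g)P(f)\<close> is rewritten for arbitrary polynomials \<open>f\<close>, \<open>g\<close> instead of Lie
  polynomials only, so that the relations can be indexed by pairs of plain words.
\<close>

definition rb_circ :: "('x, 'k::field) omega_poly \<Rightarrow> ('x, 'k) omega_poly \<Rightarrow> ('x, 'k) omega_poly" where
  "rb_circ f g = pcomm (pop f) g + pcomm f (pop g)"

definition rb_rhs :: "'k::field \<Rightarrow> ('x, 'k) omega_poly \<Rightarrow> ('x, 'k) omega_poly \<Rightarrow> ('x, 'k) omega_poly" where
  "rb_rhs lam f g = pop (rb_circ f g) + pscale lam (pcomm f g)"

definition rb_rel :: "'k::field \<Rightarrow> ('x, 'k) omega_poly \<Rightarrow> ('x, 'k) omega_poly \<Rightarrow> ('x, 'k) omega_poly" where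
  "rb_rel lam f g = pcomm (pop f) (pop g) - rb_rhs lam f g"

definition ctx :: "'x word \<Rightarrow> ('x, 'k::field) omega_poly \<Rightarrow> 'x word \<Rightarrow> ('x, 'k) omega_poly" where
  "ctx a f b = pmul (mon a) (pmul f (mon b))"

lemmas rb_defs = rb_rel_def rb_rhs_def rb_circ_def

lemma rb_rel_add_left: "rb_rel lam (f + f') g = rb_rel lam f g + rb_rel lam f' g"
  and rb_rel_add_right: "rb_rel lam f (g + g') = rb_rel lam f g + rb_rel lam f g'"
  and rb_rel_pscale_left: "rb_rel lam (pscale c f) g = pscale c (rb_rel lam f g)"
  and rb_rel_pscale_right: "rb_rel lam f (pscale c g) = pscale c (rb_rel lam f g)"
  by (simp_all add: rb_defs pcomm_distribs pop_distribs pscale_distribs mult.commute)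

lemma rb_rel_swap: "rb_rel lam g f = - rb_rel lam f g"
  unfolding rb_defs
  by (subst (1 2 3 4) pcomm_swap) (simp add: pop_distribs pscale_distribs)

lemma rb_rel_self [simp]: "rb_rel lam f f = 0"
  unfolding rb_defs
  by (subst (3) pcomm_swap) simp

lemma mon_append: "mon (u @ v) = pmul (mon u) (mon v)"
  by (simp add: pmul_single)

lemma ctx_Nil [simp]: "ctx [] f [] = f"
  by (simp add: ctx_def)

lemma ctx_ctx: "ctx a (ctx a' f b') b = ctx (a @ a') f (b' @ b)"
proof -
  have "ctx a (ctx a' f b') b = pmul (pmul (mon a) (mon a')) (pmul f (pmul (mon b') (mon b)))"
    by (simp only: ctx_def pmul_assoc)
  then show ?thesis by (simp add: ctx_def pmul_single)
qed

lemma ctx_add: "ctx a (f + g) b = ctx a f b + ctx a g b"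
  and ctx_diff: "ctx a (f - g) b = ctx a f b - ctx a g b"
  and ctx_pscale: "ctx a (pscale c f) b = pscale c (ctx a f b)"
  by (simp_all add: ctx_def pmul_distribs)

lemma has_lead_ctx: "has_lead f w \<Longrightarrow> has_lead (ctx a f b) (a @ w @ b)"
  unfolding ctx_def by (intro has_lead_pmul has_lead_mon)

text \<open>The leading word is carried along with the relation. Splitting off \<open>lrel\<close>
  separates a redex from its context: a redex has one or two letters and sits in one associative
  context, while deeper positions are reached through \<open>lrel_op\<close>. The words range over
  the whole type; the restriction to \<open>X\<close> returns in
  \<open>rel_imp_reducible\<close>.\<close>

inductive rel :: "'k::field \<Rightarrow> 'x::wellorder word \<Rightarrow> ('x, 'k) omega_poly \<Rightarrow> bool"
  and lrel :: "'k::field \<Rightarrow> 'x::wellorder word \<Rightarrow> ('x, 'k) omega_poly \<Rightarrow> bool"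
  for lam where
  rel_ctx: "lrel lam l f \<Longrightarrow> rel lam (a @ l @ b) (ctx a f b)"
| lrel_rb: "u \<in> omega_words UNIV \<Longrightarrow> v \<in> omega_words UNIV \<Longrightarrow> Dl_less v u \<Longrightarrow>
    lrel lam [Op u, Op v] (rb_rel lam (mon u) (mon v))"
| lrel_op: "rel lam w f \<Longrightarrow> lrel lam [Op w] (pop f)"

lemma lrel_rel: "lrel lam l f \<Longrightarrow> rel lam l f"
  using rel_ctx[of lam l f "[]" "[]"] by simp

lemma rel_in_ctx: "rel lam w f \<Longrightarrow> rel lam (a @ w @ b) (ctx a f b)"
proof -
  assume "rel lam w f"
  then obtain l g a' b' where l: "w = a' @ l @ b'" "f = ctx a' g b'" "lrel lam l g"
    by cases
  show ?thesis using rel_ctx[OF l(3), of "a @ a'" "b' @ b"] l(1,2) by (simp add: ctx_ctx)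
qed

lemma rel_pop: "rel lam w f \<Longrightarrow> rel lam [Op w] (pop f)"
  by (rule lrel_rel[OF lrel_op])

lemma rel_left: "rel lam w f \<Longrightarrow> rel lam (a @ w) (pmul (mon a) f)"
  using rel_in_ctx[of lam w f a "[]"] by (simp add: ctx_def)

lemma rel_right: "rel lam w f \<Longrightarrow> rel lam (w @ b) (pmul f (mon b))"
  using rel_in_ctx[of lam w f "[]" b] by (simp add: ctx_def)

text \<open>The word \<open>P(P(u)v)\<close> and its kin have degree
  \<open>deg u + deg v + 2\<close>, exactly that of \<open>P(u)P(v)\<close>, and are smaller only
  because their breadth is 1; the words with factor \<open>lam\<close> have two degrees
  less.\<close>

lemma below_rb_rhs:
  assumes "deg u + deg v + 2 < deg w \<or> deg u + deg v + 2 = deg w \<and> 1 < length w"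
  shows "below (rb_rhs lam (mon u) (mon v)) w"
  unfolding rb_rhs_def rb_circ_def pcomm_def pop_single pmul_single pop_distribs
  by (intro below_add below_diff below_pscale)
    (use assms in \<open>auto simp: below_single pop_single Dl_less_iff\<close>)

lemma Dl_less_pair:
  assumes "Dl_less a u" "deg a + deg b \<le> deg u + deg v"
  shows "Dl_less [Op a, Op b] [Op u, Op v]"
proof -
  have "prm_less (Op a) (Op u)"
    using assms(1) Dl_less_deg_le[OF assms(1)] by (auto simp: prm_less_iff)
  then show ?thesis using assms(2) by (auto simp: Dl_less_iff)
qed

lemma has_lead_rb_rel:
  assumes "Dl_less v u" shows "has_lead (rb_rel lam (mon u) (mon v)) [Op u, Op v]"
proof -
  have "has_lead (pcomm (pop (mon u)) (pop (mon v))) ([Op u] @ [Op v])"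
    using Dl_less_pair[OF assms, of u v]
    by (intro has_lead_pcomm has_lead_pop has_lead_mon) simp
  then show ?thesis
    unfolding rb_rel_def by (auto intro!: has_lead_diff_below below_rb_rhs)
qed

lemma has_lead_rel: "rel lam w f \<Longrightarrow> has_lead f w"
  and has_lead_lrel: "lrel lam l f \<Longrightarrow> has_lead f l"
  by (induction rule: rel_lrel.inducts)
    (auto intro: has_lead_ctx has_lead_rb_rel has_lead_pop)

lemma poly_over_mon: "poly_over X (mon u) \<longleftrightarrow> u \<in> omega_words X"
  by (auto simp: poly_over_def omega_words_iff)

lemma poly_over_rb_rhs: "poly_over X f \<Longrightarrow> poly_over X g \<Longrightarrow> poly_over X (rb_rhs lam f g)"
  and poly_over_rb_circ: "poly_over X f \<Longrightarrow> poly_over X g \<Longrightarrow> poly_over X (rb_circ f g)"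
  unfolding rb_rhs_def rb_circ_def
  by (intro poly_over_add poly_over_pop poly_over_pcomm poly_over_pscale; assumption)+

lemma poly_over_rb_rel: "poly_over X f \<Longrightarrow> poly_over X g \<Longrightarrow> poly_over X (rb_rel lam f g)"
  unfolding rb_rel_def
  by (intro poly_over_diff poly_over_rb_rhs poly_over_pop poly_over_pcomm; assumption)

lemma poly_over_ctx:
  assumes "poly_over X f" "word_over X a" "word_over X b" shows "poly_over X (ctx a f b)"
  unfolding poly_over_def
proof
  fix w assume "w \<in> supp (ctx a f b)"
  then obtain w' where w': "w = a @ w'" "w' \<in> supp (pmul f (mon b))"
    using supp_pmul[of "mon a" "pmul f (mon b)"] by (auto simp: ctx_def)
  then obtain v where "w' = v @ b" "v \<in> supp f" using supp_pmul[of f "mon b"] by auto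
  then show "w \<noteq> [] \<and> word_over X w" using w' assms by (auto simp: poly_over_def)
qed

lemma rel_poly_over: "rel lam w f \<Longrightarrow> word_over UNIV w \<Longrightarrow> poly_over UNIV f"
  and lrel_poly_over: "lrel lam l f \<Longrightarrow> word_over UNIV l \<Longrightarrow> poly_over UNIV f"
proof (induction rule: rel_lrel.inducts)
  case (rel_ctx l f a b)
  then show ?case by (intro poly_over_ctx) simp_all
next
  case (lrel_rb u v)
  then show ?case by (intro poly_over_rb_rel) (simp_all only: poly_over_mon)
next
  case (lrel_op w f)
  then show ?case by (intro poly_over_pop) simp
qed

text \<open>With \<open>Q\<close> the words below \<open>w\<close> this is the error allowed when
  two reductions of \<open>w\<close> are compared; with \<open>Q\<close> always true it is the ideal
  of relations.\<close>

definition rel_span :: "'k::field \<Rightarrow> ('x::wellorder word \<Rightarrow> bool) \<Rightarrow> ('x, 'k) omega_poly set" where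
  "rel_span lam Q = PV.span {f. \<exists>w. rel lam w f \<and> Q w}"

lemma rel_span_gen: "rel lam w f \<Longrightarrow> Q w \<Longrightarrow> f \<in> rel_span lam Q"
  unfolding rel_span_def by (intro PV.span_base) blast

lemmas rel_span_closed =
  PV.span_add[of _ "{f. \<exists>w. rel lam w f \<and> Q w}" for lam Q, folded rel_span_def]
  PV.span_diff[of _ "{f. \<exists>w. rel lam w f \<and> Q w}" for lam Q, folded rel_span_def]
  PV.span_neg[of _ "{f. \<exists>w. rel lam w f \<and> Q w}" for lam Q, folded rel_span_def]
  PV.span_scale[of _ "{f. \<exists>w. rel lam w f \<and> Q w}" for lam Q, folded rel_span_def]
  PV.span_zero[of "{f. \<exists>w. rel lam w f \<and> Q w}" for lam Q, folded rel_span_def]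

lemma span_linear_image:
  fixes F :: "('x, 'k::field) omega_poly \<Rightarrow> ('y, 'k) omega_poly"
  assumes "f \<in> PV.span S" and add: "\<And>f g. F (f + g) = F f + F g"
    and scale: "\<And>c f. F (pscale c f) = pscale c (F f)"
    and S: "\<And>f. f \<in> S \<Longrightarrow> F f \<in> PV.span T"
  shows "F f \<in> PV.span T"
  using assms(1)
proof (induction rule: PV.span_induct_alt)
  case base
  have "F 0 = pscale 0 (F 0)" using scale[of 0 0] by simp
  then show ?case using PV.span_zero by simp
next
  case (step c x y)
  then show ?case by (simp add: add scale PV.span_add PV.span_scale S)
qed

lemma rel_span_ctx:
  assumes "f \<in> rel_span lam Q" "\<And>w. Q w \<Longrightarrow> R (a @ w @ b)"
  shows "ctx a f b \<in> rel_span lam R"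
  using assms(1) unfolding rel_span_def
  by (rule span_linear_image)
    (use assms(2) in \<open>auto simp: ctx_add ctx_pscale intro!: PV.span_base rel_in_ctx\<close>)

lemma rel_span_pop:
  assumes "f \<in> rel_span lam Q" "\<And>w. Q w \<Longrightarrow> R [Op w]"
  shows "pop f \<in> rel_span lam R"
  using assms(1) unfolding rel_span_def
  by (rule span_linear_image)
    (use assms(2) in \<open>auto simp: pop_add pop_pscale intro!: PV.span_base rel_pop\<close>)

lemma linear_on_supp:
  fixes F :: "('x, 'k::field) omega_poly \<Rightarrow> ('y, 'k) omega_poly"
  assumes add: "\<And>f g. F (f + g) = F f + F g"
    and scale: "\<And>c f. F (pscale c f) = pscale c (F f)"
    and S: "\<And>u. u \<in> supp f \<Longrightarrow> F (mon u) \<in> PV.span T"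
  shows "F f \<in> PV.span T"
proof -
  have "additive F" by (simp add: additive_def add)
  then have "F (\<Sum>u\<in>supp f. pscale (coef f u) (mon u)) = (\<Sum>u\<in>supp f. pscale (coef f u) (F (mon u)))"
    by (simp add: additive.sum scale)
  then have "F f = (\<Sum>u\<in>supp f. pscale (coef f u) (F (mon u)))"
    using poly_sum_mon[of f] by simp
  then show ?thesis using S by (simp add: PV.span_sum PV.span_scale)
qed

text \<open>The generating relations have \<open>v < u\<close>. The remaining pairs reduce to them
  by antisymmetry of \<open>rb_rel\<close>, which is why \<open>Q\<close> is demanded for both
  orders of the two letters.\<close>

lemma rb_rel_mon_in_span:
  assumes "u \<in> omega_words UNIV" "v \<in> omega_words UNIV" "Q [Op u, Op v]" "Q [Op v, Op u]"
  shows "rb_rel lam (mon u) (mon v) \<in> rel_span lam Q"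
proof -
  have "u = v \<or> Dl_less u v \<or> Dl_less v u"
    using Dl_less_total[of UNIV u v] assms(1,2) by (simp add: omega_words_iff)
  then consider "u = v" | "Dl_less u v" | "Dl_less v u" by blast
  then show ?thesis
  proof cases
    case 1
    then show ?thesis by (simp add: rel_span_closed)
  next
    case 2
    have "rb_rel lam (mon v) (mon u) \<in> rel_span lam Q"
      by (rule rel_span_gen[where w = "[Op v, Op u]"])
        (use 2 assms in \<open>auto intro: lrel_rel lrel_rb\<close>)
    then show ?thesis using rb_rel_swap[of lam "mon u" "mon v"] by (simp add: rel_span_closed)
  next
    case 3
    then show ?thesis
      by (intro rel_span_gen[where w = "[Op u, Op v]"])
        (use assms in \<open>auto intro: lrel_rel lrel_rb\<close>)
  qed
qed

lemma rb_rel_in_span: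
  assumes "poly_over UNIV f" "poly_over UNIV g"
    and Q: "\<And>u v. u \<in> supp f \<Longrightarrow> v \<in> supp g \<Longrightarrow> Q [Op u, Op v] \<and> Q [Op v, Op u]"
  shows "rb_rel lam f g \<in> rel_span lam Q"
  unfolding rel_span_def
proof (rule linear_on_supp[of "\<lambda>f. rb_rel lam f g"])
  fix u assume u: "u \<in> supp f"
  show "rb_rel lam (mon u) g \<in> PV.span {f. \<exists>w. rel lam w f \<and> Q w}"
  proof (rule linear_on_supp[of "\<lambda>g. rb_rel lam (mon u) g"])
    fix v assume v: "v \<in> supp g"
    have "rb_rel lam (mon u) (mon v) \<in> rel_span lam Q"
      by (rule rb_rel_mon_in_span)
        (use Q[OF u v] assms(1,2) u v in \<open>auto simp: poly_over_def omega_words_iff\<close>)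
    then show "rb_rel lam (mon u) (mon v) \<in> PV.span {f. \<exists>w. rel lam w f \<and> Q w}"
      by (simp add: rel_span_def)
  qed (simp_all add: rb_rel_add_right rb_rel_pscale_right)
qed (simp_all add: rb_rel_add_left rb_rel_pscale_left)

subsection \<open>Local confluence\<close>

abbreviation rel_below :: "'k::field \<Rightarrow> 'x::wellorder word \<Rightarrow> ('x, 'k) omega_poly set" where
  "rel_below lam w \<equiv> rel_span lam (\<lambda>v. Dl_less v w)"

text \<open>With \<open>l = f + fr\<close> and \<open>r = g + gr\<close> both sides contain
  \<open>f m g\<close>, and what is left is \<open>f m gr - fr m g\<close>: relations at words in
  which one of the redexes has been replaced by a smaller word.\<close>

lemma confluent_disjoint:
  assumes f: "lrel lam l f" and g: "lrel lam r g"
  shows "ctx a f (m @ r @ b) - ctx (a @ l @ m) g b \<in> rel_below lam (a @ l @ m @ r @ b)"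
proof -
  define fr where "fr = mon l - f"
  define gr where "gr = mon r - g"
  have fr: "below fr l" and gr: "below gr r"
    unfolding fr_def gr_def using has_lead_diff[OF has_lead_mon] has_lead_lrel f g by blast+
  have "ctx a f (m @ r @ b) = ctx a (pmul f (pmul (mon m) (mon r))) b"
    and "ctx (a @ l @ m) g b = ctx a (pmul (pmul (mon l) (mon m)) g) b"
    by (simp_all add: ctx_def mon_append pmul_assoc)
  then have "ctx a f (m @ r @ b) - ctx (a @ l @ m) g b
    = ctx a (pmul f (pmul (mon m) gr)) b - ctx a (pmul fr (pmul (mon m) g)) b"
    by (simp add: fr_def gr_def ctx_def pmul_distribs pmul_assoc)
  moreover have "ctx a (pmul f (pmul (mon m) gr)) b \<in> rel_below lam (a @ l @ m @ r @ b)"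
    unfolding rel_span_def
  proof (rule linear_on_supp[of "\<lambda>h. ctx a (pmul f (pmul (mon m) h)) b"])
    fix x assume "x \<in> supp gr"
    then have x: "Dl_less x r" using gr by (simp add: below_def)
    have "ctx a (pmul f (pmul (mon m) (mon x))) b = ctx a f (m @ x @ b)"
      by (simp add: ctx_def mon_append pmul_assoc)
    moreover have "rel lam (a @ l @ m @ x @ b) (ctx a f (m @ x @ b))"
      using rel_ctx[OF f] by simp
    moreover have "Dl_less (a @ l @ m @ x @ b) (a @ l @ m @ r @ b)"
      using Dl_less_context[OF x, of "a @ l @ m" b] by simp
    ultimately show "ctx a (pmul f (pmul (mon m) (mon x))) b
        \<in> PV.span {f. \<exists>w. rel lam w f \<and> Dl_less w (a @ l @ m @ r @ b)}"
      by (intro PV.span_base) auto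
  qed (simp_all add: ctx_def pmul_distribs)
  moreover have "ctx a (pmul fr (pmul (mon m) g)) b \<in> rel_below lam (a @ l @ m @ r @ b)"
    unfolding rel_span_def
  proof (rule linear_on_supp[of "\<lambda>h. ctx a (pmul h (pmul (mon m) g)) b"])
    fix x assume "x \<in> supp fr"
    then have x: "Dl_less x l" using fr by (simp add: below_def)
    have "ctx a (pmul (mon x) (pmul (mon m) g)) b = ctx (a @ x @ m) g b"
      by (simp add: ctx_def mon_append pmul_assoc)
    moreover have "rel lam (a @ x @ m @ r @ b) (ctx (a @ x @ m) g b)"
      using rel_ctx[OF g, of "a @ x @ m" b] by simp
    moreover have "Dl_less (a @ x @ m @ r @ b) (a @ l @ m @ r @ b)"
      using Dl_less_context[OF x, of a "m @ r @ b"] by simp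
    ultimately show "ctx a (pmul (mon x) (pmul (mon m) g)) b
        \<in> PV.span {f. \<exists>w. rel lam w f \<and> Dl_less w (a @ l @ m @ r @ b)}"
      by (intro PV.span_base) auto
  qed (simp_all add: ctx_def pmul_distribs)
  ultimately show ?thesis by (simp add: rel_span_closed)
qed

text \<open>Each term of the right-hand side contains \<open>f\<close> once, in a context or below
  P; the six inequalities are about the leading words of these terms.\<close>

lemma rb_rhs_rel_in_span:
  assumes "rel lam u f" "Dl_less [Op ([Op u] @ v)] w" "Dl_less [Op (v @ [Op u])] w"
    "Dl_less [Op (u @ [Op v])] w" "Dl_less [Op ([Op v] @ u)] w" "Dl_less (u @ v) w" "Dl_less (v @ u) w"
  shows "rb_rhs lam f (mon v) \<in> rel_below lam w" "rb_rhs lam (mon v) f \<in> rel_below lam w"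
proof -
  note gens = assms(2-)[THEN rel_span_gen[rotated, of "\<lambda>v. Dl_less v w"]]
  have r: "pop (pmul (pop f) (mon v)) \<in> rel_below lam w" "pop (pmul (mon v) (pop f)) \<in> rel_below lam w"
    "pop (pmul f (mon [Op v])) \<in> rel_below lam w" "pop (pmul (mon [Op v]) f) \<in> rel_below lam w"
    "pmul f (mon v) \<in> rel_below lam w" "pmul (mon v) f \<in> rel_below lam w"
    by (rule gens, intro rel_pop rel_left rel_right assms(1))+
  show "rb_rhs lam f (mon v) \<in> rel_below lam w" "rb_rhs lam (mon v) f \<in> rel_below lam w"
    unfolding rb_rhs_def rb_circ_def pcomm_def pop_single pop_add pop_diff
    by (intro rel_span_closed r)+
qed

text \<open>The redex \<open>P(u)P(v)\<close> against a redex inside \<open>u\<close>. Writing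
  \<open>u = f + r\<close> with \<open>r\<close> below \<open>u\<close>, the part of
  \<open>rb_rel\<close> linear in \<open>f\<close> begins with \<open>P(f)P(v)\<close>, which is the
  other reduction; all else consists of relations at smaller words.\<close>

lemma confluent_nested_left:
  assumes u: "u \<in> omega_words UNIV" and v: "v \<in> omega_words UNIV" and vu: "Dl_less v u"
    and f: "rel lam u f"
  shows "rb_rel lam (mon u) (mon v) - pmul (pop f) (mon [Op v]) \<in> rel_below lam [Op u, Op v]"
proof -
  define r where "r = mon u - f"
  have r: "below r u" unfolding r_def using has_lead_diff[OF has_lead_mon] has_lead_rel f by blast
  have fo: "poly_over UNIV f" using rel_poly_over[OF f] u by (simp add: omega_words_iff)
  have ro: "poly_over UNIV r" unfolding r_def using u fo by (intro poly_over_diff) (simp_all add: poly_over_mon)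
  have vo: "poly_over UNIV (mon v)" using v by (simp only: poly_over_mon)
  have "mon u = f + r" by (simp add: r_def)
  then have "rb_rel lam (mon u) (mon v) - pmul (pop f) (mon [Op v])
    = rb_rel lam r (mon v) - pmul (mon [Op v]) (pop f) - rb_rhs lam f (mon v)"
    by (simp add: rb_rel_add_left) (simp add: rb_rel_def pcomm_def pop_single)
  moreover have "rb_rel lam r (mon v) \<in> rel_below lam [Op u, Op v]"
  proof (rule rb_rel_in_span[OF ro vo])
    fix x y assume "x \<in> supp r" "y \<in> supp (mon v :: ('a, 'b) omega_poly)"
    then have x: "Dl_less x u" "y = v" using r by (auto simp: below_def)
    then show "Dl_less [Op x, Op y] [Op u, Op v] \<and> Dl_less [Op y, Op x] [Op u, Op v]"
      using Dl_less_pair[OF x(1), of v v] Dl_less_pair[OF vu, of x v] Dl_less_deg_le[OF x(1)] by simp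
  qed
  moreover have "pmul (mon [Op v]) (pop f) \<in> rel_below lam [Op u, Op v]"
    using Dl_less_pair[OF vu, of u v] by (intro rel_span_gen[OF rel_left[OF rel_pop[OF f]]]) simp
  moreover have "rb_rhs lam f (mon v) \<in> rel_below lam [Op u, Op v]"
    by (rule rb_rhs_rel_in_span[OF f]) (simp_all add: Dl_less_iff)
  ultimately show ?thesis by (simp add: rel_span_closed)
qed

lemma confluent_nested_right:
  assumes u: "u \<in> omega_words UNIV" and v: "v \<in> omega_words UNIV" and vu: "Dl_less v u"
    and f: "rel lam v f"
  shows "rb_rel lam (mon u) (mon v) - pmul (mon [Op u]) (pop f) \<in> rel_below lam [Op u, Op v]"
proof -
  define r where "r = mon v - f"
  have r: "below r v" unfolding r_def using has_lead_diff[OF has_lead_mon] has_lead_rel f by blast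
  have fo: "poly_over UNIV f" using rel_poly_over[OF f] v by (simp add: omega_words_iff)
  have ro: "poly_over UNIV r" unfolding r_def using v fo by (intro poly_over_diff) (simp_all add: poly_over_mon)
  have uo: "poly_over UNIV (mon u)" using u by (simp only: poly_over_mon)
  have "mon v = f + r" by (simp add: r_def)
  then have "rb_rel lam (mon u) (mon v) - pmul (mon [Op u]) (pop f)
    = rb_rel lam (mon u) r - pmul (pop f) (mon [Op u]) - rb_rhs lam (mon u) f"
    by (simp add: rb_rel_add_right) (simp add: rb_rel_def pcomm_def pop_single)
  moreover have "rb_rel lam (mon u) r \<in> rel_below lam [Op u, Op v]"
  proof (rule rb_rel_in_span[OF uo ro])
    fix y x assume "x \<in> supp r" "y \<in> supp (mon u :: ('a, 'b) omega_poly)"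
    then have x: "Dl_less x v" "y = u" using r by (auto simp: below_def)
    \<comment> \<open>Unlike for a redex inside \<open>u\<close>, the first letters agree here and
      the second one decreases; the swapped pair decreases at its first letter, as
      \<open>x < v < u\<close>.\<close>
    have "Dl_less [Op u, Op x] [Op u, Op v]"
      using Dl_less_context[OF Dl_less_Op[OF x(1)], of "[Op u]" "[]"] by simp
    then show "Dl_less [Op y, Op x] [Op u, Op v] \<and> Dl_less [Op x, Op y] [Op u, Op v]"
      using Dl_less_pair[OF Dl_less_trans[OF x(1) vu], of u v] Dl_less_deg_le[OF x(1)] x(2) by simp
  qed
  moreover have "pmul (pop f) (mon [Op u]) \<in> rel_below lam [Op u, Op v]"
    using Dl_less_pair[OF vu, of u v] by (intro rel_span_gen[OF rel_right[OF rel_pop[OF f]]]) simp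
  moreover have "rb_rhs lam (mon u) f \<in> rel_below lam [Op u, Op v]"
    by (rule rb_rhs_rel_in_span[OF f]) (simp_all add: Dl_less_iff)
  ultimately show ?thesis by (simp add: rel_span_closed)
qed

text \<open>Here \<open>p\<close>, \<open>q\<close>, \<open>r\<close> stand for \<open>P(u)\<close>,
  \<open>P(v)\<close>, \<open>P(t)\<close>. The identities are sums of Jacobi identities over the
  triples in which two, none or one of the letters \<open>u\<close>, \<open>v\<close>,
  \<open>t\<close> are replaced in this way; in the overlap they occur below P, below P with factor
  \<open>lam\<close>, and outside P with factor \<open>lam\<close>.\<close>

lemma rb_jacobi_identities:
  fixes u v t p q r :: "('x, 'k::field) omega_poly"
  shows "pcomm p (pcomm q t + pcomm v r) + pcomm u (pcomm q r)
      - (pcomm q (pcomm p t + pcomm u r) + pcomm v (pcomm p r))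
      + (pcomm r (pcomm p v + pcomm u q) + pcomm t (pcomm p q)) = 0"
    and "pcomm u (pcomm v t) - pcomm v (pcomm u t) + pcomm t (pcomm u v) = 0"
    and "pcomm u (pcomm q t + pcomm v r) + pcomm p (pcomm v t)
      - (pcomm v (pcomm p t + pcomm u r) + pcomm q (pcomm u t))
      + (pcomm t (pcomm p v + pcomm u q) + pcomm r (pcomm u v)) = 0"
  by (simp_all add: pcomm_def pmul_distribs pmul_assoc)

lemma supp_deg_le:
  assumes "\<forall>x\<in>supp f. deg x \<le> m" "\<forall>x\<in>supp g. deg x \<le> n"
  shows "\<forall>x\<in>supp (pcomm f g). deg x \<le> m + n"
  using assms supp_pmul[of f g] supp_pmul[of g f] keys_diff[of "pmul f g" "pmul g f"]
  unfolding pcomm_def by (fastforce intro: add_mono)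

text \<open>The overlap \<open>P(u)P(v)P(t)\<close>: its resolution amounts to the Jacobi identity.\<close>

lemma confluent_overlap:
  assumes u: "u \<in> omega_words UNIV" and v: "v \<in> omega_words UNIV" and t: "t \<in> omega_words UNIV"
    and vu: "Dl_less v u" and tv: "Dl_less t v"
  shows "pmul (rb_rel lam (mon u) (mon v)) (mon [Op t]) - pmul (mon [Op u]) (rb_rel lam (mon v) (mon t))
    \<in> rel_below lam [Op u, Op v, Op t]"
proof -
  let ?U = "mon u :: ('a, 'b) omega_poly" and ?V = "mon v :: ('a, 'b) omega_poly"
    and ?T = "mon t :: ('a, 'b) omega_poly"
  let ?PU = "pop ?U" and ?PV = "pop ?V" and ?PT = "pop ?T"
  let ?R = "rb_rel lam" and ?I = "rel_below lam [Op u, Op v, Op t]"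
  have tu: "Dl_less t u" using Dl_less_trans[OF tv vu] .
  have P: "mon [Op u] = ?PU" "mon [Op v] = ?PV" "mon [Op t] = ?PT" by (simp_all add: pop_single)
  define E1 where "E1 = rb_rhs lam ?V ?T"
  define E2 where "E2 = rb_rhs lam ?U ?T"
  define E3 where "E3 = rb_rhs lam ?U ?V"
  \<comment> \<open>The two reducts start with \<open>P(u)P(t)P(v)\<close> and
    \<open>P(v)P(u)P(t)\<close>; four exchanges take both to \<open>P(t)P(v)P(u)\<close>, where they
    cancel. \<open>A\<close> gathers the relations used, and the right-hand sides remain as
    commutators.\<close>
  define A where "A = - pmul ?PV (?R ?U ?T) + pmul (?R ?U ?T) ?PV - pmul (?R ?V ?T) ?PU + pmul ?PT (?R ?U ?V)"
  have split1: "pmul (?R ?U ?V) ?PT - pmul ?PU (?R ?V ?T)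
    = A + (pcomm ?PU E1 - pcomm ?PV E2 + pcomm ?PT E3)"
    unfolding A_def E1_def E2_def E3_def
    by (simp add: rb_rel_def pcomm_def pmul_distribs pmul_assoc)
  have gen: "lrel lam [Op u, Op v] (?R ?U ?V)" "lrel lam [Op v, Op t] (?R ?V ?T)"
    "lrel lam [Op u, Op t] (?R ?U ?T)"
    using u v t vu tv tu by (auto intro: lrel_rb)
  have less: "Dl_less [Op v, Op u] [Op u, Op v]" "Dl_less [Op t, Op v] [Op v, Op t]"
    "Dl_less [Op t, Op u] [Op u, Op t]"
    using Dl_less_pair[OF vu, of u v] Dl_less_pair[OF tv, of v t] Dl_less_pair[OF tu, of u t] by simp_all
  have w1: "Dl_less [Op v, Op u, Op t] [Op u, Op v, Op t]"
    using Dl_less_context[OF less(1), of "[]" "[Op t]"] by simp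
  have w2: "Dl_less [Op u, Op t, Op v] [Op u, Op v, Op t]"
    using Dl_less_context[OF less(2), of "[Op u]" "[]"] by simp
  have w3: "Dl_less [Op v, Op t, Op u] [Op u, Op v, Op t]"
    using Dl_less_trans[OF _ w1] Dl_less_context[OF less(3), of "[Op v]" "[]"] by simp
  have w4: "Dl_less [Op t, Op u, Op v] [Op u, Op v, Op t]"
    using Dl_less_trans[OF _ w2] Dl_less_context[OF less(3), of "[]" "[Op v]"] by simp
  have A1: "pmul ?PV (?R ?U ?T) \<in> ?I"
    using rel_span_gen[OF rel_left[OF lrel_rel[OF gen(3)], of "[Op v]"], of "\<lambda>x. Dl_less x [Op u, Op v, Op t]"] w1
    by (simp add: P)
  have A2: "pmul (?R ?U ?T) ?PV \<in> ?I"
    using rel_span_gen[OF rel_right[OF lrel_rel[OF gen(3)], of "[Op v]"], of "\<lambda>x. Dl_less x [Op u, Op v, Op t]"] w2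
    by (simp add: P)
  have A3: "pmul (?R ?V ?T) ?PU \<in> ?I"
    using rel_span_gen[OF rel_right[OF lrel_rel[OF gen(2)], of "[Op u]"], of "\<lambda>x. Dl_less x [Op u, Op v, Op t]"] w3
    by (simp add: P)
  have A4: "pmul ?PT (?R ?U ?V) \<in> ?I"
    using rel_span_gen[OF rel_left[OF lrel_rel[OF gen(1)], of "[Op t]"], of "\<lambda>x. Dl_less x [Op u, Op v, Op t]"] w4
    by (simp add: P)
  have A: "A \<in> ?I" unfolding A_def by (intro rel_span_closed A1 A2 A3 A4)
  define C1 where "C1 = rb_circ ?V ?T"
  define C2 where "C2 = rb_circ ?U ?T"
  define C3 where "C3 = rb_circ ?U ?V"
  define B where "B = ?R ?U C1 - ?R ?V C2 + ?R ?T C3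
    - pop (pcomm ?U (?R ?V ?T)) + pop (pcomm ?V (?R ?U ?T)) - pop (pcomm ?T (?R ?U ?V))"
  \<comment> \<open>The commutator of \<open>P(x)\<close> with \<open>P(rb_circ y z)\<close> is
    again rewritten by a relation. In the terms below P, \<open>P(rb_circ y z)\<close> is turned
    back into \<open>[P(y), P(z)]\<close>, which puts them into the form of
    \<open>rb_jacobi_identities\<close>.\<close>
  have expand: "pcomm (pop x) (rb_rhs lam y z) = ?R x (rb_circ y z) - pop (pcomm x (?R y z))
      + pop (pcomm (pop x) (rb_circ y z) + pcomm x (pcomm (pop y) (pop z)))
      - pscale lam (pop (pcomm x (pcomm y z)))
      + pscale lam (pcomm x (rb_circ y z) + pcomm (pop x) (pcomm y z))" for x y z
    unfolding rb_rel_def[of lam x] rb_rhs_def[of lam x] rb_circ_def[of x]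
    unfolding rb_rel_def rb_rhs_def
    by (simp add: pcomm_distribs pop_distribs pscale_distribs)
  have split2: "pcomm ?PU E1 - pcomm ?PV E2 + pcomm ?PT E3 = B"
  proof -
    have "pcomm ?PU E1 - pcomm ?PV E2 + pcomm ?PT E3 = B
      + pop (pcomm ?PU C1 + pcomm ?U (pcomm ?PV ?PT) - (pcomm ?PV C2 + pcomm ?V (pcomm ?PU ?PT))
          + (pcomm ?PT C3 + pcomm ?T (pcomm ?PU ?PV)))
      - pscale lam (pop (pcomm ?U (pcomm ?V ?T) - pcomm ?V (pcomm ?U ?T) + pcomm ?T (pcomm ?U ?V)))
      + pscale lam (pcomm ?U C1 + pcomm ?PU (pcomm ?V ?T) - (pcomm ?V C2 + pcomm ?PV (pcomm ?U ?T))
          + (pcomm ?T C3 + pcomm ?PT (pcomm ?U ?V)))"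
      unfolding E1_def E2_def E3_def expand B_def C1_def[symmetric] C2_def[symmetric] C3_def[symmetric]
      by (simp add: pop_distribs pscale_distribs)
    then show ?thesis
      unfolding C1_def C2_def C3_def rb_circ_def rb_jacobi_identities by simp
  qed
  \<comment> \<open>By this bound \<open>P(x)P(c)\<close>, for \<open>c\<close> in
    \<open>rb_circ y z\<close>, has at most the degree of \<open>P(u)P(v)P(t)\<close>, and its
    breadth is 2 against 3.\<close>
  have degC: "\<forall>x\<in>supp (rb_circ (mon y) (mon z) :: ('a, 'b) omega_poly). deg x \<le> Suc (deg y + deg z)" for y z
    unfolding rb_circ_def pcomm_def pop_single pmul_single
    using keys_add[of "mon ([Op y] @ z) - mon (z @ [Op y])" "mon (y @ [Op z]) - mon ([Op z] @ y)"]
      keys_diff[of "mon ([Op y] @ z)" "mon (z @ [Op y])"]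
      keys_diff[of "mon (y @ [Op z])" "mon ([Op z] @ y)"]
    by (fastforce split: if_splits)
  have B1: "?R (mon x) (rb_circ (mon y) (mon z)) \<in> ?I"
    if "x \<in> omega_words UNIV" "y \<in> omega_words UNIV" "z \<in> omega_words UNIV"
      "deg x + deg y + deg z = deg u + deg v + deg t" for x y z
  proof (rule rb_rel_in_span)
    show "poly_over UNIV (mon x)" "poly_over UNIV (rb_circ (mon y) (mon z))"
      using that by (simp_all only: poly_over_mon poly_over_rb_circ)
    fix x' c assume "x' \<in> supp (mon x :: ('a, 'b) omega_poly)" "c \<in> supp (rb_circ (mon y) (mon z) :: ('a, 'b) omega_poly)"
    then have "x' = x" "deg c \<le> Suc (deg y + deg z)" using degC by auto
    then show "Dl_less [Op x', Op c] [Op u, Op v, Op t] \<and> Dl_less [Op c, Op x'] [Op u, Op v, Op t]"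
      using that(4) by (auto simp: Dl_less_iff)
  qed
  \<comment> \<open>The constant 2 counts the two operators of a leading word such as
    \<open>P(u)P(v)\<close>; the outer P brings the degree up to at most that of the overlap, at
    breadth 1.\<close>
  have B2: "pop (pcomm (mon x) f) \<in> ?I"
    if f: "rel lam l f" and "deg x + deg l \<le> deg u + deg v + deg t + 2" for x l f
  proof -
    have "pop (pmul (mon x) f) \<in> ?I" "pop (pmul f (mon x)) \<in> ?I"
      by (rule rel_span_gen[OF rel_pop], rule rel_left[OF f] rel_right[OF f],
        use that(2) in \<open>auto simp: Dl_less_iff\<close>)+
    then show ?thesis unfolding pcomm_def pop_diff by (rule rel_span_closed(2))
  qed
  have "B \<in> ?I"
    unfolding B_def C1_def C2_def C3_def
    by (intro rel_span_closed B1 u v t B2[OF lrel_rel[OF gen(1)]] B2[OF lrel_rel[OF gen(2)]]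
      B2[OF lrel_rel[OF gen(3)]]) simp_all
  then show ?thesis unfolding P split1 split2 using A by (intro rel_span_closed)
qed

text \<open>A redex has one or two letters. If the second redex starts inside the first, the first
  must be \<open>P(u)P(v)\<close> and the second starts at \<open>P(v)\<close>: it is either
  \<open>P(v)P(t)\<close>, the essential overlap, or \<open>P(v)\<close> with a redex inside
  \<open>v\<close>.\<close>

lemma confluent_shifted:
  assumes f: "lrel lam l f" and f': "lrel lam l' f'" and eq: "a @ l @ b = a' @ l' @ b'"
    and lt: "length a < length a'"
  shows "ctx a f b - ctx a' f' b' \<in> rel_below lam (a @ l @ b)"
proof -
  have eq': "(a @ l) @ b = a' @ (l' @ b')" using eq by simp
  from append_eq_append_cases[OF eq'] show ?thesis
  proof (elim disjE exE conjE)
    fix c assume "b = c @ l' @ b'" "a' = (a @ l) @ c"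
    then show ?thesis using confluent_disjoint[OF f f', of a c b'] by simp
  next
    fix c assume c: "c \<noteq> []" "a @ l = a' @ c" "l' @ b' = c @ b"
    from append_eq_append_cases[OF c(2)] obtain d where d: "a' = a @ d" "l = d @ c"
      using lt by fastforce
    have "d \<noteq> []" using lt d(1) by auto
    then have len: "length l \<ge> 2" using d(2) c(1) by (cases d; cases c) simp_all
    obtain u v where l: "l = [Op u, Op v]" and fe: "f = rb_rel lam (mon u) (mon v)"
      and uvo: "u \<in> omega_words UNIV" "v \<in> omega_words UNIV" and vu: "Dl_less v u"
      using f len by cases simp_all
    have dc: "d = [Op u]" "c = [Op v]"
      using d(2) l \<open>d \<noteq> []\<close> c(1) by (cases d; cases "tl d"; simp)+
    note uv = dc l fe uvo vu
    have l'b': "l' @ b' = Op v # b" using c(3) dc by simp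
    from f' show ?thesis
    proof cases
      case (lrel_rb v' t)
      then have t: "v' = v" "b = Op t # b'" using l'b' by auto
      have "pmul f (mon [Op t]) - pmul (mon [Op u]) f' \<in> rel_below lam [Op u, Op v, Op t]"
        using confluent_overlap[of u v t lam] uv lrel_rb t by simp
      then have "ctx a (pmul f (mon [Op t]) - pmul (mon [Op u]) f') b' \<in> rel_below lam (a @ l @ b)"
        by (rule rel_span_ctx[of _ lam "\<lambda>x. Dl_less x [Op u, Op v, Op t]"])
          (use Dl_less_context[of _ "[Op u, Op v, Op t]" a b'] uv t in simp)
      moreover have "ctx a (pmul f (mon [Op t])) b' = ctx a f b"
        by (simp add: ctx_def t pmul_assoc pmul_single)
      moreover have "ctx a (pmul (mon [Op u]) f') b' = ctx a' f' b'"
        by (simp add: ctx_def d dc pmul_assoc mon_append[of a "[Op u]"])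
      ultimately show ?thesis by (simp add: ctx_diff)
    next
      case (lrel_op w g)
      then have w: "w = v" "b' = b" using l'b' by auto
      have "f - pmul (mon [Op u]) f' \<in> rel_below lam [Op u, Op v]"
        using confluent_nested_right[of u v lam g] uv lrel_op w by simp
      then have "ctx a (f - pmul (mon [Op u]) f') b \<in> rel_below lam (a @ l @ b)"
        by (rule rel_span_ctx[of _ lam "\<lambda>x. Dl_less x [Op u, Op v]"])
          (use Dl_less_context[of _ "[Op u, Op v]" a b] uv in simp)
      moreover have "ctx a (pmul (mon [Op u]) f') b = ctx a' f' b'"
        by (simp add: ctx_def d dc w pmul_assoc mon_append[of a "[Op u]"])
      ultimately show ?thesis by (simp add: ctx_diff)
    qed
  qed
qed

lemma confluent_same_start:
  assumes f: "lrel lam [Op u, Op v] f" and f': "lrel lam [Op u] f'"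
  shows "ctx a f b - ctx a f' (Op v # b) \<in> rel_below lam (a @ Op u # Op v # b)"
proof -
  obtain g where g: "f' = pop g" "rel lam u g" using f' by cases auto
  have "f - pmul f' (mon [Op v]) \<in> rel_below lam [Op u, Op v]"
    using f by cases (use confluent_nested_left[of u v lam g] g in auto)
  then have "ctx a (f - pmul f' (mon [Op v])) b \<in> rel_below lam (a @ [Op u, Op v] @ b)"
    by (rule rel_span_ctx[of _ lam "\<lambda>x. Dl_less x [Op u, Op v]"])
      (use Dl_less_context[of _ "[Op u, Op v]" a b] in simp)
  then show ?thesis
    by (simp add: ctx_diff) (simp add: ctx_def pmul_assoc pmul_single)
qed

lemma rel_span_uminus: "- f \<in> rel_span lam Q \<Longrightarrow> f \<in> rel_span lam Q"
  using rel_span_closed(3)[of "- f" lam Q] by simp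

lemma lrel_cases_length:
  assumes "lrel lam l f"
  obtains u v where "l = [Op u, Op v]" | w where "l = [Op w]"
  using assms by cases blast+

text \<open>Redexes with different starts are covered by \<open>confluent_shifted\<close>, those
  with the same start and different widths by \<open>confluent_same_start\<close>. The induction
  serves for one and the same position, where it descends into the argument of P.\<close>

theorem rel_confluent: "rel lam w f \<Longrightarrow> \<forall>g. rel lam w g \<longrightarrow> f - g \<in> rel_below lam w"
  and lrel_confluent: "lrel lam l f \<Longrightarrow> \<forall>g. lrel lam l g \<longrightarrow> f - g \<in> rel_below lam l"
proof (induction rule: rel_lrel.inducts)
  case (rel_ctx l f a b)
  show ?case
  proof (intro allI impI)
    fix g assume "rel lam (a @ l @ b) g"
    then obtain a' l' b' g' where g: "a @ l @ b = a' @ l' @ b'" "g = ctx a' g' b'" "lrel lam l' g'"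
      by cases auto
    consider "length a < length a'" | "length a' < length a" | "a = a'" "l @ b = l' @ b'"
      using g(1) append_eq_append_conv[of a a' "l @ b" "l' @ b'"]
        less_linear[of "length a" "length a'"] by auto
    then show "ctx a f b - g \<in> rel_below lam (a @ l @ b)"
    proof cases
      case 1
      then show ?thesis using confluent_shifted[OF rel_ctx(1) g(3,1)] g(2) by simp
    next
      case 2
      then have "ctx a' g' b' - ctx a f b \<in> rel_below lam (a' @ l' @ b')"
        using confluent_shifted[OF g(3) rel_ctx(1) g(1)[symmetric]] by simp
      then show ?thesis using g by (intro rel_span_uminus[of "ctx a f b - g"]) simp
    next
      case 3
      from rel_ctx(1) show ?thesis
      proof (cases rule: lrel_cases_length)
        case l: (1 u v)
        from g(3) show ?thesis
        proof (cases rule: lrel_cases_length)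
          case (1 u' v')
          then have "l' = l" "b' = b" using l 3 by auto
          moreover from this have "f - g' \<in> rel_below lam l" using spec[OF rel_ctx.IH(2), of g'] g(3) by simp
          then have "ctx a (f - g') b \<in> rel_below lam (a @ l @ b)"
            by (rule rel_span_ctx[of _ lam "\<lambda>v. Dl_less v l"]) (rule Dl_less_context)
          ultimately show ?thesis using g(2) 3(1) by (simp add: ctx_diff)
        next
          case (2 w)
          then have e: "l' = [Op u]" "b' = Op v # b" using l 3 by auto
          have "lrel lam [Op u, Op v] f" "lrel lam [Op u] g'" using rel_ctx(1) g(3) l e(1) by simp_all
          from confluent_same_start[OF this, of a b] show ?thesis unfolding g(2) l e(2) 3(1) by simp
        qed
      next
        case l: (2 w)
        from g(3) show ?thesis
        proof (cases rule: lrel_cases_length)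
          case (1 u' v')
          then have e: "l = [Op u']" "b = Op v' # b'" using l 3 by auto
          have "lrel lam [Op u', Op v'] g'" "lrel lam [Op u'] f" using rel_ctx(1) g(3) 1 e(1) by simp_all
          from confluent_same_start[OF this, of a b']
          have "ctx a g' b' - ctx a f b \<in> rel_below lam (a @ l @ b)" unfolding e by simp
          then show ?thesis using g(2) 3(1) by (intro rel_span_uminus[of "ctx a f b - g"]) simp
        next
          case (2 w')
          then have "l' = l" "b' = b" using l 3 by auto
          moreover from this have "f - g' \<in> rel_below lam l" using spec[OF rel_ctx.IH(2), of g'] g(3) by simp
          then have "ctx a (f - g') b \<in> rel_below lam (a @ l @ b)"
            by (rule rel_span_ctx[of _ lam "\<lambda>v. Dl_less v l"]) (rule Dl_less_context)
          ultimately show ?thesis using g(2) 3(1) by (simp add: ctx_diff)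
        qed
      qed
    qed
  qed
next
  case (lrel_rb u v)
  show ?case
  proof (intro allI impI)
    fix g assume "lrel lam [Op u, Op v] g"
    then have "g = rb_rel lam (mon u) (mon v)" by cases auto
    then show "rb_rel lam (mon u) (mon v) - g \<in> rel_below lam [Op u, Op v]"
      by (simp add: rel_span_closed)
  qed
next
  case (lrel_op w f)
  show ?case
  proof (intro allI impI)
    fix g assume "lrel lam [Op w] g"
    then obtain g' where "g = pop g'" "rel lam w g'" by cases auto
    moreover from this have "pop (f - g') \<in> rel_below lam [Op w]"
      using lrel_op.IH by (intro rel_span_pop[of "f - g'" lam "\<lambda>v. Dl_less v w"]) (simp_all add: Dl_less_Op)
    ultimately show "pop f - g \<in> rel_below lam [Op w]" by (simp add: pop_diff)
  qed
qed

subsection \<open>Normal forms\<close>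

definition lin_ext :: "('x word \<Rightarrow> ('y, 'k::field) omega_poly) \<Rightarrow> ('x, 'k) omega_poly \<Rightarrow> ('y, 'k) omega_poly" where
  "lin_ext F f = (\<Sum>u\<in>supp f. pscale (coef f u) (F u))"

lemma lin_ext_superset:
  assumes "finite A" "supp f \<subseteq> A"
  shows "lin_ext F f = (\<Sum>u\<in>A. pscale (coef f u) (F u))"
  unfolding lin_ext_def by (intro sum.mono_neutral_left assms) (simp add: in_keys_iff)

lemma lin_ext_mon: "lin_ext F (mon u) = F u"
  by (simp add: lin_ext_def)

lemma lin_ext_add: "lin_ext F (f + g) = lin_ext F f + lin_ext F g"
proof -
  let ?A = "supp f \<union> supp g"
  show ?thesis
    by (subst (1 2 3) lin_ext_superset[of ?A])
      (use keys_add[of f g] in \<open>auto simp: lookup_add PV.scale_left_distrib sum.distrib\<close>)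
qed

lemma lin_ext_pscale: "lin_ext F (pscale c f) = pscale c (lin_ext F f)"
  unfolding lin_ext_superset[OF finite_keys supp_pscale[of c f]]
  by (simp add: lin_ext_def PV.scale_sum_right)

lemma lin_ext_diff: "lin_ext F (f - g) = lin_ext F f - lin_ext F g"
  using additive.diff[of "lin_ext F" f g] by (simp add: additive_def lin_ext_add)

text \<open>Reduction along one relation chosen per word. That every relation, chosen or not, is
  sent to 0 is the content of \<open>normal_form_rel\<close>.\<close>

function normal_form :: "'k::field \<Rightarrow> 'x::wellorder word \<Rightarrow> ('x, 'k) omega_poly" where
  "normal_form lam w =
    (if \<exists>f. rel lam w f
     then (let r = mon w - (SOME f. rel lam w f)
           in \<Sum>v\<in>supp r. pscale (coef r v) (normal_form lam v))
     else mon w)"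
  by auto
termination
proof (relation "inv_image {(u, v). Dl_less u v} snd", goal_cases)
  case 1
  show ?case by (intro wf_inv_image wf_Dl_less)
next
  case (2 lam w r v)
  have "below r w" unfolding 2(2)
    by (rule has_lead_diff[OF has_lead_mon has_lead_rel[OF someI_ex[OF 2(1)]]])
  then show ?case using 2(3) by (simp add: below_def)
qed

declare normal_form.simps [simp del]

lemma normal_form_irreducible: "\<not> (\<exists>f. rel lam w f) \<Longrightarrow> normal_form lam w = mon w"
  by (simp only: normal_form.simps[of lam w] if_False)

lemma normal_form_rel_below:
  assumes IH: "\<And>v f. Dl_less v w \<Longrightarrow> rel lam v f \<Longrightarrow> lin_ext (normal_form lam) f = 0"
    and f: "f \<in> rel_below lam w"
  shows "lin_ext (normal_form lam) f = 0"
proof -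
  \<comment> \<open>All generators of the span are sent to 0, so the image lies in the span of the
    empty set.\<close>
  have "lin_ext (normal_form lam) f \<in> PV.span {}"
    using f unfolding rel_span_def
    by (rule span_linear_image) (auto simp: lin_ext_add lin_ext_pscale IH)
  then show ?thesis by simp
qed

text \<open>For the chosen relation \<open>f0\<close> this is the recursion equation. Any other
  relation with the same word differs from it by relations with smaller words, and those vanish by
  induction.\<close>

lemma normal_form_rel: "rel lam w f \<Longrightarrow> lin_ext (normal_form lam) f = 0"
proof (induction w arbitrary: f rule: wf_induct_rule[OF wf_Dl_less])
  case (1 w)
  define f0 where "f0 = (SOME f. rel lam w f)"
  have ex: "\<exists>f. rel lam w f" using 1(2) by blast
  have f0: "rel lam w f0" unfolding f0_def by (rule someI_ex[OF ex])
  have "normal_form lam w = lin_ext (normal_form lam) (mon w - f0)"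
    by (subst normal_form.simps) (simp add: ex lin_ext_def Let_def f0_def)
  then have "lin_ext (normal_form lam) f0 = 0"
    by (simp add: lin_ext_diff lin_ext_mon)
  moreover have "lin_ext (normal_form lam) (f - f0) = 0"
  proof (rule normal_form_rel_below)
    show "f - f0 \<in> rel_below lam w" using rel_confluent[OF 1(2)] f0 by blast
  qed (use 1(1) in auto)
  ultimately show ?case by (simp add: lin_ext_diff)
qed

lemma supp_normal_form: "v \<in> supp (normal_form lam w) \<Longrightarrow> v = w \<or> Dl_less v w"
proof (induction w arbitrary: v rule: wf_induct_rule[OF wf_Dl_less])
  case (1 w)
  show ?case
  proof (cases "\<exists>f. rel lam w f")
    case True
    define r where "r = mon w - (SOME f. rel lam w f)"
    have r: "below r w" unfolding r_def
      by (rule has_lead_diff[OF has_lead_mon has_lead_rel[OF someI_ex[OF True]]])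
    have "normal_form lam w = (\<Sum>x\<in>supp r. pscale (coef r x) (normal_form lam x))"
      by (subst normal_form.simps) (simp add: True Let_def r_def)
    then obtain x where x: "x \<in> supp r" "v \<in> supp (pscale (coef r x) (normal_form lam x))"
      using 1(2) keys_sum[of "\<lambda>x. pscale (coef r x) (normal_form lam x)" "supp r"] by auto
    have xw: "Dl_less x w" using r x(1) by (simp add: below_def)
    have "v \<in> supp (normal_form lam x)" using x(2) supp_pscale by blast
    then have "v = x \<or> Dl_less v x" using 1(1)[of x v] xw by simp
    then show ?thesis using xw Dl_less_trans[of v x w] by auto
  next
    case False
    then show ?thesis using 1(2) by (simp add: normal_form_irreducible)
  qed
qed

abbreviation rel_ideal :: "'k::field \<Rightarrow> ('x::wellorder, 'k) omega_poly set" where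
  "rel_ideal lam \<equiv> rel_span lam (\<lambda>_. True)"

text \<open>The normal form of \<open>f\<close> is 0. If \<open>w\<close> were irreducible it would
  be its own normal form, while the normal forms of the other words of \<open>f\<close> stay below
  \<open>w\<close>; the coefficient at \<open>w\<close> would then be 1.\<close>

theorem lead_reducible:
  assumes f: "f \<in> rel_ideal lam" and w: "has_lead f w"
  shows "\<exists>g. rel lam w g"
proof (rule ccontr)
  assume irr: "\<not> (\<exists>g. rel lam w g)"
  have "lin_ext (normal_form lam) f \<in> PV.span {}"
    using f unfolding rel_span_def
    by (rule span_linear_image) (auto simp: lin_ext_add lin_ext_pscale normal_form_rel)
  then have "0 = coef (lin_ext (normal_form lam) f) w" by simp
  also have "\<dots> = (\<Sum>u\<in>supp f. coef f u * coef (normal_form lam u) w)"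
    by (simp add: lin_ext_def lookup_sum)
  also have "\<dots> = (\<Sum>u\<in>supp f. if u = w then 1 else 0)"
  proof (intro sum.cong refl)
    fix u assume u: "u \<in> supp f"
    show "coef f u * coef (normal_form lam u) w = (if u = w then 1 else 0)"
    proof (cases "u = w")
      case True
      then show ?thesis using w by (simp add: normal_form_irreducible[OF irr] has_lead_def)
    next
      case False
      then have "Dl_less u w" using has_leadD[OF w u] by simp
      then have "w \<notin> supp (normal_form lam u)"
        using supp_normal_form[of w lam u] Dl_less_trans[of w u w] by auto
      then show ?thesis using False by (simp add: in_keys_iff)
    qed
  qed
  also have "\<dots> = 1" using has_lead_in_supp[OF w] by simp
  finally show False by simp
qed

lemma rel_ideal_pop: "f \<in> rel_ideal lam \<Longrightarrow> pop f \<in> rel_ideal lam"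
  by (erule rel_span_pop) (rule TrueI)

lemma rel_ideal_pmul_left:
  assumes f: "f \<in> rel_ideal lam" shows "pmul g f \<in> rel_ideal lam"
proof -
  have m: "pmul (mon u) f \<in> PV.span {f. \<exists>w. rel lam w f \<and> True}" for u
    using rel_span_ctx[OF f, of "\<lambda>_. True" u "[]", OF TrueI] unfolding ctx_def rel_span_def pmul_Nil .
  show ?thesis unfolding rel_span_def
    by (rule linear_on_supp[of "\<lambda>g. pmul g f"]) (rule pmul_add_left pmul_pscale_left m)+
qed

lemma rel_ideal_pmul_right:
  assumes f: "f \<in> rel_ideal lam" shows "pmul f g \<in> rel_ideal lam"
proof -
  have m: "pmul f (mon u) \<in> PV.span {f. \<exists>w. rel lam w f \<and> True}" for u
    using rel_span_ctx[OF f, of "\<lambda>_. True" "[]" u, OF TrueI] unfolding ctx_def rel_span_def pmul_Nil .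
  show ?thesis unfolding rel_span_def
    by (rule linear_on_supp[of "\<lambda>g. pmul f g"]) (rule pmul_add_right pmul_pscale_right m)+
qed

lemma rb_rel_in_rel_ideal: "poly_over UNIV f \<Longrightarrow> poly_over UNIV g \<Longrightarrow> rb_rel lam f g \<in> rel_ideal lam"
  by (rule rb_rel_in_span) (simp_all only: simp_thms)

section \<open>Lyndon-Shirshov bracketings in a Lie algebra with operator\<close>

lemma scalars_simps [simp]:
  "carrier scalars = UNIV" "a \<oplus>\<^bsub>scalars\<^esub> b = a + b" "a \<otimes>\<^bsub>scalars\<^esub> b = a * b"
  "\<zero>\<^bsub>scalars\<^esub> = 0" "\<one>\<^bsub>scalars\<^esub> = 1"
  by (simp_all add: ring_of_type_algebra_def)

inductive_set lspan :: "('k::field, 'a, 'm) lie_op_scheme \<Rightarrow> 'a set \<Rightarrow> 'a set" for L B where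
  lspan_zero: "\<zero>\<^bsub>L\<^esub> \<in> lspan L B"
| lspan_step: "b \<in> B \<Longrightarrow> x \<in> lspan L B \<Longrightarrow> (c \<odot>\<^bsub>L\<^esub> b) \<oplus>\<^bsub>L\<^esub> x \<in> lspan L B"

text \<open>Bracketings are evaluated not only in polynomials but also in test algebras and in
  products, hence \<open>comm_eval\<close> is repeated for an arbitrary bracket.\<close>

primrec teval :: "('a \<Rightarrow> 'a \<Rightarrow> 'a) \<Rightarrow> 'a bword \<Rightarrow> 'a" where
  "teval m (Letter a) = a"
| "teval m (Br s t) = m (teval m s) (teval m t)"

primrec ev_prm :: "('a \<Rightarrow> 'a \<Rightarrow> 'a) \<Rightarrow> ('a \<Rightarrow> 'a) \<Rightarrow> ('y \<Rightarrow> 'a) \<Rightarrow> 'y bprm \<Rightarrow> 'a" where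
  "ev_prm m P \<phi> (BGen y) = \<phi> y"
| "ev_prm m P \<phi> (BOp t) = P (teval m (map_bword (ev_prm m P \<phi>) t))"

definition nword_ev :: "('k, 'a, 'm) lie_op_scheme \<Rightarrow> ('y \<Rightarrow> 'a) \<Rightarrow> 'y nword \<Rightarrow> 'a" where
  "nword_ev L \<phi> t = teval (monoid.mult L) (map_bword (ev_prm (monoid.mult L) (opr L) \<phi>) t)"

lemma set_bword_underlying: "set_bword t = set (underlying t)"
  by (induction t) auto

lemma underlying_map: "underlying (map_bword f t) = map f (underlying t)"
  by (induction t) auto

section \<open>Identities and spans in a Lie algebra with operator\<close>

context lie_op_algebra
begin

lemma smult_add_scalar: "x \<in> carrier L \<Longrightarrow> (c + d) \<odot> x = c \<odot> x \<oplus> d \<odot> x"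
  using smult_l_distr[of c d x] by simp

lemma smult_add_vector: "x \<in> carrier L \<Longrightarrow> y \<in> carrier L \<Longrightarrow> c \<odot> (x \<oplus> y) = c \<odot> x \<oplus> c \<odot> y"
  using smult_r_distr[of c x y] by simp

lemma smult_smult: "x \<in> carrier L \<Longrightarrow> c \<odot> (d \<odot> x) = (c * d) \<odot> x"
  using smult_assoc1[of c d x] by simp

lemma smult_1: "x \<in> carrier L \<Longrightarrow> 1 \<odot> x = x"
  using smult_one[of x] by simp

lemma smult_0: "x \<in> carrier L \<Longrightarrow> 0 \<odot> x = \<zero>"
  using smult_l_null[of x] by simp

lemma smult_zero: "c \<odot> \<zero> = \<zero>"
  using smult_r_null[of c] by simp

lemma smult_uminus: "x \<in> carrier L \<Longrightarrow> (- c) \<odot> x = \<ominus> (c \<odot> x)"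
proof -
  assume x: "x \<in> carrier L"
  have "(- c) \<odot> x \<oplus> c \<odot> x = \<zero>"
    using smult_add_scalar[OF x, of "- c" c] smult_0[OF x] by simp
  then show ?thesis using x M.minus_equality[of "(- c) \<odot> x" "c \<odot> x"] by simp
qed

lemma bracket_zero_left: "y \<in> carrier L \<Longrightarrow> \<zero> \<otimes> y = \<zero>"
  using bracket_smult_left[of \<zero> y 0] smult_0[of \<zero>] smult_0[of "\<zero> \<otimes> y"] bracket_closed[of \<zero> y] by simp

lemma bracket_zero_right: "y \<in> carrier L \<Longrightarrow> y \<otimes> \<zero> = \<zero>"
  using bracket_smult_right[of y \<zero> 0] smult_0[of \<zero>] smult_0[of "y \<otimes> \<zero>"] bracket_closed[of y \<zero>] by simp

lemma bracket_swap:
  assumes x: "x \<in> carrier L" and y: "y \<in> carrier L" shows "y \<otimes> x = \<ominus> (x \<otimes> y)"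
proof -
  have c: "x \<otimes> y \<in> carrier L" "y \<otimes> x \<in> carrier L" using x y bracket_closed by auto
  have "\<zero> = (x \<oplus> y) \<otimes> (x \<oplus> y)" using bracket_alternating x y by simp
  also have "\<dots> = x \<otimes> y \<oplus> y \<otimes> x"
    unfolding bracket_add_left[OF x y M.add.m_closed[OF x y]] bracket_add_right[OF x x y]
      bracket_add_right[OF y x y] bracket_alternating[OF x] bracket_alternating[OF y]
    using c by simp
  finally show ?thesis using c M.minus_equality[of "y \<otimes> x" "x \<otimes> y"] M.a_comm[of "y \<otimes> x" "x \<otimes> y"] by simp
qed

text \<open>The Jacobi identity as the fact that right multiplication by \<open>z\<close> is a
  derivation, the form used for rewriting products of bracketings.\<close>

lemma bracket_jacobi_left:
  assumes x: "x \<in> carrier L" and y: "y \<in> carrier L" and z: "z \<in> carrier L"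
  shows "(x \<otimes> y) \<otimes> z = (x \<otimes> z) \<otimes> y \<oplus> x \<otimes> (y \<otimes> z)"
proof -
  note c = bracket_closed x y z
  have 1: "z \<otimes> (x \<otimes> y) = \<ominus> ((x \<otimes> y) \<otimes> z)" by (rule bracket_swap) (simp_all add: c)
  have "z \<otimes> x = \<ominus> (x \<otimes> z)" by (rule bracket_swap) (simp_all add: c)
  then have "y \<otimes> (z \<otimes> x) = y \<otimes> ((- 1) \<odot> (x \<otimes> z))"
    using smult_uminus[of "x \<otimes> z" 1] smult_1[of "x \<otimes> z"] by (simp add: c)
  also have "\<dots> = (- 1) \<odot> (y \<otimes> (x \<otimes> z))" by (simp add: bracket_smult_right c)
  also have "\<dots> = \<ominus> (y \<otimes> (x \<otimes> z))"
    using smult_uminus[of "y \<otimes> (x \<otimes> z)" 1] smult_1[of "y \<otimes> (x \<otimes> z)"] by (simp add: c)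
  also have "y \<otimes> (x \<otimes> z) = \<ominus> ((x \<otimes> z) \<otimes> y)" by (rule bracket_swap) (simp_all add: c)
  finally have 2: "y \<otimes> (z \<otimes> x) = (x \<otimes> z) \<otimes> y" by (simp add: c)
  have "x \<otimes> (y \<otimes> z) \<oplus> (x \<otimes> z) \<otimes> y \<oplus> \<ominus> ((x \<otimes> y) \<otimes> z) = \<zero>"
    using jacobi[OF x y z] unfolding 1 2 .
  then have "x \<otimes> (y \<otimes> z) \<oplus> (x \<otimes> z) \<otimes> y = (x \<otimes> y) \<otimes> z"
    using M.minus_equality[of "x \<otimes> (y \<otimes> z) \<oplus> (x \<otimes> z) \<otimes> y" "\<ominus> ((x \<otimes> y) \<otimes> z)"] by (simp add: c)
  then show ?thesis using M.a_comm[of "x \<otimes> (y \<otimes> z)" "(x \<otimes> z) \<otimes> y"] by (simp add: c)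
qed

lemma lspan_carrier: "B \<subseteq> carrier L \<Longrightarrow> x \<in> lspan L B \<Longrightarrow> x \<in> carrier L"
  by (erule lspan.induct) auto

lemma lspan_base: "b \<in> B \<Longrightarrow> B \<subseteq> carrier L \<Longrightarrow> b \<in> lspan L B"
  using lspan_step[OF _ lspan_zero, of b B L 1] smult_1[of b] by (auto simp: subset_iff)

lemma lspan_mono: "x \<in> lspan L B \<Longrightarrow> B \<subseteq> C \<Longrightarrow> x \<in> lspan L C"
  by (induction rule: lspan.induct) (auto intro: lspan.intros)

lemma lspan_add:
  assumes B: "B \<subseteq> carrier L" and x: "x \<in> lspan L B" and y: "y \<in> lspan L B"
  shows "x \<oplus> y \<in> lspan L B"
  using x
proof (induction rule: lspan.induct)
  case lspan_zero
  then show ?case using y lspan_carrier[OF B y] by simp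
next
  case (lspan_step b x c)
  have "b \<in> carrier L" "x \<in> carrier L" "y \<in> carrier L"
    using B lspan_step.hyps y lspan_carrier[OF B] by auto
  then have "(c \<odot> b) \<oplus> x \<oplus> y = (c \<odot> b) \<oplus> (x \<oplus> y)" by (simp add: M.a_assoc)
  then show ?case using lspan.lspan_step[OF lspan_step.hyps(1) lspan_step.IH] by simp
qed

lemma lspan_smult:
  assumes B: "B \<subseteq> carrier L" and x: "x \<in> lspan L B"
  shows "d \<odot> x \<in> lspan L B"
  using x
proof (induction rule: lspan.induct)
  case lspan_zero
  then show ?case by (simp add: smult_zero lspan.lspan_zero)
next
  case (lspan_step b x c)
  have "b \<in> carrier L" "x \<in> carrier L"
    using B lspan_step.hyps lspan_carrier[OF B] by auto
  then have "d \<odot> ((c \<odot> b) \<oplus> x) = ((d * c) \<odot> b) \<oplus> (d \<odot> x)"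
    by (simp add: smult_add_vector smult_smult)
  then show ?case using lspan.lspan_step[OF lspan_step.hyps(1) lspan_step.IH] by simp
qed

lemma lspan_uminus:
  assumes B: "B \<subseteq> carrier L" and x: "x \<in> lspan L B"
  shows "\<ominus> x \<in> lspan L B"
  using lspan_smult[OF assms, of "- 1"] smult_uminus[of x 1] smult_1[of x] lspan_carrier[OF assms] by simp

lemma lspan_bracket_left:
  assumes B: "B \<subseteq> carrier L" and C: "C \<subseteq> carrier L" and y: "y \<in> carrier L"
    and BC: "\<And>b. b \<in> B \<Longrightarrow> b \<otimes> y \<in> lspan L C" and x: "x \<in> lspan L B"
  shows "x \<otimes> y \<in> lspan L C"
  using x
proof (induction rule: lspan.induct)
  case lspan_zero
  then show ?case using y by (simp add: bracket_zero_left lspan.lspan_zero)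
next
  case (lspan_step b x c)
  have c: "b \<in> carrier L" "x \<in> carrier L"
    using B lspan_step.hyps lspan_carrier[OF B] by auto
  have "((c \<odot> b) \<oplus> x) \<otimes> y = c \<odot> (b \<otimes> y) \<oplus> x \<otimes> y"
    using c y by (simp add: bracket_add_left bracket_smult_left)
  then show ?case using lspan_add[OF C lspan_smult[OF C BC[OF lspan_step.hyps(1)]] lspan_step.IH] by simp
qed

lemma lspan_bracket_right:
  assumes B: "B \<subseteq> carrier L" and C: "C \<subseteq> carrier L" and y: "y \<in> carrier L"
    and BC: "\<And>b. b \<in> B \<Longrightarrow> y \<otimes> b \<in> lspan L C" and x: "x \<in> lspan L B"
  shows "y \<otimes> x \<in> lspan L C"
proof -
  have xc: "x \<in> carrier L" using lspan_carrier[OF B x] .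
  have "x \<otimes> y \<in> lspan L C"
  proof (rule lspan_bracket_left[OF B C y _ x])
    fix b assume b: "b \<in> B"
    then show "b \<otimes> y \<in> lspan L C"
      using bracket_swap[of y b] lspan_uminus[OF C BC[OF b]] y B by auto
  qed
  then show ?thesis using bracket_swap[OF xc y] lspan_uminus[OF C] by simp
qed

lemma teval_carrier: "set_bword t \<subseteq> carrier L \<Longrightarrow> teval (\<otimes>) t \<in> carrier L"
  by (induction t) (auto simp: bracket_closed)

end

section \<open>Products of two Lyndon-Shirshov bracketings\<close>

locale lyndon_lie = lie_op_algebra L + letter_order gt Z
  for L :: "('k::field, 'a, 'm) lie_op_scheme" (structure)
    and gt :: "'z \<Rightarrow> 'z \<Rightarrow> bool" and Z :: "'z set" +
  fixes ev :: "'z \<Rightarrow> 'a"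
  assumes ev_carrier: "z \<in> Z \<Longrightarrow> ev z \<in> carrier L"
begin

definition lyn_bracket :: "'z list \<Rightarrow> 'a" where
  "lyn_bracket w = teval (\<otimes>) (map_bword ev (std_bracket gt w))"

text \<open>Rewriting preserves the length and never leaves the words above \<open>v\<close>; this
  is the invariant carried through the induction.\<close>

definition lyn_set :: "'z set \<Rightarrow> nat \<Rightarrow> 'z list \<Rightarrow> 'z list set" where
  "lyn_set A n v = {w. lyndon gt w \<and> set w \<subseteq> A \<and> length w = n \<and> w \<ggreater> v}"

lemma lyn_bracket_carrier: "lyndon gt w \<Longrightarrow> set w \<subseteq> Z \<Longrightarrow> lyn_bracket w \<in> carrier L"
  unfolding lyn_bracket_def
  by (rule teval_carrier)
    (auto simp: set_bword_underlying underlying_map std_bracket_spec intro!: ev_carrier)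

lemma lyn_set_carrier: "A \<subseteq> Z \<Longrightarrow> lyn_bracket ` lyn_set A n v \<subseteq> carrier L"
  unfolding lyn_set_def using lyn_bracket_carrier by blast

lemma lyn_set_mono: "v' \<ggreater> v \<Longrightarrow> lyn_set A n v' \<subseteq> lyn_set A n v"
  unfolding lyn_set_def by (auto intro: lex_trans[of _ v' v])

text \<open>A termination measure: a finite alphabet and a bound on the length leave finitely many
  words above \<open>v\<close>, and their number drops when \<open>v\<close> increases.\<close>

definition rank :: "'z set \<Rightarrow> nat \<Rightarrow> 'z list \<Rightarrow> nat" where
  "rank A n v = card {w. set w \<subseteq> A \<and> length w \<le> n \<and> w \<ggreater> v}"

lemma rank_less:
  assumes "finite A" "v' \<ggreater> v" "set v' \<subseteq> A" "length v' \<le> n"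
  shows "rank A n v' < rank A n v"
  unfolding rank_def
proof (rule psubset_card_mono)
  show "finite {w. set w \<subseteq> A \<and> length w \<le> n \<and> w \<ggreater> v}"
    using finite_lists_length_le[OF assms(1), of n] by (rule rev_finite_subset) auto
  have "{w. set w \<subseteq> A \<and> length w \<le> n \<and> w \<ggreater> v'} \<subseteq> {w. set w \<subseteq> A \<and> length w \<le> n \<and> w \<ggreater> v}"
    by (auto intro: lex_trans[of _ v' v] assms(2))
  moreover have "v' \<in> {w. set w \<subseteq> A \<and> length w \<le> n \<and> w \<ggreater> v}"
    "v' \<notin> {w. set w \<subseteq> A \<and> length w \<le> n \<and> w \<ggreater> v'}"
    using assms lex_irrefl by auto
  ultimately show "{w. set w \<subseteq> A \<and> length w \<le> n \<and> w \<ggreater> v'} \<subset> {w. set w \<subseteq> A \<and> length w \<le> n \<and> w \<ggreater> v}"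
    by blast
qed

text \<open>
  Rewriting \<open>[[u\<^sub>1 u\<^sub>2] v]\<close> to \<open>[[u\<^sub>1 v] u\<^sub>2] + [u\<^sub>1 [u\<^sub>2 v]]\<close> terminates because the second factor \<open>v\<close> of
  every product of the full length increases lexicographically.
\<close>

lemma lyn_bracket_mult:
  assumes "finite A" "A \<subseteq> Z"
  shows "lyndon gt u \<Longrightarrow> lyndon gt v \<Longrightarrow> set u \<subseteq> A \<Longrightarrow> set v \<subseteq> A \<Longrightarrow> u \<ggreater> v \<Longrightarrow>
    length u + length v = n \<Longrightarrow>
    lyn_bracket u \<otimes> lyn_bracket v \<in> lspan L (lyn_bracket ` lyn_set A n v)"
proof (induction n arbitrary: u v rule: less_induct)
  case (less n)
  \<comment> \<open>The length \<open>n\<close> is the outer induction and handles the inner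
    products; the rank of the right factor is the inner one and handles products of full
    length.\<close>
  note outer = less.IH
  from less.prems show ?case
  proof (induction "rank A n v" arbitrary: u v rule: less_induct)
    case (less v u)
    note u = less.prems(1,3) and v = less.prems(2,4) and uv = less.prems(5) and n = less.prems(6)
    let ?B = "lyn_bracket ` lyn_set A n v"
    have BC: "?B \<subseteq> carrier L" by (rule lyn_set_carrier[OF assms(2)])
    have Z: "set x \<subseteq> Z" if "set x \<subseteq> A" for x using that assms(2) by blast
    note cl = lyn_bracket_carrier[OF _ Z]
    have one: "lyn_bracket x \<otimes> lyn_bracket y \<in> lspan L ?B"
      if "lyndon gt x" "lyndon gt y" "set x \<subseteq> A" "set y \<subseteq> A" "x \<ggreater> y" "y \<ggreater> v"
        "length x + length y = n" for x y
    proof (rule lspan_mono)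
      show "lyn_bracket x \<otimes> lyn_bracket y \<in> lspan L (lyn_bracket ` lyn_set A n y)"
        by (rule less.hyps) (use that rank_less[OF assms(1) that(6,4), of n] in simp_all)
      show "lyn_bracket ` lyn_set A n y \<subseteq> ?B"
        by (rule image_mono[OF lyn_set_mono[OF that(6)]])
    qed
    \<comment> \<open>Both factors exceed \<open>v\<close>, so whichever of them ends up on the
      right after a swap has smaller rank than \<open>v\<close>.\<close>
    have both: "lyn_bracket x \<otimes> lyn_bracket y \<in> lspan L ?B"
      if x: "lyndon gt x" "set x \<subseteq> A" "x \<ggreater> v" and y: "lyndon gt y" "set y \<subseteq> A" "y \<ggreater> v"
        and len: "length x + length y = n" for x y
    proof -
      consider "x = y" | "x \<ggreater> y" | "y \<ggreater> x" using lex_total[OF Z Z] x(2) y(2) by blast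
      then show ?thesis
      proof cases
        case 1
        then show ?thesis using bracket_alternating[OF cl[OF x(1,2)]] by (simp add: lspan_zero)
      next
        case 2
        then show ?thesis using one x y len by simp
      next
        case 3
        then have "lyn_bracket y \<otimes> lyn_bracket x \<in> lspan L ?B" using one x y len by simp
        then show ?thesis
          using bracket_swap[OF cl[OF y(1,2)] cl[OF x(1,2)]] lspan_uminus[OF BC] by simp
      qed
    qed
    from std_bracket_append[OF u(1) v(1) Z[OF u(2)] Z[OF v(2)] uv] show ?case
    proof (elim disjE exE conjE)
      assume s: "std_bracket gt (u @ v) = Br (std_bracket gt u) (std_bracket gt v)"
      have "u @ v \<in> lyn_set A n v"
        unfolding lyn_set_def
        using lyndon_append[OF u(1) v(1) uv] lyndon_suffix[of gt u v] u v n
          lyndon_not_Nil[OF u(1)] lyndon_not_Nil[OF v(1)] by simp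
      moreover have "lyn_bracket u \<otimes> lyn_bracket v = lyn_bracket (u @ v)"
        by (simp add: lyn_bracket_def s)
      ultimately show ?thesis by (simp add: lspan_base BC)
    next
      fix u1 u2
      assume e: "u = u1 @ u2" and l: "lyndon gt u1" "lyndon gt u2" and gt: "u1 \<ggreater> u2" "u2 \<ggreater> v"
        and s: "std_bracket gt u = Br (std_bracket gt u1) (std_bracket gt u2)"
      have A: "set u1 \<subseteq> A" "set u2 \<subseteq> A" using u(2) e by auto
      have g1: "u1 \<ggreater> v" using lex_trans[OF gt] .
      have len: "length u1 > 0" "length u2 > 0" "length u1 + length u2 + length v = n"
        using l lyndon_not_Nil n e by auto
      have ln: "length u1 + length v < n" "length u2 + length v < n" using len by linarith+
      note c1 = cl[OF l(1) A(1)] and c2 = cl[OF l(2) A(2)] and cv = cl[OF v]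
      have "lyn_bracket u = lyn_bracket u1 \<otimes> lyn_bracket u2" by (simp add: lyn_bracket_def s)
      then have eq: "lyn_bracket u \<otimes> lyn_bracket v
        = (lyn_bracket u1 \<otimes> lyn_bracket v) \<otimes> lyn_bracket u2
          \<oplus> lyn_bracket u1 \<otimes> (lyn_bracket u2 \<otimes> lyn_bracket v)"
        using bracket_jacobi_left[OF c1 c2 cv] by simp
      \<comment> \<open>The inner product is shorter and expands into words above \<open>v\<close>;
        as \<open>u2\<close> is above \<open>v\<close> too, each of them may be multiplied by
        \<open>u2\<close>.\<close>
      have "(lyn_bracket u1 \<otimes> lyn_bracket v) \<otimes> lyn_bracket u2 \<in> lspan L ?B"
      proof (rule lspan_bracket_left[OF lyn_set_carrier[OF assms(2)] BC c2])
        show "lyn_bracket u1 \<otimes> lyn_bracket v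
          \<in> lspan L (lyn_bracket ` lyn_set A (length u1 + length v) v)"
          by (rule outer) (use l A v g1 ln in simp_all)
        fix b assume "b \<in> lyn_bracket ` lyn_set A (length u1 + length v) v"
        then obtain w where w: "b = lyn_bracket w" "w \<in> lyn_set A (length u1 + length v) v" by blast
        show "b \<otimes> lyn_bracket u2 \<in> lspan L ?B"
          unfolding w(1) by (rule both) (use w(2) l A gt len in \<open>simp_all add: lyn_set_def\<close>)
      qed
      moreover have "lyn_bracket u1 \<otimes> (lyn_bracket u2 \<otimes> lyn_bracket v) \<in> lspan L ?B"
      proof (rule lspan_bracket_right[OF lyn_set_carrier[OF assms(2)] BC c1])
        show "lyn_bracket u2 \<otimes> lyn_bracket v
          \<in> lspan L (lyn_bracket ` lyn_set A (length u2 + length v) v)"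
          by (rule outer) (use l A v gt ln in simp_all)
        fix b assume "b \<in> lyn_bracket ` lyn_set A (length u2 + length v) v"
        then obtain w where w: "b = lyn_bracket w" "w \<in> lyn_set A (length u2 + length v) v" by blast
        show "lyn_bracket u1 \<otimes> b \<in> lspan L ?B"
          unfolding w(1) by (rule both) (use w(2) l A g1 len in \<open>simp_all add: lyn_set_def\<close>)
      qed
      ultimately show ?thesis unfolding eq by (rule lspan_add[OF BC])
    qed
  qed
qed

end

section \<open>Lyndon-Shirshov \<open>\<Omega>\<close>-words\<close>

primrec prm_lyn :: "'x::wellorder set \<Rightarrow> 'x prm \<Rightarrow> bool" where
  "prm_lyn X (Gen x) \<longleftrightarrow> x \<in> X"
| "prm_lyn X (Op u) \<longleftrightarrow> lyndon prm_gt u \<and> (\<forall>b \<in> set (map (prm_lyn X) u). b)"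

lemma prm_lyn_Op [simp]: "prm_lyn X (Op u) \<longleftrightarrow> lyndon prm_gt u \<and> (\<forall>p\<in>set u. prm_lyn X p)"
  by simp

declare prm_lyn.simps(2) [simp del]

lemma prm_lyn_over: "prm_lyn X p \<Longrightarrow> prm_over X p"
  by (induction p) (auto simp: word_over_def lyndon_not_Nil)

text \<open>The alphabet of all primes free of junk is independent of \<open>X\<close>, so one
  instance serves every set of generators.\<close>

interpretation PO: letter_order "\<lambda>p q. prm_less q p" "{p. prm_over UNIV p}"
proof
  show "prm_less z x" if "prm_less y x" "prm_less z y" for x y z :: "'a prm"
    using prm_less_trans[OF that(2,1)] .
  show "x = y \<or> prm_less y x \<or> prm_less x y" if "x \<in> {p. prm_over UNIV p}" "y \<in> {p. prm_over UNIV p}"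
    for x y :: "'a prm"
    using prm_less_total[of UNIV x y] that by auto
qed simp

lemma prm_lyn_over_UNIV: "prm_lyn X p \<Longrightarrow> prm_over UNIV p"
  by (erule prm_over_mono[OF prm_lyn_over]) simp

lemma alsw_prm_iff:
  assumes "Y \<subseteq> {p. prm_over UNIV p}"
  shows "w \<in> alsw prm_gt Y \<longleftrightarrow> set w \<subseteq> Y \<and> lyndon prm_gt w"
proof -
  have "w \<in> alsw prm_gt Y \<longleftrightarrow> w \<in> alsw prm_gt {p. prm_over UNIV p} \<and> set w \<subseteq> Y"
    using assms unfolding alsw_def nonempty_words_def by blast
  then show ?thesis using assms unfolding PO.alsw_iff by blast
qed

lemma ALSW_n_lyn: "w \<in> ALSW_n X n \<Longrightarrow> lyndon prm_gt w \<and> (\<forall>p\<in>set w. prm_lyn X p)"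
proof (induction n arbitrary: w)
  case 0
  have "w \<in> alsw prm_gt (Gen ` X)" using 0 by simp
  then have "set w \<subseteq> Gen ` X \<and> lyndon prm_gt w" by (subst (asm) alsw_prm_iff) auto
  then show ?case by auto
next
  case (Suc n)
  have l: "prm_lyn X p" if "p \<in> Gen ` X \<union> Op ` ALSW_n X n" for p
    using that Suc.IH by auto
  then have sub: "Gen ` X \<union> Op ` ALSW_n X n \<subseteq> {p. prm_over UNIV p}"
    using prm_lyn_over_UNIV by blast
  have "w \<in> alsw prm_gt (Gen ` X \<union> Op ` ALSW_n X n)" using Suc.prems by simp
  then have "set w \<subseteq> Gen ` X \<union> Op ` ALSW_n X n \<and> lyndon prm_gt w"
    unfolding alsw_prm_iff[OF sub] .
  then show ?case using l by blast
qed

lemma alsw_mono: "Y \<subseteq> Y' \<Longrightarrow> alsw gt Y \<subseteq> alsw gt Y'"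
  unfolding alsw_def nonempty_words_def by blast

lemma ALSW_n_mono: "m \<le> n \<Longrightarrow> ALSW_n X m \<subseteq> ALSW_n X n"
proof (rule lift_Suc_mono_le[of "ALSW_n X"])
  fix n show "ALSW_n X n \<subseteq> ALSW_n X (Suc n)"
  proof (induction n)
    case 0
    show ?case unfolding ALSW_n.simps by (rule alsw_mono) blast
  next
    case (Suc n)
    have "Gen ` X \<union> Op ` ALSW_n X n \<subseteq> Gen ` X \<union> Op ` ALSW_n X (Suc n)" using Suc.IH by blast
    then show ?case unfolding ALSW_n.simps(2)[of X n] ALSW_n.simps(2)[of X "Suc n"] by (rule alsw_mono)
  qed
qed

lemma ALSW_iff: "w \<in> ALSW X \<longleftrightarrow> lyndon prm_gt w \<and> (\<forall>p\<in>set w. prm_lyn X p)"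
proof
  assume "w \<in> ALSW X"
  then show "lyndon prm_gt w \<and> (\<forall>p\<in>set w. prm_lyn X p)"
    unfolding ALSW_def using ALSW_n_lyn by blast
next
  let ?F = "\<lambda>n. Gen ` X \<union> Op ` ALSW_n X n"
  have mono: "?F m \<subseteq> ?F n" if "m \<le> n" for m n
    using ALSW_n_mono[OF that, of X] by auto
  have over: "?F n \<subseteq> {p. prm_over UNIV p}" for n
  proof -
    have "prm_lyn X p" if "p \<in> ?F n" for p using that ALSW_n_lyn[of _ X n] by auto
    then show ?thesis by (blast intro: prm_lyn_over_UNIV)
  qed
  have word: "\<exists>n. u \<in> ALSW_n X n"
    if ne: "\<forall>p\<in>set u. \<exists>n. p \<in> ?F n" "lyndon prm_gt u" for u
  proof -
    obtain n where "set u \<subseteq> ?F n"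
      using finite_bounded_level[of "set u" ?F, OF finite_set ne(1) mono] by blast
    then have "u \<in> ALSW_n X (Suc n)"
      unfolding ALSW_n.simps(2) alsw_prm_iff[OF over] using ne(2) by blast
    then show ?thesis by blast
  qed
  have prm: "\<exists>n. p \<in> ?F n" if "prm_lyn X p" for p
    using that
  proof (induction p)
    case (Op u)
    then have "\<exists>n. u \<in> ALSW_n X n" by (intro word) auto
    then show ?case by auto
  qed auto
  assume "lyndon prm_gt w \<and> (\<forall>p\<in>set w. prm_lyn X p)"
  then have "\<exists>n. w \<in> ALSW_n X n" using word prm by blast
  then show "w \<in> ALSW X" by (simp add: ALSW_def)
qed

lemma ALSW_lyndon: "w \<in> ALSW X \<Longrightarrow> lyndon prm_gt w"
  by (simp add: ALSW_iff)

lemma ALSW_over: "w \<in> ALSW X \<Longrightarrow> word_over X w"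
  by (auto simp: ALSW_iff word_over_def prm_lyn_over)

lemma ALSW_set: "w \<in> ALSW X \<Longrightarrow> set w \<subseteq> {p. prm_over UNIV p}"
  by (auto simp: ALSW_iff prm_lyn_over_UNIV)

lemma ALSW_not_Nil: "w \<in> ALSW X \<Longrightarrow> w \<noteq> []"
  by (auto simp: ALSW_iff)

lemma ALSW_omega_UNIV: "w \<in> ALSW X \<Longrightarrow> w \<in> omega_words UNIV"
  using ALSW_over[of w X] word_over_mono[of X w UNIV] by (simp add: omega_words_iff ALSW_not_Nil)

lemma ALSW_Op: "w \<in> ALSW X \<Longrightarrow> [Op w] \<in> ALSW X"
  by (simp add: ALSW_iff)

lemma ALSW_letters: "lyndon prm_gt w \<Longrightarrow> set w \<subseteq> set v \<Longrightarrow> v \<in> ALSW X \<Longrightarrow> w \<in> ALSW X"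
  by (auto simp: ALSW_iff)

subsection \<open>Bracketings\<close>

lemma lex_gt_map:
  assumes "inj_on f Y" "\<And>p q. p \<in> Y \<Longrightarrow> q \<in> Y \<Longrightarrow> gt' (f p) (f q) \<longleftrightarrow> gt p q"
  shows "set u \<subseteq> Y \<Longrightarrow> set v \<subseteq> Y \<Longrightarrow> lex_gt gt' (map f u) (map f v) \<longleftrightarrow> lex_gt gt u v"
proof (induction u arbitrary: v)
  case Nil
  then show ?case by (cases v) simp_all
next
  case (Cons z u)
  then show ?case using assms by (cases v) (auto simp: inj_on_eq_iff)
qed

lemma lyndon_map:
  assumes "inj_on f Y" "\<And>p q. p \<in> Y \<Longrightarrow> q \<in> Y \<Longrightarrow> gt' (f p) (f q) \<longleftrightarrow> gt p q"
    and "set w \<subseteq> Y" "lyndon gt w"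
  shows "lyndon gt' (map f w)"
  unfolding lyndon_def
proof (intro conjI allI impI)
  fix u v assume "map f w = u @ v \<and> u \<noteq> [] \<and> v \<noteq> []"
  then obtain u' v' where w: "w = u' @ v'" "v = map f v'" "u' \<noteq> []" "v' \<noteq> []"
    by (auto simp: map_eq_append_conv)
  then have "lex_gt gt w v'" using lyndon_suffix[of gt u' v'] assms(4) by simp
  then show "lex_gt gt' (map f w) v"
    unfolding w(2) by (subst lex_gt_map[where f = f and Y = Y and gt = gt and gt' = gt', OF assms(1,2)]) (use assms(3) w in auto)
qed (use lyndon_not_Nil[OF assms(4)] in simp)

lemma is_nlsw_map:
  assumes L: "letter_order gt Y" and L': "letter_order gt' (f ` Y)"
    and f: "inj_on f Y" "\<And>p q. p \<in> Y \<Longrightarrow> q \<in> Y \<Longrightarrow> gt' (f p) (f q) \<longleftrightarrow> gt p q"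
  shows "is_nlsw gt Y t \<Longrightarrow> is_nlsw gt' (f ` Y) (map_bword f t)"
proof (induction t)
  case (Letter z)
  then show ?case unfolding letter_order.alsw_iff[OF L] letter_order.alsw_iff[OF L'] is_nlsw.simps
    by (simp add: letter_order.alsw_iff[OF L'])
next
  case (Br s t)
  have Br': "set (underlying s) \<subseteq> Y" "set (underlying t) \<subseteq> Y" "lyndon gt (underlying s @ underlying t)"
    "is_nlsw gt Y s" "is_nlsw gt Y t"
    "\<And>s1 s2. s = Br s1 s2 \<Longrightarrow> lex_le gt (underlying s2) (underlying t)"
    using Br.prems unfolding letter_order.is_nlsw_iff[OF L] by auto
  have "lyndon gt' (map f (underlying s @ underlying t))"
    by (rule lyndon_map[where f = f and Y = Y and gt = gt and gt' = gt', OF f]) (use Br' in auto)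
  moreover have "lex_le gt' (underlying s2) (underlying (map_bword f t))" if "map_bword f s = Br s1 s2" for s1 s2
  proof -
    obtain t1 t2 where t: "s = Br t1 t2" "s2 = map_bword f t2" using \<open>map_bword f s = Br s1 s2\<close> by (cases s) auto
    have "lex_le gt (underlying t2) (underlying t)" using Br'(6)[OF t(1)] .
    then show ?thesis unfolding lex_le_def t(2) underlying_map
      using lex_gt_map[where gt' = gt' and gt = gt and f = f and Y = Y, OF f, of "underlying t" "underlying t2"] Br'(1,2) t(1) by auto
  qed
  ultimately show ?case
    unfolding letter_order.is_nlsw_iff[OF L'] bword.map using Br' Br.IH
    by (auto simp: underlying_map)
qed

text \<open>The relabelled tree satisfies the defining conditions of the bracketing of the
  relabelled word, and such a tree is unique.\<close>

lemma std_bracket_map: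
  assumes L: "letter_order gt (set w)" and L': "letter_order gt' (f ` set w)"
    and f: "inj_on f (set w)" "\<And>p q. p \<in> set w \<Longrightarrow> q \<in> set w \<Longrightarrow> gt' (f p) (f q) \<longleftrightarrow> gt p q"
    and w: "lyndon gt w"
  shows "std_bracket gt' (map f w) = map_bword f (std_bracket gt w)"
proof -
  have "is_nlsw gt' (f ` set w) (map_bword f (std_bracket gt w))"
    by (rule is_nlsw_map[OF L L' f(1) _ letter_order.std_bracket_spec(1)[OF L w subset_refl]])
      (rule f(2))
  from letter_order.std_bracket_eq[OF L' this] show ?thesis
    using letter_order.std_bracket_spec[OF L w subset_refl] by (simp add: underlying_map)
qed

lemma letter_order_subset: "letter_order gt Z \<Longrightarrow> Y \<subseteq> Z \<Longrightarrow> letter_order gt Y"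
  unfolding letter_order_def by blast

text \<open>Bracketing the plain primes first and their arguments afterwards gives the same tree,
  which replaces \<open>bprm_gt\<close> by \<open>prm_gt\<close>. Assumption \<open>e\<close> makes
  \<open>bracket_prm\<close> injective on the letters; it is the induction hypothesis available in
  \<open>erase_bracket_prm\<close>.\<close>

lemma bracket_map:
  assumes "w \<in> ALSW X" and e: "\<And>p. p \<in> set w \<Longrightarrow> erase_prm (bracket_prm p) = p"
  shows "bracket w = map_bword bracket_prm (std_bracket prm_gt w)"
  unfolding bracket_def
proof (rule std_bracket_map)
  show "letter_order prm_gt (set w)"
    by (rule letter_order_subset[OF PO.letter_order_axioms ALSW_set[OF assms(1)]])
  show gt: "bprm_gt (bracket_prm p) (bracket_prm q) \<longleftrightarrow> prm_gt p q" if "p \<in> set w" "q \<in> set w" for p q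
    using e[OF that(1)] e[OF that(2)] by (simp add: bprm_gt_def)
  show "letter_order bprm_gt (bracket_prm ` set w)"
  proof
    show "\<not> bprm_gt z z" for z by (simp add: bprm_gt_def)
    show "bprm_gt x z" if "bprm_gt x y" "bprm_gt y z" for x y z
      using that unfolding bprm_gt_def by (rule PO.trans)
    show "x = y \<or> bprm_gt x y \<or> bprm_gt y x"
      if "x \<in> bracket_prm ` set w" "y \<in> bracket_prm ` set w" for x y
    proof -
      obtain p q where pq: "x = bracket_prm p" "y = bracket_prm q" "p \<in> set w" "q \<in> set w"
        using \<open>x \<in> bracket_prm ` set w\<close> \<open>y \<in> bracket_prm ` set w\<close> by blast
      have "p = q \<or> prm_gt p q \<or> prm_gt q p"
        using PO.total[of p q] ALSW_set[OF assms(1)] pq(3,4) by blast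
      then show ?thesis unfolding pq using gt pq(3,4) by blast
    qed
  qed
  show "inj_on bracket_prm (set w)" by (rule inj_on_inverseI[of _ erase_prm]) (rule e)
  show "lyndon prm_gt w" using ALSW_lyndon[OF assms(1)] .
qed

lemma erase_bracket_prm: "prm_lyn X p \<Longrightarrow> erase_prm (bracket_prm p) = p"
proof (induction p)
  case (Op u)
  then have u: "u \<in> ALSW X" by (simp add: ALSW_iff)
  have e: "erase_prm (bracket_prm p) = p" if "p \<in> set u" for p
    using Op that by auto
  have "bracket_prm (Op u) = BOp (map_bword bracket_prm (std_bracket prm_gt u))"
    using bracket_map[OF u e] by (simp add: bracket_def)
  then have "erase_prm (bracket_prm (Op u)) = Op (map (\<lambda>p. erase_prm (bracket_prm p)) u)"
    using PO.std_bracket_spec[OF ALSW_lyndon[OF u] ALSW_set[OF u]]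
    by (simp add: underlying_map)
  then show ?case using e by (simp add: map_idI)
qed simp

lemma bracket_ALSW: "w \<in> ALSW X \<Longrightarrow> bracket w = map_bword bracket_prm (std_bracket prm_gt w)"
  by (rule bracket_map) (auto simp: ALSW_iff intro: erase_bracket_prm)

lemma erase_bracket: "w \<in> ALSW X \<Longrightarrow> erase (bracket w) = w"
proof -
  assume w: "w \<in> ALSW X"
  have "erase (bracket w) = map (\<lambda>p. erase_prm (bracket_prm p)) w"
    unfolding bracket_ALSW[OF w] erase_def
    using PO.std_bracket_spec[OF ALSW_lyndon[OF w] ALSW_set[OF w]] by (simp add: underlying_map)
  also have "\<dots> = w" using w by (intro map_idI) (auto simp: ALSW_iff intro: erase_bracket_prm)
  finally show ?thesis .
qed

lemma nword_ev_bracket: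
  "w \<in> ALSW X \<Longrightarrow> nword_ev L \<phi> (bracket w) = teval (monoid.mult L)
     (map_bword (\<lambda>p. ev_prm (monoid.mult L) (opr L) \<phi> (bracket_prm p)) (std_bracket prm_gt w))"
  unfolding nword_ev_def by (simp add: bracket_ALSW bword.map_comp comp_def)

lemma ev_prm_Op: "ev_prm (monoid.mult L) (opr L) \<phi> (bracket_prm (Op u)) = opr L (nword_ev L \<phi> (bracket u))"
  by (simp add: nword_ev_def bracket_def)

lemma bracket_Op: "[Op w] \<in> ALSW X \<Longrightarrow> bracket [Op w] = Letter (BOp (bracket w))"
  using bracket_ALSW[of "[Op w]" X] PO.std_bracket_single[of "Op w"] ALSW_set[of "[Op w]" X]
  by (simp add: bracket_def)

lemma bracket_Gen: "bracket [Gen x] = Letter (BGen x)"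
  using bracket_ALSW[of "[Gen x]" UNIV] PO.std_bracket_single[of "Gen x"]
  by (simp add: ALSW_iff)

subsection \<open>The span of the bracketings is a subalgebra\<close>

definition lyn_span :: "('k::field, 'a, 'm) lie_op_scheme \<Rightarrow> 'x::wellorder set \<Rightarrow> ('x \<Rightarrow> 'a) \<Rightarrow> 'a set" where
  "lyn_span L X \<phi> = lspan L ((\<lambda>w. nword_ev L \<phi> (bracket w)) ` ALSW X)"

context lie_op_algebra
begin

lemma ev_prm_carrier:
  assumes \<phi>: "\<phi> \<in> X \<rightarrow> carrier L"
  shows "prm_lyn X p \<Longrightarrow> ev_prm (\<otimes>) (opr L) \<phi> (bracket_prm p) \<in> carrier L"
proof (induction p)
  case (Gen x)
  then show ?case using \<phi> by auto
next
  case (Op u)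
  have u: "u \<in> ALSW X" using Op.prems by (simp add: ALSW_iff)
  have "nword_ev L \<phi> (bracket u) \<in> carrier L"
    unfolding nword_ev_bracket[OF u]
    by (rule teval_carrier)
      (use PO.std_bracket_spec[OF ALSW_lyndon[OF u] ALSW_set[OF u]] Op in
        \<open>auto simp: set_bword_underlying underlying_map\<close>)
  then show ?case unfolding ev_prm_Op by (rule opr_closed)
qed

lemma lyndon_lie_prm:
  assumes "\<phi> \<in> X \<rightarrow> carrier L"
  shows "lyndon_lie L prm_gt {p. prm_lyn X p} (\<lambda>p. ev_prm (\<otimes>) (opr L) \<phi> (bracket_prm p))"
proof -
  interpret P: letter_order prm_gt "{p. prm_lyn X p}"
    by (rule letter_order_subset[OF PO.letter_order_axioms]) (auto intro: prm_lyn_over_UNIV)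
  show ?thesis by unfold_locales (use ev_prm_carrier[OF assms] in auto)
qed

context
  fixes X :: "'x::wellorder set" and \<phi> :: "'x \<Rightarrow> 'a"
  assumes \<phi>: "\<phi> \<in> X \<rightarrow> carrier L"
begin

interpretation LL: lyndon_lie L prm_gt "{p. prm_lyn X p}" "\<lambda>p. ev_prm (\<otimes>) (opr L) \<phi> (bracket_prm p)"
  by (rule lyndon_lie_prm[OF \<phi>])

lemma nword_ev_eq: "w \<in> ALSW X \<Longrightarrow> nword_ev L \<phi> (bracket w) = LL.lyn_bracket w"
  unfolding LL.lyn_bracket_def by (rule nword_ev_bracket)

lemma nword_ev_carrier: "w \<in> ALSW X \<Longrightarrow> nword_ev L \<phi> (bracket w) \<in> carrier L"
  unfolding nword_ev_eq by (rule LL.lyn_bracket_carrier) (auto simp: ALSW_iff)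

lemma lyn_span_carrier: "x \<in> lyn_span L X \<phi> \<Longrightarrow> x \<in> carrier L"
  unfolding lyn_span_def by (rule lspan_carrier[rotated]) (auto intro: nword_ev_carrier)

lemma lyn_span_base: "w \<in> ALSW X \<Longrightarrow> nword_ev L \<phi> (bracket w) \<in> lyn_span L X \<phi>"
  unfolding lyn_span_def by (rule lspan_base) (auto intro: nword_ev_carrier)

lemma gens_carrier: "(\<lambda>w. nword_ev L \<phi> (bracket w)) ` ALSW X \<subseteq> carrier L"
  by (auto intro: nword_ev_carrier)

lemma lyn_span_add: "x \<in> lyn_span L X \<phi> \<Longrightarrow> y \<in> lyn_span L X \<phi> \<Longrightarrow> x \<oplus> y \<in> lyn_span L X \<phi>"
  unfolding lyn_span_def by (rule lspan_add[OF gens_carrier])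

lemma lyn_span_smult: "x \<in> lyn_span L X \<phi> \<Longrightarrow> c \<odot> x \<in> lyn_span L X \<phi>"
  unfolding lyn_span_def by (rule lspan_smult[OF gens_carrier])

lemma lyn_span_gen: "x \<in> X \<Longrightarrow> \<phi> x \<in> lyn_span L X \<phi>"
  using lyn_span_base[of "[Gen x]"] by (simp add: ALSW_iff bracket_Gen nword_ev_def)

text \<open>P applied to \<open>[w]\<close> is the bracketing of the one-letter word
  \<open>P(w)\<close>, and a single letter is always Lyndon.\<close>

lemma lyn_span_opr: "x \<in> lyn_span L X \<phi> \<Longrightarrow> opr L x \<in> lyn_span L X \<phi>"
  unfolding lyn_span_def
proof (induction rule: lspan.induct)
  case lspan_zero
  have "opr L \<zero> = opr L (0 \<odot> \<zero>)" using smult_0[of \<zero>] by simp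
  also have "\<dots> = \<zero>" using opr_smult[of \<zero> 0] smult_0[of "opr L \<zero>"] opr_closed[of \<zero>] by simp
  finally show ?case by (simp add: lspan.lspan_zero)
next
  case (lspan_step b x c)
  then obtain w where w: "w \<in> ALSW X" "b = nword_ev L \<phi> (bracket w)" by blast
  have c: "b \<in> carrier L" "x \<in> carrier L"
    using w nword_ev_carrier lspan_carrier[OF gens_carrier lspan_step.hyps(2)] by auto
  have "opr L b = nword_ev L \<phi> (bracket [Op w])"
    using w(2) by (simp add: bracket_Op[OF ALSW_Op[OF w(1)]] nword_ev_def)
  then have "opr L b \<in> (\<lambda>w. nword_ev L \<phi> (bracket w)) ` ALSW X" using ALSW_Op[OF w(1)] by simp
  moreover have "opr L (c \<odot> b \<oplus> x) = c \<odot> opr L b \<oplus> opr L x"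
    using c by (simp add: opr_add opr_smult)
  ultimately show ?case using lspan.lspan_step[OF _ lspan_step.IH] by simp
qed

lemma lyn_bracket_mult_span:
  assumes "u \<in> ALSW X" "v \<in> ALSW X" "lex_gt prm_gt u v"
  shows "nword_ev L \<phi> (bracket u) \<otimes> nword_ev L \<phi> (bracket v) \<in> lyn_span L X \<phi>"
proof -
  \<comment> \<open>Rewriting introduces no letters besides those of \<open>u\<close> and
    \<open>v\<close>, so these form a finite alphabet, as the rank requires.\<close>
  let ?A = "set u \<union> set v"
  have A: "?A \<subseteq> {p. prm_lyn X p}" using assms(1,2) by (auto simp: ALSW_iff)
  have "LL.lyn_bracket u \<otimes> LL.lyn_bracket v
      \<in> lspan L (LL.lyn_bracket ` LL.lyn_set ?A (length u + length v) v)"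
    by (rule LL.lyn_bracket_mult[OF _ A]) (use assms in \<open>simp_all add: ALSW_iff\<close>)
  moreover have "LL.lyn_bracket ` LL.lyn_set ?A (length u + length v) v
      \<subseteq> (\<lambda>w. nword_ev L \<phi> (bracket w)) ` ALSW X"
  proof
    fix x assume "x \<in> LL.lyn_bracket ` LL.lyn_set ?A (length u + length v) v"
    then obtain w where w: "x = LL.lyn_bracket w" "lyndon prm_gt w" "set w \<subseteq> ?A"
      by (auto simp: LL.lyn_set_def)
    then have "w \<in> ALSW X" using A by (auto simp: ALSW_iff)
    then show "x \<in> (\<lambda>w. nword_ev L \<phi> (bracket w)) ` ALSW X"
      unfolding w(1) using nword_ev_eq by (intro image_eqI[of _ _ w]) auto
  qed
  ultimately show ?thesis
    unfolding lyn_span_def nword_ev_eq[OF assms(1)] nword_ev_eq[OF assms(2)] by (rule lspan_mono)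
qed

lemma lyn_bracket_mult_span':
  assumes u: "u \<in> ALSW X" and v: "v \<in> ALSW X"
  shows "nword_ev L \<phi> (bracket u) \<otimes> nword_ev L \<phi> (bracket v) \<in> lyn_span L X \<phi>"
proof -
  consider "u = v" | "lex_gt prm_gt u v" | "lex_gt prm_gt v u"
    using PO.lex_total[OF ALSW_set[OF u] ALSW_set[OF v]] by blast
  then show ?thesis
  proof cases
    case 1
    then show ?thesis using bracket_alternating[OF nword_ev_carrier[OF u]]
      by (simp add: lyn_span_def lspan_zero)
  next
    case 2
    then show ?thesis by (rule lyn_bracket_mult_span[OF u v])
  next
    case 3
    then have "nword_ev L \<phi> (bracket v) \<otimes> nword_ev L \<phi> (bracket u) \<in> lyn_span L X \<phi>"
      by (rule lyn_bracket_mult_span[OF v u])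
    then show ?thesis
      using bracket_swap[OF nword_ev_carrier[OF v] nword_ev_carrier[OF u]]
        lspan_uminus[OF gens_carrier] by (simp add: lyn_span_def)
  qed
qed

lemma lyn_span_bracket:
  assumes x: "x \<in> lyn_span L X \<phi>" and y: "y \<in> lyn_span L X \<phi>"
  shows "x \<otimes> y \<in> lyn_span L X \<phi>"
  unfolding lyn_span_def
proof (rule lspan_bracket_left[OF gens_carrier gens_carrier lyn_span_carrier[OF y] _ x[unfolded lyn_span_def]])
  fix b assume "b \<in> (\<lambda>w. nword_ev L \<phi> (bracket w)) ` ALSW X"
  then obtain u where u: "u \<in> ALSW X" "b = nword_ev L \<phi> (bracket u)" by blast
  show "b \<otimes> y \<in> lspan L ((\<lambda>w. nword_ev L \<phi> (bracket w)) ` ALSW X)"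
    unfolding u(2)
    by (rule lspan_bracket_right[OF gens_carrier gens_carrier nword_ev_carrier[OF u(1)] _ y[unfolded lyn_span_def]])
      (use lyn_bracket_mult_span'[OF u(1)] in \<open>auto simp: lyn_span_def\<close>)
qed

end

end

section \<open>Leading words of bracketed words\<close>

definition tree_word :: "('p \<Rightarrow> 'x word) \<Rightarrow> 'p bword \<Rightarrow> 'x word" where
  "tree_word W t = concat (map W (underlying t))"

lemma tree_word_simps [simp]:
  "tree_word W (Letter p) = W p" "tree_word W (Br s t) = tree_word W s @ tree_word W t"
  by (simp_all add: tree_word_def)

text \<open>At every node the two factors are in the order that makes \<open>st\<close> the leading word of \<open>[s, t]\<close>.\<close>

primrec nodes :: "('p \<Rightarrow> 'x::wellorder word) \<Rightarrow> 'p bword \<Rightarrow> bool" where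
  "nodes W (Letter p) \<longleftrightarrow> True"
| "nodes W (Br s t) \<longleftrightarrow> nodes W s \<and> nodes W t \<and>
     Dl_less (tree_word W t @ tree_word W s) (tree_word W s @ tree_word W t)"

abbreviation prm_word :: "('y \<Rightarrow> 'x word) \<Rightarrow> 'y bprm \<Rightarrow> 'x word" where
  "prm_word \<tau> p \<equiv> subst_prm \<tau> (erase_prm p)"

text \<open>\<open>\<tau>\<close> assigns to a generator the leading word of the polynomial that
  will be substituted for it; the node condition is imposed inside every argument of P as
  well.\<close>

primrec good_prm :: "('y \<Rightarrow> 'x::wellorder word) \<Rightarrow> 'y bprm \<Rightarrow> bool" where
  "good_prm \<tau> (BGen y) \<longleftrightarrow> True"
| "good_prm \<tau> (BOp t) \<longleftrightarrow> nodes (prm_word \<tau>) t \<and> (\<forall>b \<in> set_bword (map_bword (good_prm \<tau>) t). b)"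

definition good :: "('y \<Rightarrow> 'x::wellorder word) \<Rightarrow> 'y nword \<Rightarrow> bool" where
  "good \<tau> t \<longleftrightarrow> nodes (prm_word \<tau>) t \<and> (\<forall>p\<in>set_bword t. good_prm \<tau> p)"

lemma good_prm_BOp [simp]: "good_prm \<tau> (BOp t) \<longleftrightarrow> good \<tau> t"
  by (simp add: good_def bword.set_map)

declare good_prm.simps(2) [simp del]

lemma erase_simps [simp]: "erase (Letter p) = [erase_prm p]" "erase (Br s t) = erase s @ erase t"
  by (simp_all add: erase_def)

lemma erase_prm_BOp [simp]: "erase_prm (BOp t) = Op (erase t)"
  by (simp add: erase_def)

declare erase_prm.simps(2) [simp del]

lemma subst_word_simps [simp]:
  "subst_word \<tau> [] = []" "subst_word \<tau> (p # u) = subst_prm \<tau> p @ subst_word \<tau> u"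
  "subst_word \<tau> (u @ v) = subst_word \<tau> u @ subst_word \<tau> v"
  by (simp_all add: subst_word_def)

lemma subst_prm_Op [simp]: "subst_prm \<tau> (Op u) = [Op (subst_word \<tau> u)]"
  by (simp add: subst_word_def)

declare subst_prm.simps(2) [simp del]

lemma tree_word_prm_word: "tree_word (prm_word \<tau>) t = subst_word \<tau> (erase t)"
  by (induction t) simp_all

lemma good_simps [simp]:
  "good \<tau> (Letter p) \<longleftrightarrow> good_prm \<tau> p"
  "good \<tau> (Br s t) \<longleftrightarrow> good \<tau> s \<and> good \<tau> t \<and>
     Dl_less (subst_word \<tau> (erase t) @ subst_word \<tau> (erase s)) (subst_word \<tau> (erase s) @ subst_word \<tau> (erase t))"
  by (auto simp: good_def tree_word_prm_word)

lemma nword_eval_simps [simp]: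
  "nword_eval \<sigma> (Letter p) = eval_prm \<sigma> p" "nword_eval \<sigma> (Br s t) = pcomm (nword_eval \<sigma> s) (nword_eval \<sigma> t)"
  by (simp_all add: nword_eval_def)

lemma eval_prm_BOp [simp]: "eval_prm \<sigma> (BOp t) = pop (nword_eval \<sigma> t)"
  by (simp add: nword_eval_def)

declare eval_prm.simps(2) [simp del]

lemma has_lead_tree:
  assumes "\<And>p. p \<in> set_bword t \<Longrightarrow> has_lead (eval_prm \<sigma> p) (prm_word \<tau> p)" "nodes (prm_word \<tau>) t"
  shows "has_lead (nword_eval \<sigma> t) (subst_word \<tau> (erase t))"
  using assms
proof (induction t)
  case (Br s t)
  then have "has_lead (nword_eval \<sigma> s) (subst_word \<tau> (erase s))"
    "has_lead (nword_eval \<sigma> t) (subst_word \<tau> (erase t))" by auto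
  then show ?case using Br.prems(2) by (simp add: has_lead_pcomm tree_word_prm_word)
qed simp

lemma has_lead_prm:
  assumes "\<And>y. has_lead (\<sigma> y) (\<tau> y)"
  shows "good_prm \<tau> p \<Longrightarrow> has_lead (eval_prm \<sigma> p) (prm_word \<tau> p)"
proof (induction p)
  case (BGen y)
  then show ?case using assms by simp
next
  case (BOp t)
  then have "has_lead (nword_eval \<sigma> t) (subst_word \<tau> (erase t))"
    by (intro has_lead_tree) (auto simp: good_def)
  then show ?case by (simp add: has_lead_pop)
qed

theorem has_lead_nword_eval:
  assumes "\<And>y. has_lead (\<sigma> y) (\<tau> y)" "good \<tau> t"
  shows "has_lead (nword_eval \<sigma> t) (subst_word \<tau> (erase t))"
  using assms(2) by (intro has_lead_tree has_lead_prm[OF assms(1)]) (auto simp: good_def)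

subsection \<open>Bracketings of Lyndon-Shirshov words\<close>

abbreviation gen_word :: "'x \<Rightarrow> 'x word" where
  "gen_word \<equiv> \<lambda>x. [Gen x]"

lemma subst_prm_gen_word [simp]: "subst_prm gen_word p = [p]"
proof (induction p)
  case (Op u)
  then have "subst_word gen_word u = u" by (induction u) auto
  then show ?case by simp
qed simp

lemma subst_word_gen_word [simp]: "subst_word gen_word u = u"
  by (induction u) auto

lemma lex_gt_flip: "length u = length v \<Longrightarrow> lex_gt (\<lambda>p q. R q p) u v \<longleftrightarrow> lex_gt R v u"
  by (induction u v rule: list_induct2) auto

text \<open>A rotation keeps degree and breadth, so only the lexicographic comparison remains; at
  equal length \<open>lex_gt prm_gt\<close> and \<open>lex_gt prm_less\<close> are opposite.\<close>

lemma Dl_less_rotation: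
  assumes "lyndon prm_gt (u @ v)" "u \<noteq> []" "v \<noteq> []"
  shows "Dl_less (v @ u) (u @ v)"
proof -
  have "lex_gt prm_gt (u @ v) (v @ u)" by (rule PO.lyndon_rotation[OF assms])
  then have "lex_gt prm_less (v @ u) (u @ v)" by (subst (asm) lex_gt_flip) simp_all
  then show ?thesis by (simp add: Dl_less_iff)
qed

text \<open>Each node of a standard bracketing carries a Lyndon word \<open>st\<close>, which
  exceeds its rotation \<open>ts\<close>.\<close>

lemma nlsw_nodes: "is_nlsw prm_gt {p. prm_over UNIV p} t \<Longrightarrow> nodes (\<lambda>p. [p]) t"
proof (induction t)
  case (Br s t)
  have w: "tree_word (\<lambda>p. [p]) r = underlying r" for r :: "'a prm bword"
    by (simp add: tree_word_def)
  have "lyndon prm_gt (underlying s @ underlying t)" "is_nlsw prm_gt {p. prm_over UNIV p} s"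
    "is_nlsw prm_gt {p. prm_over UNIV p} t"
    using Br.prems unfolding PO.is_nlsw_iff by auto
  then show ?case
    using Br.IH Dl_less_rotation[OF _ PO.underlying_not_Nil PO.underlying_not_Nil] by (simp add: w)
qed simp

lemma nodes_map: "nodes W (map_bword f t) \<longleftrightarrow> nodes (W \<circ> f) t"
proof (induction t)
  case (Br s t)
  have "tree_word W (map_bword f r) = tree_word (W \<circ> f) r" for r
    by (simp add: tree_word_def underlying_map)
  then show ?case using Br by (simp add: comp_def)
qed simp

lemma nodes_cong: "(\<And>p. p \<in> set_bword t \<Longrightarrow> W p = W' p) \<Longrightarrow> nodes W t \<longleftrightarrow> nodes W' t"
proof (induction t)
  case (Br s t)
  have "tree_word W s = tree_word W' s" "tree_word W t = tree_word W' t"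
    unfolding tree_word_def using Br.prems
    by (auto simp: set_bword_underlying intro!: arg_cong[of _ _ concat])
  then show ?case using Br by simp
qed simp

lemma good_bracket: "w \<in> ALSW X \<Longrightarrow> good gen_word (bracket w)"
proof -
  have tree: "nodes (prm_word gen_word) (bracket u)" if u: "u \<in> ALSW X" for u
  proof -
    have s: "set_bword (std_bracket prm_gt u) = set u"
      using PO.std_bracket_spec(2)[OF ALSW_lyndon[OF u] ALSW_set[OF u]] by (simp add: set_bword_underlying)
    have "nodes (\<lambda>p. [p]) (std_bracket prm_gt u)"
      by (rule nlsw_nodes[OF PO.std_bracket_nlsw[OF ALSW_lyndon[OF u] ALSW_set[OF u]]])
    moreover have "(prm_word gen_word \<circ> bracket_prm) p = [p]" if "p \<in> set u" for p
      using u that erase_bracket_prm[of X p] by (simp add: ALSW_iff)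
    ultimately show ?thesis
      unfolding bracket_ALSW[OF u] nodes_map
      using nodes_cong[of "std_bracket prm_gt u" "prm_word gen_word \<circ> bracket_prm" "\<lambda>p. [p]"] s by simp
  qed
  have set: "set_bword (bracket u) = bracket_prm ` set u" if u: "u \<in> ALSW X" for u
    using PO.std_bracket_spec(2)[OF ALSW_lyndon[OF u] ALSW_set[OF u]]
    unfolding bracket_ALSW[OF u] by (simp add: set_bword_underlying underlying_map)
  have prm: "good_prm gen_word (bracket_prm p)" if "prm_lyn X p" for p
    using that
  proof (induction p)
    case (Op u)
    have u: "u \<in> ALSW X" using Op.prems by (simp add: ALSW_iff)
    have "good gen_word (bracket u)"
      using tree[OF u] set[OF u] Op u by (auto simp: good_def ALSW_iff)
    then show ?case by (simp add: bracket_def[symmetric])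
  qed simp
  show "w \<in> ALSW X \<Longrightarrow> good gen_word (bracket w)"
    using tree set prm by (auto simp: good_def ALSW_iff)
qed

lemma has_lead_lie_poly: "w \<in> ALSW X \<Longrightarrow> has_lead (lie_poly (bracket w)) w"
  using has_lead_nword_eval[of pgen gen_word "bracket w"] good_bracket[of w X] erase_bracket[of w X]
  by (simp add: lie_poly_def pgen_def has_lead_mon)

subsection \<open>Replacing a subword of a bracketing\<close>

lemma erase_tsubst_prm: "erase (tsubst_prm \<rho> p) = subst_prm (\<lambda>y. erase (\<rho> y)) (erase_prm p)"
proof (induction p)
  case (BOp t)
  have "erase (join_bword (map_bword (tsubst_prm \<rho>) t)) = subst_word (\<lambda>y. erase (\<rho> y)) (erase t)"
    using BOp by (induction t) auto
  then show ?case by simp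
qed simp

definition tsubst :: "('y \<Rightarrow> 'z nword) \<Rightarrow> 'y nword \<Rightarrow> 'z nword" where
  "tsubst \<rho> t = join_bword (map_bword (tsubst_prm \<rho>) t)"

lemma tsubst_simps [simp]:
  "tsubst \<rho> (Letter p) = tsubst_prm \<rho> p" "tsubst \<rho> (Br s t) = Br (tsubst \<rho> s) (tsubst \<rho> t)"
  by (simp_all add: tsubst_def)

lemma tsubst_prm_BOp [simp]: "tsubst_prm \<rho> (BOp t) = Letter (BOp (tsubst \<rho> t))"
  by (simp add: tsubst_def)

declare tsubst_prm.simps(2) [simp del]

lemma erase_tsubst: "erase (tsubst \<rho> t) = subst_word (\<lambda>y. erase (\<rho> y)) (erase t)"
  by (induction t) (simp_all add: erase_tsubst_prm)

text \<open>A node of the outer tree is also a node of the tree after substitution, with the same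
  words on both sides, so the condition there is inherited.\<close>

lemma good_tsubst:
  "good_prm (\<lambda>y. erase (\<rho> y)) p \<or> \<not> good gen_word (tsubst_prm \<rho> p)"
proof (induction p)
  case (BOp t)
  have "good gen_word (tsubst \<rho> t) \<Longrightarrow> good (\<lambda>y. erase (\<rho> y)) t"
    using BOp by (induction t) (auto simp: erase_tsubst)
  then show ?case by auto
qed simp

lemma good_of_tsubst: "good gen_word (tsubst \<rho> t) \<Longrightarrow> good (\<lambda>y. erase (\<rho> y)) t"
  using good_tsubst[of \<rho>] by (induction t) (auto simp: erase_tsubst)

lemma tplug_tsubst: "tplug T s = tsubst (case_option s (\<lambda>x. Letter (BGen x))) T"
  by (simp add: tplug_def tsubst_def)

lemma erase_case_option: "erase (case_option s (\<lambda>x. Letter (BGen x)) y) = case_option (erase s) gen_word y"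
  by (cases y) simp_all

text \<open>The inequalities at the nodes involve leading words alone, so the subword
  \<open>s\<close> may be replaced by any monic polynomial with the same leading word.\<close>

lemma has_lead_tplug:
  assumes "good gen_word (tplug T s)" "has_lead g (erase s)"
  shows "has_lead (nword_eval (case_option g pgen) T) (erase (tplug T s))"
proof -
  have e: "(\<lambda>y. erase (case_option s (\<lambda>x. Letter (BGen x)) y)) = case_option (erase s) gen_word"
    using erase_case_option by (rule ext)
  have "good (case_option (erase s) gen_word) T"
    using good_of_tsubst[OF assms(1)[unfolded tplug_tsubst]] unfolding e .
  moreover have "has_lead (case_option g pgen y) (case_option (erase s) gen_word y)" for y
    using assms(2) by (cases y) (simp_all add: pgen_def has_lead_mon)
  ultimately have "has_lead (nword_eval (case_option g pgen) T) (subst_word (case_option (erase s) gen_word) (erase T))"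
    by (rule has_lead_nword_eval[rotated])
  then show ?thesis unfolding tplug_tsubst erase_tsubst e .
qed

subsection \<open>Special normal words\<close>

text \<open>The definition compares neighbouring factors; transitivity extends this to all pairs,
  the form in which \<open>lyndon_factors_unique\<close> is stated.\<close>

lemma lyndon_factors_spec:
  assumes "\<forall>p\<in>set c. prm_lyn X p"
  shows "concat (lyndon_factors X c) = c" "set (lyndon_factors X c) \<subseteq> ALSW X"
    "sorted_wrt (lex_le prm_gt) (lyndon_factors X c)"
proof -
  have tr: "transp (lex_le prm_gt :: 'a word \<Rightarrow> _)" using PO.lex_le_trans by (auto simp: transp_def)
  have sorted: "(\<forall>t. Suc t < length cs \<longrightarrow> lex_le prm_gt (cs ! t) (cs ! Suc t)) \<longleftrightarrow> sorted_wrt (lex_le prm_gt) cs"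
    for cs :: "'a word list"
    using sorted_wrt_iff_nth_Suc_transp[OF tr, of cs] by simp
  have "set c \<subseteq> {p. prm_over UNIV p}" using assms prm_lyn_over_UNIV by blast
  then obtain cs where cs: "concat cs = c" "\<forall>d\<in>set cs. lyndon prm_gt d" "sorted_wrt (lex_le prm_gt) cs"
    using PO.lyndon_factors_exist by blast
  have "set cs \<subseteq> ALSW X"
  proof
    fix d assume d: "d \<in> set cs"
    then have "set d \<subseteq> set c" unfolding cs(1)[symmetric] by auto
    then show "d \<in> ALSW X" using d cs(2) assms by (auto simp: ALSW_iff)
  qed
  then have ex: "concat cs = c \<and> set cs \<subseteq> ALSW X \<and> sorted_wrt (lex_le prm_gt) cs" using cs by simp
  have un: "ds = cs" if "concat ds = c \<and> set ds \<subseteq> ALSW X \<and> sorted_wrt (lex_le prm_gt) ds" for ds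
  proof (rule PO.lyndon_factors_unique)
    show "\<forall>d\<in>set ds. lyndon prm_gt d" using that by (auto intro: ALSW_lyndon)
  qed (use that cs in simp_all)
  have "lyndon_factors X c = cs"
    unfolding lyndon_factors_def sorted by (rule the_equality) (use ex un in blast)+
  then show "concat (lyndon_factors X c) = c" "set (lyndon_factors X c) \<subseteq> ALSW X"
    "sorted_wrt (lex_le prm_gt) (lyndon_factors X c)" using ex by simp_all
qed

text \<open>Each partial product is a Lyndon word greater than the next factor, so every commutator
  has the concatenation as its leading word.\<close>

lemma has_lead_left_normed:
  assumes f: "has_lead f v" and v: "v \<in> ALSW X" and vc: "v @ c \<in> ALSW X"
  shows "has_lead (foldl pcomm f (map (\<lambda>d. lie_poly (bracket d)) (lyndon_factors X c))) (v @ c)"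
proof -
  let ?cs = "lyndon_factors X c"
  have "\<forall>p\<in>set c. prm_lyn X p" using vc by (auto simp: ALSW_iff)
  note cs = lyndon_factors_spec[OF this]
  have "has_lead (foldl pcomm f (map (\<lambda>d. lie_poly (bracket d)) ds)) (v @ concat ds)"
    if "?cs = ds @ es" for ds es
    using that
  proof (induction ds arbitrary: es rule: rev_induct)
    case Nil
    then show ?case using f by simp
  next
    case (snoc d ds)
    have d: "d \<in> ALSW X" using cs(2) snoc.prems by auto
    have split: "?cs = ds @ d # es" using snoc.prems by simp
    have l: "lyndon prm_gt (v @ concat ds) \<and> lex_gt prm_gt (v @ concat ds) d"
      by (rule PO.lyndon_mult_factors[of v ?cs ds d es])
        (use split v vc cs in \<open>auto intro: ALSW_lyndon dest: ALSW_set\<close>)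
    then have "lyndon prm_gt ((v @ concat ds) @ d)"
      using PO.lyndon_append ALSW_lyndon[OF d] by blast
    then have "Dl_less (d @ v @ concat ds) ((v @ concat ds) @ d)"
      using Dl_less_rotation[of "v @ concat ds" d] ALSW_not_Nil[OF v] ALSW_not_Nil[OF d] by simp
    then show ?case
      using has_lead_pcomm[OF snoc.IH[OF split] has_lead_lie_poly[OF d]] by simp
  qed
  from this[of ?cs "[]"] show ?thesis using cs(1) by simp
qed

lemma plug_lift_word [simp]: "subst_word (case_option v gen_word) (lift_word c) = c"
proof -
  have "subst_prm (case_option v gen_word) (map_prm Some p) = [p]" for p
  proof (induction p)
    case (Op u)
    then have "subst_word (case_option v gen_word) (lift_word u) = u" by (induction u) auto
    then show ?case by simp
  qed simp
  then show ?thesis by (induction c) auto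
qed

text \<open>The left-normed commutator that replaces the subword \<open>[vc]\<close> has the same
  leading word \<open>vc\<close>, and nothing else in the bracketing of \<open>plug \<pi> v\<close>
  changes.\<close>

theorem has_lead_special_normal:
  assumes ch: "valid_choice X ch" and \<pi>: "\<pi> \<in> star_words X" and f: "has_lead f v"
    and v: "v \<in> ALSW X" and p: "plug \<pi> v \<in> ALSW X"
  shows "has_lead (special_normal X ch \<pi> f) (plug \<pi> v)"
proof -
  obtain T c where Tc: "ch \<pi> v = (T, c)" by (cases "ch \<pi> v")
  have vc: "v @ c \<in> ALSW X" and br: "bracket (plug \<pi> v) = tplug T (bracket (v @ c))"
    using ch \<pi> v p Tc unfolding valid_choice_def by fastforce+
  let ?g = "foldl pcomm f (map (\<lambda>d. lie_poly (bracket d)) (lyndon_factors X c))"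
  have "has_lead ?g (erase (bracket (v @ c)))"
    using has_lead_left_normed[OF f v vc] erase_bracket[OF vc] by simp
  moreover have "good gen_word (tplug T (bracket (v @ c)))"
    using good_bracket[OF p] br by simp
  ultimately have "has_lead (nword_eval (case_option ?g pgen) T) (erase (tplug T (bracket (v @ c))))"
    by (rule has_lead_tplug[rotated])
  then show ?thesis
    unfolding special_normal_def has_lead_lead[OF f] Tc br[symmetric] erase_bracket[OF p] by simp
qed

section \<open>The free Lie \<open>\<Omega>\<close>-algebra\<close>

lemma Lie_simps [simp]:
  "carrier (Lie X) = Lie_set X" "monoid.mult (Lie X) = pcomm" "zero (Lie X) = 0" "add (Lie X) = (+)"
  "module.smult (Lie X) = pscale" "opr (Lie X) = pop"
  by (simp_all add: Lie_def)

lemma Lie_uminus: "f \<in> Lie_set X \<Longrightarrow> - f \<in> Lie_set X"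
  using Lie_scale[of f X "- 1"] by (simp add: PV.scale_minus_left)

lemma Lie_diff: "f \<in> Lie_set X \<Longrightarrow> g \<in> Lie_set X \<Longrightarrow> f - g \<in> Lie_set X"
  using Lie_add[OF _ Lie_uminus, of f X g] by simp

lemma lie_op_algebra_Lie: "lie_op_algebra (Lie X :: ('k::field, ('x, 'k) omega_poly) lie_op)"
proof (intro lie_op_algebra.intro lie_op_algebra_axioms.intro moduleI abelian_groupI)
  fix f assume "f \<in> carrier (Lie X :: ('k, ('x, 'k) omega_poly) lie_op)"
  then show "\<exists>g\<in>carrier (Lie X :: ('k, ('x, 'k) omega_poly) lie_op). g \<oplus>\<^bsub>Lie X\<^esub> f = \<zero>\<^bsub>Lie X\<^esub>"
    by (intro bexI[of _ "- f"]) (simp_all add: Lie_uminus)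
next
  fix f g h :: "('x, 'k) omega_poly"
  show "f \<otimes>\<^bsub>Lie X\<^esub> (g \<otimes>\<^bsub>Lie X\<^esub> h) \<oplus>\<^bsub>Lie X\<^esub> g \<otimes>\<^bsub>Lie X\<^esub> (h \<otimes>\<^bsub>Lie X\<^esub> f) \<oplus>\<^bsub>Lie X\<^esub> h \<otimes>\<^bsub>Lie X\<^esub> (f \<otimes>\<^bsub>Lie X\<^esub> g) = \<zero>\<^bsub>Lie X\<^esub>"
    using pcomm_jacobi[of f g h] by simp
qed (auto intro: Lie_set.intros cring_from_type_algebra
  simp: PV.scale_right_distrib PV.scale_left_distrib pcomm_distribs pop_distribs add.assoc add.commute)

interpretation LieX: lie_op_algebra "Lie X :: ('k::field, ('x, 'k) omega_poly) lie_op" for X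
  by (rule lie_op_algebra_Lie)

lemma comm_eval_teval: "comm_eval t = teval pcomm t"
  by (induction t) simp_all

lemma eval_prm_ev_prm: "eval_prm \<sigma> p = ev_prm pcomm pop \<sigma> p"
proof (induction p)
  case (BOp t)
  then have e: "map_bword (eval_prm \<sigma>) t = map_bword (ev_prm pcomm pop \<sigma>) t"
    by (intro bword.map_cong) auto
  show ?case unfolding eval_prm_BOp nword_eval_def comm_eval_teval ev_prm.simps e ..
qed simp

lemma nword_ev_Lie: "nword_ev (Lie X) \<sigma> t = nword_eval \<sigma> t"
  unfolding nword_ev_def nword_eval_def by (simp add: comm_eval_teval eval_prm_ev_prm[abs_def])

subsection \<open>Coordinates with respect to the bracketings\<close>

abbreviation lyn_comb :: "('x::wellorder, 'k::field) omega_poly \<Rightarrow> ('x, 'k) omega_poly" where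
  "lyn_comb \<equiv> lin_ext (\<lambda>w. lie_poly (bracket w))"

lemma finite_Dl_max:
  assumes "finite A" "A \<noteq> {}" "A \<subseteq> ALSW X"
  shows "\<exists>m\<in>A. \<forall>v\<in>A. v = m \<or> Dl_less v m"
  using assms
proof (induction rule: finite_ne_induct)
  case (singleton a)
  show ?case by simp
next
  case (insert a A)
  then obtain m where m: "m \<in> A" "\<forall>v\<in>A. v = m \<or> Dl_less v m" by auto
  have "a = m \<or> Dl_less a m \<or> Dl_less m a"
    by (rule Dl_less_total[of X]) (use insert.prems m(1) ALSW_over in auto)
  then consider "a = m \<or> Dl_less a m" | "Dl_less m a" by blast
  then show ?case
  proof cases
    case 1
    then show ?thesis using m by (intro bexI[of _ m]) auto
  next
    case 2
    have "v = a \<or> Dl_less v a" if "v \<in> A" for v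
      using m(2) that 2 Dl_less_trans[OF _ 2, of v] by auto
    then show ?thesis by (intro bexI[of _ a]) auto
  qed
qed

text \<open>The bracketing of \<open>w\<close> is monic with leading word \<open>w\<close>, so
  distinct words have distinct leading words and the greatest one in the support cannot cancel.
  Linear independence of the bracketings follows.\<close>

lemma lyn_comb_lead:
  assumes "supp c \<subseteq> ALSW X" "c \<noteq> 0"
  shows "\<exists>m\<in>supp c. coef (lyn_comb c) m = coef c m \<and> (\<forall>v\<in>supp (lyn_comb c). v = m \<or> Dl_less v m)"
proof -
  obtain m where m: "m \<in> supp c" "\<forall>v\<in>supp c. v = m \<or> Dl_less v m"
    using finite_Dl_max[OF finite_keys _ assms(1)] assms(2) by auto
  have lead: "has_lead (lie_poly (bracket w) :: ('a, 'b) omega_poly) w" if "w \<in> supp c" for w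
    using has_lead_lie_poly assms(1) that by blast
  have "coef (lyn_comb c) m = (\<Sum>w\<in>supp c. coef c w * coef (lie_poly (bracket w)) m)"
    by (simp add: lin_ext_def lookup_sum)
  also have "\<dots> = (\<Sum>w\<in>supp c. if w = m then coef c m else 0)"
  proof (intro sum.cong refl)
    fix w assume w: "w \<in> supp c"
    show "coef c w * coef (lie_poly (bracket w)) m = (if w = m then coef c m else 0)"
    proof (cases "w = m")
      case True
      then show ?thesis using lead[OF m(1)] by (simp add: has_lead_def)
    next
      case False
      then have wm: "Dl_less w m" using m(2) w by blast
      have "m \<notin> supp (lie_poly (bracket w) :: ('a, 'b) omega_poly)"
        using has_leadD[OF lead[OF w], of m] wm Dl_less_trans[OF wm, of w] False by auto
      then show ?thesis using False by (simp add: in_keys_iff)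
    qed
  qed
  also have "\<dots> = coef c m" using m(1) by simp
  finally have c: "coef (lyn_comb c) m = coef c m" .
  have "v = m \<or> Dl_less v m" if v: "v \<in> supp (lyn_comb c)" for v
  proof -
    obtain w where w: "w \<in> supp c" "v \<in> supp (pscale (coef c w) (lie_poly (bracket w)))"
      using v keys_sum[of "\<lambda>w. pscale (coef c w) (lie_poly (bracket w))" "supp c"]
      unfolding lin_ext_def by blast
    then have "v \<in> supp (lie_poly (bracket w) :: ('a, 'b) omega_poly)"
      using supp_pscale[of "coef c w" "lie_poly (bracket w)"] by blast
    then have "v = w \<or> Dl_less v w" by (rule has_leadD[OF lead[OF w(1)]])
    moreover have "w = m \<or> Dl_less w m" using m(2) w(1) by blast
    ultimately show ?thesis using Dl_less_trans[of v w m] by blast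
  qed
  then show ?thesis using m(1) c by blast
qed

lemma lyn_comb_eq_0:
  assumes "supp c \<subseteq> ALSW X" "lyn_comb c = 0" shows "c = 0"
proof (rule ccontr)
  assume "c \<noteq> 0"
  then obtain m where "m \<in> supp c" "coef (lyn_comb c) m = coef c m"
    using lyn_comb_lead[OF assms(1)] by blast
  then show False using assms(2) by (simp add: in_keys_iff)
qed

lemma pgen_closed: "pgen \<in> X \<rightarrow> carrier (Lie X)"
  by (simp add: Lie_gen)

lemma Lie_set_lyn_span: "f \<in> Lie_set X \<Longrightarrow> f \<in> lyn_span (Lie X) X pgen"
proof (induction rule: Lie_set.induct)
  case (Lie_gen x)
  then show ?case by (rule LieX.lyn_span_gen[OF pgen_closed])
next
  case Lie_zero
  show ?case using lspan_zero[of "Lie X"] by (simp add: lyn_span_def)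
next
  case (Lie_add f g)
  then show ?case using LieX.lyn_span_add[OF pgen_closed, of f X g] by simp
next
  case (Lie_scale f c)
  then show ?case using LieX.lyn_span_smult[OF pgen_closed, of f X c] by simp
next
  case (Lie_comm f g)
  then show ?case using LieX.lyn_span_bracket[OF pgen_closed, of f X g] by simp
next
  case (Lie_op f)
  then show ?case using LieX.lyn_span_opr[OF pgen_closed, of f X] by simp
qed

lemma lie_poly_in_Lie_set: "w \<in> ALSW X \<Longrightarrow> lie_poly (bracket w) \<in> Lie_set X"
  using LieX.nword_ev_carrier[OF pgen_closed, of w X] by (simp add: nword_ev_Lie lie_poly_def)

lemma lin_ext_single: "lin_ext F (Poly_Mapping.single u a) = pscale a (F u)"
  by (simp add: lin_ext_superset[of "{u}"])

lemma supp_add_subset: "supp c \<subseteq> A \<Longrightarrow> supp d \<subseteq> A \<Longrightarrow> supp (c + d) \<subseteq> A"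
  using keys_add[of c d] by blast

lemma supp_single_subset: "u \<in> A \<Longrightarrow> supp (Poly_Mapping.single u a) \<subseteq> A"
  by simp

lemma lin_ext_in:
  assumes "\<And>f g. f \<in> S \<Longrightarrow> g \<in> S \<Longrightarrow> f + g \<in> S" "\<And>a f. f \<in> S \<Longrightarrow> pscale a f \<in> S" "0 \<in> S"
    "\<And>w. w \<in> supp c \<Longrightarrow> F w \<in> S"
  shows "lin_ext F c \<in> S"
  unfolding lin_ext_def
proof -
  have "(\<Sum>u\<in>A. pscale (coef c u) (F u)) \<in> S" if "finite A" "A \<subseteq> supp c" for A
    using that by (induction rule: finite_induct) (use assms in auto)
  then show "(\<Sum>u\<in>supp c. pscale (coef c u) (F u)) \<in> S" by simp
qed

subsection \<open>Products and homomorphisms\<close>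

definition lie_prod :: "('k, 'a, 'm) lie_op_scheme \<Rightarrow> ('k, 'b, 'n) lie_op_scheme \<Rightarrow> ('k, 'a \<times> 'b) lie_op" where
  "lie_prod L M = \<lparr>carrier = carrier L \<times> carrier M,
     monoid.mult = (\<lambda>(a, b) (c, d). (a \<otimes>\<^bsub>L\<^esub> c, b \<otimes>\<^bsub>M\<^esub> d)), one = (\<one>\<^bsub>L\<^esub>, \<one>\<^bsub>M\<^esub>),
     zero = (\<zero>\<^bsub>L\<^esub>, \<zero>\<^bsub>M\<^esub>), add = (\<lambda>(a, b) (c, d). (a \<oplus>\<^bsub>L\<^esub> c, b \<oplus>\<^bsub>M\<^esub> d)),
     module.smult = (\<lambda>r (a, b). (r \<odot>\<^bsub>L\<^esub> a, r \<odot>\<^bsub>M\<^esub> b)), opr = (\<lambda>(a, b). (opr L a, opr M b))\<rparr>"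

lemma lie_prod_simps [simp]:
  "carrier (lie_prod L M) = carrier L \<times> carrier M"
  "(a, b) \<otimes>\<^bsub>lie_prod L M\<^esub> (c, d) = (a \<otimes>\<^bsub>L\<^esub> c, b \<otimes>\<^bsub>M\<^esub> d)"
  "\<zero>\<^bsub>lie_prod L M\<^esub> = (\<zero>\<^bsub>L\<^esub>, \<zero>\<^bsub>M\<^esub>)"
  "(a, b) \<oplus>\<^bsub>lie_prod L M\<^esub> (c, d) = (a \<oplus>\<^bsub>L\<^esub> c, b \<oplus>\<^bsub>M\<^esub> d)"
  "r \<odot>\<^bsub>lie_prod L M\<^esub> (a, b) = (r \<odot>\<^bsub>L\<^esub> a, r \<odot>\<^bsub>M\<^esub> b)"
  "opr (lie_prod L M) (a, b) = (opr L a, opr M b)"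
  by (simp_all add: lie_prod_def)

lemma lie_op_algebra_prod:
  assumes "lie_op_algebra L" "lie_op_algebra M" shows "lie_op_algebra (lie_prod L M)"
proof -
  interpret L: lie_op_algebra L by fact
  interpret M: lie_op_algebra M by fact
  show ?thesis
  proof (intro lie_op_algebra.intro lie_op_algebra_axioms.intro moduleI abelian_groupI)
    fix x assume "x \<in> carrier (lie_prod L M)"
    then show "\<exists>y\<in>carrier (lie_prod L M). y \<oplus>\<^bsub>lie_prod L M\<^esub> x = \<zero>\<^bsub>lie_prod L M\<^esub>"
      by (intro bexI[of _ "(\<ominus>\<^bsub>L\<^esub> fst x, \<ominus>\<^bsub>M\<^esub> snd x)"])
        (auto simp: L.M.l_neg M.M.l_neg)
  next
    fix x y assume "x \<in> carrier (lie_prod L M)" "y \<in> carrier (lie_prod L M)"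
    then show "x \<oplus>\<^bsub>lie_prod L M\<^esub> y = y \<oplus>\<^bsub>lie_prod L M\<^esub> x"
      by (auto simp: L.M.a_comm M.M.a_comm)
  qed (auto intro: cring_from_type_algebra
    simp: L.M.a_assoc[symmetric] M.M.a_assoc[symmetric]
      L.smult_add_scalar M.smult_add_scalar L.smult_add_vector M.smult_add_vector
      L.smult_smult M.smult_smult L.smult_1 M.smult_1
      L.bracket_closed M.bracket_closed L.bracket_add_left M.bracket_add_left
      L.bracket_add_right M.bracket_add_right L.bracket_smult_left M.bracket_smult_left
      L.bracket_smult_right M.bracket_smult_right L.bracket_alternating M.bracket_alternating
      L.jacobi M.jacobi L.opr_closed M.opr_closed L.opr_add M.opr_add L.opr_smult M.opr_smult)
qed

lemma ev_prm_prod: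
  "ev_prm (monoid.mult (lie_prod L M)) (opr (lie_prod L M)) (\<lambda>x. (\<phi> x, \<psi> x)) p
    = (ev_prm (monoid.mult L) (opr L) \<phi> p, ev_prm (monoid.mult M) (opr M) \<psi> p)"
proof (induction p)
  case (BOp t)
  have "teval (monoid.mult (lie_prod L M)) (map_bword (ev_prm (monoid.mult (lie_prod L M)) (opr (lie_prod L M)) (\<lambda>x. (\<phi> x, \<psi> x))) t)
    = (teval (monoid.mult L) (map_bword (ev_prm (monoid.mult L) (opr L) \<phi>) t),
       teval (monoid.mult M) (map_bword (ev_prm (monoid.mult M) (opr M) \<psi>) t))"
    using BOp by (induction t) auto
  then show ?case by simp
qed simp

lemma nword_ev_prod:
  "nword_ev (lie_prod L M) (\<lambda>x. (\<phi> x, \<psi> x)) t = (nword_ev L \<phi> t, nword_ev M \<psi> t)"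
  unfolding nword_ev_def by (induction t) (auto simp: ev_prm_prod)

context lie_op_algebra
begin

definition lin_comb :: "('x word \<Rightarrow> 'a) \<Rightarrow> ('x, 'k) omega_poly \<Rightarrow> 'a" where
  "lin_comb F c = (\<Oplus>w\<in>supp c. coef c w \<odot> F w)"

lemma lin_comb_superset:
  assumes "finite A" "supp c \<subseteq> A" "F \<in> A \<rightarrow> carrier L"
  shows "lin_comb F c = (\<Oplus>w\<in>A. coef c w \<odot> F w)"
  unfolding lin_comb_def
proof (rule M.add.finprod_mono_neutral_cong_left)
  show "coef c w \<odot> F w = \<zero>" if "w \<in> A - supp c" for w
    using that assms(3) smult_0[of "F w"] by (auto simp: in_keys_iff)
qed (use assms in auto)

lemma lin_comb_add:
  assumes F: "F \<in> A \<rightarrow> carrier L" and c: "supp c \<subseteq> A" and d: "supp d \<subseteq> A"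
  shows "lin_comb F (c + d) = lin_comb F c \<oplus> lin_comb F d"
proof -
  let ?S = "supp c \<union> supp d"
  have FS: "F \<in> ?S \<rightarrow> carrier L" using F c d by blast
  have "lin_comb F (c + d) = (\<Oplus>w\<in>?S. coef (c + d) w \<odot> F w)"
    by (rule lin_comb_superset) (use FS keys_add[of c d] in auto)
  also have "\<dots> = (\<Oplus>w\<in>?S. coef c w \<odot> F w \<oplus> coef d w \<odot> F w)"
  proof (rule M.add.finprod_cong')
    show "coef (c + d) w \<odot> F w = coef c w \<odot> F w \<oplus> coef d w \<odot> F w" if "w \<in> ?S" for w
      using funcset_mem[OF FS that] by (simp add: lookup_add smult_add_scalar)
    show "(\<lambda>w. coef c w \<odot> F w \<oplus> coef d w \<odot> F w) \<in> ?S \<rightarrow> carrier L"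
      using funcset_mem[OF FS] by auto
  qed simp
  also have "\<dots> = (\<Oplus>w\<in>?S. coef c w \<odot> F w) \<oplus> (\<Oplus>w\<in>?S. coef d w \<odot> F w)"
    by (rule M.add.finprod_multf) (use FS in auto)
  also have "(\<Oplus>w\<in>?S. coef c w \<odot> F w) = lin_comb F c"
    by (rule lin_comb_superset[symmetric]) (use FS in auto)
  also have "(\<Oplus>w\<in>?S. coef d w \<odot> F w) = lin_comb F d"
    by (rule lin_comb_superset[symmetric]) (use FS in auto)
  finally show ?thesis .
qed

lemma lin_comb_single: "F u \<in> carrier L \<Longrightarrow> lin_comb F (Poly_Mapping.single u a) = a \<odot> F u"
proof -
  assume F: "F u \<in> carrier L"
  have "lin_comb F (Poly_Mapping.single u a) = (\<Oplus>w\<in>{u}. coef (Poly_Mapping.single u a) w \<odot> F w)"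
    by (rule lin_comb_superset) (use F in auto)
  also have "\<dots> = a \<odot> F u" using F by simp
  finally show ?thesis .
qed

lemma lin_comb_0: "lin_comb F 0 = \<zero>"
  by (simp add: lin_comb_def)

text \<open>
  The subalgebra of \<open>Lie X \<times> L\<close> generated by the pairs \<open>(x, \<phi> x)\<close> is spanned by pairs of bracketings,
  hence it is the graph of a homomorphism.
\<close>

definition hom_graph :: "'x::wellorder set \<Rightarrow> ('x \<Rightarrow> 'a) \<Rightarrow> (('x, 'k) omega_poly \<times> 'a) set" where
  "hom_graph X \<phi> = lyn_span (lie_prod (Lie X) L) X (\<lambda>x. (pgen x, \<phi> x))"

text \<open>A bracketing evaluated in the product is the pair of its two values, so both components
  have the same coefficients \<open>c\<close>.\<close>

lemma hom_graph_coordinates: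
  assumes \<phi>: "\<phi> \<in> X \<rightarrow> carrier L" and z: "z \<in> hom_graph X \<phi>"
  shows "\<exists>c. supp c \<subseteq> ALSW X \<and> z = (lyn_comb c, lin_comb (\<lambda>w. nword_ev L \<phi> (bracket w)) c)"
  using z unfolding hom_graph_def lyn_span_def
proof (induction rule: lspan.induct)
  case lspan_zero
  show ?case by (intro exI[of _ 0]) (simp add: lin_ext_def lin_comb_0)
next
  case (lspan_step b z a)
  let ?F = "\<lambda>w. nword_ev L \<phi> (bracket w)"
  have F: "?F \<in> ALSW X \<rightarrow> carrier L" using nword_ev_carrier[OF \<phi>] by blast
  obtain w where w: "w \<in> ALSW X" "b = (lie_poly (bracket w), ?F w)"
    using lspan_step.hyps(1) by (auto simp: nword_ev_prod nword_ev_Lie lie_poly_def)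
  obtain c where c: "supp c \<subseteq> ALSW X" "z = (lyn_comb c, lin_comb ?F c)"
    using lspan_step.IH by blast
  let ?c = "Poly_Mapping.single w a + c"
  have s: "supp (Poly_Mapping.single w a) \<subseteq> ALSW X" by (rule supp_single_subset[OF w(1)])
  have "lyn_comb ?c = pscale a (lie_poly (bracket w)) + lyn_comb c"
    by (simp add: lin_ext_add lin_ext_single)
  moreover have "lin_comb ?F ?c = a \<odot> ?F w \<oplus> lin_comb ?F c"
    unfolding lin_comb_add[OF F s c(1)] lin_comb_single[of ?F, OF funcset_mem[OF F w(1)]] by simp
  moreover have "supp ?c \<subseteq> ALSW X" by (rule supp_add_subset[OF s c(1)])
  ultimately show ?case unfolding w(2) c(2) by (intro exI[of _ ?c]) simp
qed

context
  fixes X :: "'x::wellorder set" and \<phi> :: "'x \<Rightarrow> 'a"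
  assumes \<phi>: "\<phi> \<in> X \<rightarrow> carrier L"
begin

lemma lie_op_algebra_graph: "lie_op_algebra (lie_prod (Lie X) L)"
  by (rule lie_op_algebra_prod[OF lie_op_algebra_Lie]) (rule lie_op_algebra_axioms)

interpretation G: lie_op_algebra "lie_prod (Lie X) L"
  by (rule lie_op_algebra_graph)

lemma graph_gens: "(\<lambda>x. (pgen x, \<phi> x)) \<in> X \<rightarrow> carrier (lie_prod (Lie X) L)"
  using \<phi> by (auto intro: Lie_gen)

lemma hom_graph_closed:
  "x \<in> X \<Longrightarrow> (pgen x, \<phi> x) \<in> hom_graph X \<phi>"
  "(f, a) \<in> hom_graph X \<phi> \<Longrightarrow> (g, b) \<in> hom_graph X \<phi> \<Longrightarrow> (f + g, a \<oplus> b) \<in> hom_graph X \<phi>"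
  "(f, a) \<in> hom_graph X \<phi> \<Longrightarrow> (pscale r f, r \<odot> a) \<in> hom_graph X \<phi>"
  "(f, a) \<in> hom_graph X \<phi> \<Longrightarrow> (g, b) \<in> hom_graph X \<phi> \<Longrightarrow> (pcomm f g, a \<otimes> b) \<in> hom_graph X \<phi>"
  "(f, a) \<in> hom_graph X \<phi> \<Longrightarrow> (pop f, opr L a) \<in> hom_graph X \<phi>"
  "(0, \<zero>) \<in> hom_graph X \<phi>"
  "(f, a) \<in> hom_graph X \<phi> \<Longrightarrow> a \<in> carrier L"
  using G.lyn_span_gen[OF graph_gens, of x] G.lyn_span_add[OF graph_gens, of "(f, a)" "(g, b)"]
    G.lyn_span_smult[OF graph_gens, of "(f, a)" r] G.lyn_span_bracket[OF graph_gens, of "(f, a)" "(g, b)"]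
    G.lyn_span_opr[OF graph_gens, of "(f, a)"] lspan_zero[of "lie_prod (Lie X) L"]
    G.lyn_span_carrier[OF graph_gens, of "(f, a)"]
  unfolding hom_graph_def by (simp_all add: lyn_span_def)

lemma hom_graph_total: "f \<in> Lie_set X \<Longrightarrow> \<exists>a. (f, a) \<in> hom_graph X \<phi>"
  by (induction rule: Lie_set.induct) (blast intro: hom_graph_closed)+

text \<open>The difference of two pairs over the same \<open>f\<close> has first component 0;
  independence of the bracketings forces its coefficients to vanish, and with them the second
  component.\<close>

lemma hom_graph_functional:
  assumes "(f, a) \<in> hom_graph X \<phi>" "(f, b) \<in> hom_graph X \<phi>" shows "a = b"
proof -
  have "(f + pscale (- 1) f, a \<oplus> (- 1) \<odot> b) \<in> hom_graph X \<phi>"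
    by (intro hom_graph_closed assms)
  then obtain c where c: "supp c \<subseteq> ALSW X" "f + pscale (- 1) f = lyn_comb c"
    "a \<oplus> (- 1) \<odot> b = lin_comb (\<lambda>w. nword_ev L \<phi> (bracket w)) c"
    using hom_graph_coordinates[OF \<phi>] by blast
  have "lyn_comb c = 0" using c(2) by (simp add: PV.scale_minus_left)
  then have "c = 0" using lyn_comb_eq_0[OF c(1)] by blast
  then have z: "a \<oplus> (- 1) \<odot> b = \<zero>" using c(3) by (simp add: lin_comb_0)
  have ab: "a \<in> carrier L" "b \<in> carrier L" using assms hom_graph_closed(7) by blast+
  have "a \<oplus> \<ominus> b = \<zero>" using z smult_uminus[OF ab(2), of 1] smult_1[OF ab(2)] by simp
  then show ?thesis using ab M.minus_equality[of a "\<ominus> b"] by simp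
qed

definition lift_hom :: "('x, 'k) omega_poly \<Rightarrow> 'a" where
  "lift_hom f = (THE a. (f, a) \<in> hom_graph X \<phi>)"

lemma lift_hom_eqI: "(f, a) \<in> hom_graph X \<phi> \<Longrightarrow> lift_hom f = a"
  unfolding lift_hom_def using hom_graph_functional by blast

lemma lift_hom_graph: "f \<in> Lie_set X \<Longrightarrow> (f, lift_hom f) \<in> hom_graph X \<phi>"
  using hom_graph_total[of f] lift_hom_eqI by auto

lemma lift_hom_gen: "x \<in> X \<Longrightarrow> lift_hom (pgen x) = \<phi> x"
  by (rule lift_hom_eqI[OF hom_graph_closed(1)])

lemma lift_hom_hom: "lift_hom \<in> lie_op_hom (Lie X) L"
  unfolding lie_op_hom_def
  by (auto intro!: lift_hom_eqI hom_graph_closed lift_hom_graph intro: hom_graph_closed(7)[OF lift_hom_graph])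

end

end

section \<open>Ideals and quotients\<close>

definition lie_ideal :: "'x set \<Rightarrow> ('x, 'k::field) omega_poly set \<Rightarrow> bool" where
  "lie_ideal X I \<longleftrightarrow> I \<subseteq> Lie_set X \<and> 0 \<in> I \<and> (\<forall>f\<in>I. \<forall>g\<in>I. f + g \<in> I) \<and> (\<forall>c. \<forall>f\<in>I. pscale c f \<in> I) \<and>
     (\<forall>a\<in>Lie_set X. \<forall>f\<in>I. pcomm a f \<in> I) \<and> (\<forall>f\<in>I. pop f \<in> I)"

lemma lie_idealD:
  assumes "lie_ideal X I"
  shows "f \<in> I \<Longrightarrow> f \<in> Lie_set X" "0 \<in> I" "f \<in> I \<Longrightarrow> g \<in> I \<Longrightarrow> f + g \<in> I" "f \<in> I \<Longrightarrow> pscale c f \<in> I"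
    "a \<in> Lie_set X \<Longrightarrow> f \<in> I \<Longrightarrow> pcomm a f \<in> I" "f \<in> I \<Longrightarrow> pop f \<in> I"
    "a \<in> Lie_set X \<Longrightarrow> f \<in> I \<Longrightarrow> pcomm f a \<in> I" "f \<in> I \<Longrightarrow> g \<in> I \<Longrightarrow> f - g \<in> I" "f \<in> I \<Longrightarrow> - f \<in> I"
proof -
  note a = assms[unfolded lie_ideal_def]
  show "f \<in> I \<Longrightarrow> f \<in> Lie_set X" "0 \<in> I" and add: "\<And>f g. f \<in> I \<Longrightarrow> g \<in> I \<Longrightarrow> f + g \<in> I"
    and scale: "\<And>f c. f \<in> I \<Longrightarrow> pscale c f \<in> I"
    and mult: "\<And>a f. a \<in> Lie_set X \<Longrightarrow> f \<in> I \<Longrightarrow> pcomm a f \<in> I" and "f \<in> I \<Longrightarrow> pop f \<in> I"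
    using a by blast+
  show neg: "- f \<in> I" if "f \<in> I" for f
    using scale[OF that, of "- 1"] by (simp add: PV.scale_minus_left)
  show "f \<in> I \<Longrightarrow> g \<in> I \<Longrightarrow> f - g \<in> I"
    using add[OF _ neg, of f g] by simp
  show "a \<in> Lie_set X \<Longrightarrow> f \<in> I \<Longrightarrow> pcomm f a \<in> I"
    using neg[OF mult, of a f] pcomm_swap[of a f] by simp
qed

lemma lie_op_ideal_iff: "lie_op_ideal (Lie X) I \<longleftrightarrow> lie_ideal X I"
proof
  assume i: "lie_op_ideal (Lie X) I"
  then have s: "submodule I scalars (Lie X)" by (simp add: lie_op_ideal_def)
  interpret S: submodule I scalars "Lie X" by (rule s)
  show "lie_ideal X I"
    unfolding lie_ideal_def
    using i S.subset S.one_closed S.m_closed S.smult_closed unfolding lie_op_ideal_def by auto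
next
  assume i: "lie_ideal X I"
  note D = lie_idealD[OF i]
  have "subgroup I (add_monoid (Lie X))"
  proof
    fix f assume f: "f \<in> I"
    have "\<ominus>\<^bsub>Lie X\<^esub> f = pscale (- 1) f"
      using LieX.smult_uminus[of f X 1] D(1)[OF f] by simp
    then show "inv\<^bsub>add_monoid (Lie X)\<^esub> f \<in> I"
      using D(4)[OF f, of "- 1"] by (simp add: a_inv_def)
  qed (use D in auto)
  then have "submodule I scalars (Lie X)"
    by (intro submodule.intro submodule_axioms.intro) (use D in auto)
  then show "lie_op_ideal (Lie X) I" unfolding lie_op_ideal_def using D by auto
qed

lemma lie_ideal_Lie_set: "lie_ideal X (Lie_set X)"
  by (auto simp: lie_ideal_def intro: Lie_set.intros)

lemma lie_ideal_generated:
  assumes "S \<subseteq> Lie_set X"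
  shows "lie_ideal X (generated_ideal (Lie X) S)" "S \<subseteq> generated_ideal (Lie X) S"
    and "lie_ideal X I \<Longrightarrow> S \<subseteq> I \<Longrightarrow> generated_ideal (Lie X) S \<subseteq> I"
proof -
  have eq: "generated_ideal (Lie X) S = \<Inter> {I. lie_ideal X I \<and> S \<subseteq> I}"
    unfolding generated_ideal_def lie_op_ideal_iff ..
  have sub: "generated_ideal (Lie X) S \<subseteq> Lie_set X"
    unfolding eq using lie_ideal_Lie_set assms by blast
  show "lie_ideal X (generated_ideal (Lie X) S)"
    unfolding lie_ideal_def
  proof (intro conjI ballI allI)
    show "generated_ideal (Lie X) S \<subseteq> Lie_set X" by fact
  qed (auto simp: eq intro: lie_idealD)
  show "S \<subseteq> generated_ideal (Lie X) S" "lie_ideal X I \<Longrightarrow> S \<subseteq> I \<Longrightarrow> generated_ideal (Lie X) S \<subseteq> I"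
    unfolding eq by blast+
qed

locale lie_ideal_quot =
  fixes X :: "'x set" and I :: "('x, 'k::field) omega_poly set"
  assumes ideal: "lie_ideal X I"
begin

lemmas D = lie_idealD[OF ideal]

abbreviation cl :: "('x, 'k) omega_poly \<Rightarrow> ('x, 'k) omega_poly set" where
  "cl f \<equiv> I +>\<^bsub>Lie X\<^esub> f"

abbreviation Q :: "('k, ('x, 'k) omega_poly set) lie_op" where
  "Q \<equiv> lie_quot (Lie X) I"

lemma cl_mem: "g \<in> cl f \<longleftrightarrow> g - f \<in> I"
proof
  assume "g \<in> cl f"
  then show "g - f \<in> I" by (auto simp: a_r_coset_def')
next
  assume "g - f \<in> I"
  then show "g \<in> cl f" unfolding a_r_coset_def' by (auto intro!: bexI[of _ "g - f"])
qed

lemma cl_self: "f \<in> cl f"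
  using D(2) by (simp add: cl_mem)

lemma cl_eq: "cl f = cl g \<longleftrightarrow> f - g \<in> I"
proof
  assume "cl f = cl g"
  then show "f - g \<in> I" using cl_self[of f] by (simp add: cl_mem)
next
  assume fg: "f - g \<in> I"
  have "h - f \<in> I \<longleftrightarrow> h - g \<in> I" for h
    using D(3)[OF _ fg, of "h - f"] D(8)[OF _ fg, of "h - g"] by auto
  then show "cl f = cl g" by (auto simp: cl_mem)
qed

lemma cl_Lie_set: "f \<in> Lie_set X \<Longrightarrow> g \<in> cl f \<Longrightarrow> g \<in> Lie_set X"
  using Lie_add[of "g - f" X f] D(1)[of "g - f"] by (simp add: cl_mem)

text \<open>The operations of \<open>lie_quot\<close> are unions over the members of a coset; when
  an operation is well defined, all sets in the union coincide.\<close>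

lemma Union_cl:
  assumes "\<And>g. g \<in> cl f \<Longrightarrow> cl (F g) = cl (F f)"
  shows "(\<Union>g\<in>cl f. cl (F g)) = cl (F f)"
  using assms cl_self[of f] by blast

lemma Q_simps:
  "carrier Q = cl ` Lie_set X" "\<zero>\<^bsub>Q\<^esub> = cl 0"
  "cl f \<oplus>\<^bsub>Q\<^esub> cl g = cl (f + g)"
  "c \<odot>\<^bsub>Q\<^esub> cl f = cl (pscale c f)"
  "opr Q (cl f) = cl (pop f)"
proof -
  show "carrier Q = cl ` Lie_set X" unfolding lie_quot_def by (auto simp: A_RCOSETS_def')
  have "h \<in> cl 0 \<longleftrightarrow> h \<in> I" for h by (simp add: cl_mem)
  then show "\<zero>\<^bsub>Q\<^esub> = cl 0" unfolding lie_quot_def by auto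
  show "cl f \<oplus>\<^bsub>Q\<^esub> cl g = cl (f + g)"
  proof -
    have "h \<in> set_add (Lie X) (cl f) (cl g) \<longleftrightarrow> h \<in> cl (f + g)" for h
    proof
      assume "h \<in> set_add (Lie X) (cl f) (cl g)"
      then obtain f' g' where "f' - f \<in> I" "g' - g \<in> I" "h = f' + g'"
        by (auto simp: set_add_def' cl_mem)
      then show "h \<in> cl (f + g)" using D(3)[of "f' - f" "g' - g"] by (simp add: cl_mem algebra_simps)
    next
      assume "h \<in> cl (f + g)"
      then have "h - g \<in> cl f" by (simp add: cl_mem algebra_simps)
      then show "h \<in> set_add (Lie X) (cl f) (cl g)"
        unfolding set_add_def' using cl_self[of g] by (intro UN_I[of "h - g"] UN_I[of g]) simp_all
    qed
    then show ?thesis by (auto simp: lie_quot_def)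
  qed
  show "c \<odot>\<^bsub>Q\<^esub> cl f = cl (pscale c f)"
  proof -
    have "cl (pscale c g) = cl (pscale c f)" if "g \<in> cl f" for g
      using D(4)[of "g - f" c] that unfolding cl_eq by (simp add: cl_mem pscale_distribs)
    then have "(\<Union>g\<in>cl f. cl (pscale c g)) = cl (pscale c f)" by (rule Union_cl)
    then show ?thesis by (simp add: lie_quot_def del: UN_simps)
  qed
  show "opr Q (cl f) = cl (pop f)"
  proof -
    have "cl (pop g) = cl (pop f)" if "g \<in> cl f" for g
      using D(6)[of "g - f"] that unfolding cl_eq by (simp add: cl_mem pop_diff)
    then have "(\<Union>g\<in>cl f. cl (pop g)) = cl (pop f)" by (rule Union_cl)
    then show ?thesis by (simp add: lie_quot_def del: UN_simps)
  qed
qed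

text \<open>In contrast to \<open>Q_simps\<close>, membership in \<open>Lie_set X\<close> enters:
  the ideal absorbs commutators with Lie polynomials only.\<close>

lemma Q_mult: "f \<in> Lie_set X \<Longrightarrow> g \<in> Lie_set X \<Longrightarrow> cl f \<otimes>\<^bsub>Q\<^esub> cl g = cl (pcomm f g)"
proof -
  assume f: "f \<in> Lie_set X" and g: "g \<in> Lie_set X"
  have eq: "cl (pcomm f' g') = cl (pcomm f g)" if f': "f' \<in> cl f" and g': "g' \<in> cl g" for f' g'
  proof -
    have "pcomm (f' - f) g' \<in> I" "pcomm f (g' - g) \<in> I"
      using D(7)[OF cl_Lie_set[OF g g']] D(5)[OF f] f' g' by (simp_all add: cl_mem)
    from D(3)[OF this] show ?thesis unfolding cl_eq by (simp add: pcomm_distribs)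
  qed
  have "cl f \<otimes>\<^bsub>Q\<^esub> cl g = (\<Union>f'\<in>cl f. \<Union>g'\<in>cl g. cl (pcomm f' g'))"
    by (simp add: lie_quot_def rcoset_mult_def)
  also have "\<dots> = cl (pcomm f g)" using eq cl_self[of f] cl_self[of g] by blast
  finally show ?thesis .
qed

lemma lie_op_algebra_Q: "lie_op_algebra Q"
proof (intro lie_op_algebra.intro lie_op_algebra_axioms.intro moduleI abelian_groupI)
  fix x assume "x \<in> carrier Q"
  then obtain f where "x = cl f" "f \<in> Lie_set X" by (auto simp: Q_simps)
  then show "\<exists>y\<in>carrier Q. y \<oplus>\<^bsub>Q\<^esub> x = \<zero>\<^bsub>Q\<^esub>"
    by (intro bexI[of _ "cl (- f)"]) (auto simp: Q_simps intro: Lie_uminus)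
next
  fix x y z assume "x \<in> carrier Q" "y \<in> carrier Q" "z \<in> carrier Q"
  then obtain f g h where "x = cl f" "f \<in> Lie_set X" "y = cl g" "g \<in> Lie_set X" "z = cl h" "h \<in> Lie_set X"
    by (auto simp: Q_simps)
  then show "x \<otimes>\<^bsub>Q\<^esub> (y \<otimes>\<^bsub>Q\<^esub> z) \<oplus>\<^bsub>Q\<^esub> y \<otimes>\<^bsub>Q\<^esub> (z \<otimes>\<^bsub>Q\<^esub> x) \<oplus>\<^bsub>Q\<^esub> z \<otimes>\<^bsub>Q\<^esub> (x \<otimes>\<^bsub>Q\<^esub> y) = \<zero>\<^bsub>Q\<^esub>"
    by (simp add: Q_simps Q_mult Lie_comm pcomm_jacobi)
qed (auto intro!: cring_from_type_algebra imageI Lie_set.intros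
  simp: Q_simps Q_mult Lie_add Lie_scale Lie_comm Lie_op
    PV.scale_right_distrib PV.scale_left_distrib pcomm_distribs pop_distribs ac_simps)

end

section \<open>The modified Rota-Baxter Lie algebra\<close>

lemma f_B_eq: "f_B lam u v = rb_rel lam (lie_poly (bracket u)) (lie_poly (bracket v))"
  by (simp add: f_B_def rb_defs Let_def pop_add)

lemma rb_rel_in_Lie_set: "f \<in> Lie_set X \<Longrightarrow> g \<in> Lie_set X \<Longrightarrow> rb_rel lam f g \<in> Lie_set X"
  unfolding rb_defs by (intro Lie_diff Lie_add Lie_scale Lie_comm Lie_op)

lemma S_B_Lie_set: "S_B lam X \<subseteq> Lie_set X"
  unfolding S_B_def f_B_eq by (auto intro!: rb_rel_in_Lie_set lie_poly_in_Lie_set)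

lemma lie_ideal_Id_B: "lie_ideal X (Id_B lam X)"
  unfolding Id_B_def by (rule lie_ideal_generated[OF S_B_Lie_set])

lemma S_B_Id_B: "S_B lam X \<subseteq> Id_B lam X"
  unfolding Id_B_def by (rule lie_ideal_generated[OF S_B_Lie_set])

lemma Id_B_least: "lie_ideal X I \<Longrightarrow> S_B lam X \<subseteq> I \<Longrightarrow> Id_B lam X \<subseteq> I"
  unfolding Id_B_def by (rule lie_ideal_generated(3)[OF S_B_Lie_set])

interpretation B: lie_ideal_quot X "Id_B lam X" for X and lam
  by unfold_locales (rule lie_ideal_Id_B)

lemma Lie_set_coordinates: "f \<in> Lie_set X \<Longrightarrow> \<exists>c. supp c \<subseteq> ALSW X \<and> f = lyn_comb c"
proof -
  assume "f \<in> Lie_set X"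
  then have "f \<in> lspan (Lie X) ((\<lambda>w. nword_ev (Lie X) pgen (bracket w)) ` ALSW X)"
    using Lie_set_lyn_span unfolding lyn_span_def by blast
  then show ?thesis
  proof (induction rule: lspan.induct)
    case lspan_zero
    show ?case by (intro exI[of _ 0]) (simp add: lin_ext_def)
  next
    case (lspan_step b f a)
    then obtain c w where c: "supp c \<subseteq> ALSW X" "f = lyn_comb c" and w: "w \<in> ALSW X" "b = lie_poly (bracket w)"
      by (auto simp: nword_ev_Lie lie_poly_def)
    then show ?case
      by (intro exI[of _ "Poly_Mapping.single w a + c"] conjI supp_add_subset supp_single_subset)
        (simp_all add: lin_ext_add lin_ext_single)
  qed
qed

lemma lin_ext_linear:
  assumes "\<And>f g. G (f + g) = G f + G g" "\<And>c f. G (pscale c f) = pscale c (G f)"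
  shows "G (lin_ext F c) = lin_ext (\<lambda>w. G (F w)) c"
proof -
  have "additive G" by (simp add: additive_def assms(1))
  then show ?thesis by (simp add: lin_ext_def additive.sum assms(2))
qed

text \<open>\<open>S_B\<close> has only pairs of bracketings with \<open>v < u\<close>; antisymmetry
  adds the other pairs, and bilinearity passes to all of \<open>Lie_set X\<close> by coordinates.
  Modulo the ideal this is the modified Rota-Baxter identity.\<close>

lemma rb_rel_in_Id_B:
  assumes f: "f \<in> Lie_set X" and g: "g \<in> Lie_set X" shows "rb_rel lam f g \<in> Id_B lam X"
proof -
  have words: "rb_rel lam (lie_poly (bracket u)) (lie_poly (bracket v)) \<in> Id_B lam X"
    if u: "u \<in> ALSW X" and v: "v \<in> ALSW X" for u v
  proof -
    have S: "rb_rel lam (lie_poly (bracket x)) (lie_poly (bracket y)) \<in> Id_B lam X"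
      if "x \<in> ALSW X" "y \<in> ALSW X" "Dl_less y x" for x y
    proof -
      have "f_B lam x y \<in> S_B lam X" unfolding S_B_def using that by blast
      then show ?thesis using S_B_Id_B unfolding f_B_eq by blast
    qed
    consider "u = v" | "Dl_less v u" | "Dl_less u v"
      using Dl_less_total[OF ALSW_over[OF u] ALSW_over[OF v]] by blast
    then show ?thesis
    proof cases
      case 1
      then show ?thesis using B.D(2) by simp
    next
      case 2
      then show ?thesis by (rule S[OF u v])
    next
      case 3
      have "- rb_rel lam (lie_poly (bracket v)) (lie_poly (bracket u)) \<in> Id_B lam X"
        by (rule B.D(9)[OF S[OF v u 3]])
      then show ?thesis using rb_rel_swap[of lam "lie_poly (bracket u)" "lie_poly (bracket v)"] by simp
    qed
  qed
  obtain c d where c: "supp c \<subseteq> ALSW X" "f = lyn_comb c" and d: "supp d \<subseteq> ALSW X" "g = lyn_comb d"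
    using Lie_set_coordinates f g by metis
  have "rb_rel lam (lie_poly (bracket u)) g \<in> Id_B lam X" if u: "u \<in> ALSW X" for u
    unfolding d(2) lin_ext_linear[of "rb_rel lam (lie_poly (bracket u))", OF rb_rel_add_right rb_rel_pscale_right]
    by (rule lin_ext_in) (use B.D words[OF u] d(1) in auto)
  then show ?thesis
    unfolding c(2) lin_ext_linear[of "\<lambda>f. rb_rel lam f g", OF rb_rel_add_left rb_rel_pscale_left]
    by (intro lin_ext_in) (use B.D c(1) in auto)
qed

lemma MRBL_class_eq: "MRBL_class lam X f = B.cl X lam f"
  by (simp add: MRBL_class_def)

lemma modified_RB_MRBL: "modified_RB_lie_algebra lam (MRBL lam X)"
proof (intro modified_RB_lie_algebra.intro modified_RB_lie_algebra_axioms.intro)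
  show "lie_op_algebra (MRBL lam X)" unfolding MRBL_def by (rule B.lie_op_algebra_Q)
  fix x y assume "x \<in> carrier (MRBL lam X)" "y \<in> carrier (MRBL lam X)"
  then obtain f g where fg: "x = B.cl X lam f" "f \<in> Lie_set X" "y = B.cl X lam g" "g \<in> Lie_set X"
    unfolding MRBL_def by (auto simp: B.Q_simps)
  have "pcomm (pop f) (pop g) - (pop (pcomm (pop f) g) + pop (pcomm f (pop g)) + pscale lam (pcomm f g))
      = rb_rel lam f g"
    by (simp add: rb_defs pop_add)
  then have "B.cl X lam (pcomm (pop f) (pop g))
      = B.cl X lam (pop (pcomm (pop f) g) + pop (pcomm f (pop g)) + pscale lam (pcomm f g))"
    using rb_rel_in_Id_B[OF fg(2,4), of lam] unfolding B.cl_eq by simp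
  then show "opr (MRBL lam X) x \<otimes>\<^bsub>MRBL lam X\<^esub> opr (MRBL lam X) y
    = opr (MRBL lam X) (opr (MRBL lam X) x \<otimes>\<^bsub>MRBL lam X\<^esub> y) \<oplus>\<^bsub>MRBL lam X\<^esub>
      opr (MRBL lam X) (x \<otimes>\<^bsub>MRBL lam X\<^esub> opr (MRBL lam X) y) \<oplus>\<^bsub>MRBL lam X\<^esub> lam \<odot>\<^bsub>MRBL lam X\<^esub> (x \<otimes>\<^bsub>MRBL lam X\<^esub> y)"
    unfolding MRBL_def fg(1,3) using fg(2,4) by (simp add: B.Q_simps B.Q_mult Lie_op Lie_comm)
qed

section \<open>The universal property\<close>

lemma lie_op_homD:
  assumes "h \<in> lie_op_hom L M" "x \<in> carrier L"
  shows "h x \<in> carrier M" "y \<in> carrier L \<Longrightarrow> h (x \<oplus>\<^bsub>L\<^esub> y) = h x \<oplus>\<^bsub>M\<^esub> h y"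
    "h (c \<odot>\<^bsub>L\<^esub> x) = c \<odot>\<^bsub>M\<^esub> h x" "y \<in> carrier L \<Longrightarrow> h (x \<otimes>\<^bsub>L\<^esub> y) = h x \<otimes>\<^bsub>M\<^esub> h y"
    "h (opr L x) = opr M (h x)"
  using assms by (auto simp: lie_op_hom_def)

text \<open>The kernel is an ideal, and it contains \<open>S_B\<close> because the target satisfies
  the identity from which these relations are made.\<close>

lemma (in modified_RB_lie_algebra) hom_kills_Id_B:
  assumes h: "h \<in> lie_op_hom (Lie X) L" and f: "f \<in> Id_B lam X"
  shows "h f = \<zero>"
proof -
  note H = lie_op_homD[OF h, simplified]
  have H0: "h 0 = \<zero>" using H(3)[OF Lie_zero, of 0] smult_0[OF H(1)[OF Lie_zero]] by simp
  let ?K = "{f \<in> Lie_set X. h f = \<zero>}"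
  have "lie_ideal X ?K"
    unfolding lie_ideal_def
  proof (intro conjI ballI allI)
    show "pop f \<in> ?K" if "f \<in> ?K" for f
      using that H(5)[of f] H(5)[OF Lie_zero] H0 Lie_op[of f X] by simp
  qed (use H H0 smult_zero bracket_zero_right in \<open>auto intro: Lie_set.intros\<close>)
  moreover have "S_B lam X \<subseteq> ?K"
  proof
    fix s assume "s \<in> S_B lam X"
    then obtain u v where s: "s = rb_rel lam u v" and uv: "u \<in> Lie_set X" "v \<in> Lie_set X"
      unfolding S_B_def f_B_eq using lie_poly_in_Lie_set by blast
    let ?r = "pop (pcomm (pop u) v) + pop (pcomm u (pop v)) + pscale lam (pcomm u v)"
    have r: "?r \<in> Lie_set X" "pcomm (pop u) (pop v) \<in> Lie_set X"
      by (intro Lie_add Lie_scale Lie_comm Lie_op uv)+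
    have "s = pcomm (pop u) (pop v) + pscale (- 1) ?r"
      unfolding s by (simp add: rb_defs pop_add PV.scale_minus_left)
    then have "h s = h (pcomm (pop u) (pop v)) \<oplus> (- 1) \<odot> h ?r"
      using H(2)[OF r(2) Lie_scale[OF r(1)], of "- 1"] H(3)[OF r(1), of "- 1"] by simp
    moreover have "h (pcomm (pop u) (pop v)) = h ?r"
      using uv modified_RB[OF H(1)[OF uv(1)] H(1)[OF uv(2)]]
      by (simp add: H Lie_set.intros)
    ultimately have "h s = h ?r \<oplus> \<ominus> h ?r"
      using smult_uminus[OF H(1)[OF r(1)], of 1] smult_1[OF H(1)[OF r(1)]] by simp
    then have "h s = \<zero>" using M.r_neg[OF H(1)[OF r(1)]] by simp
    moreover have "s \<in> Lie_set X" unfolding s by (rule rb_rel_in_Lie_set[OF uv])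
    ultimately show "s \<in> ?K" by simp
  qed
  ultimately show ?thesis using Id_B_least f by blast
qed

theorem free_MRBL:
  "free_modified_RB TYPE('b) lam X (\<lambda>x. MRBL_class lam X (pgen x)) (MRBL lam X)"
  unfolding free_modified_RB_def
proof (intro conjI allI impI)
  show "modified_RB_lie_algebra lam (MRBL lam X)" by (rule modified_RB_MRBL)
  show "(\<lambda>x. MRBL_class lam X (pgen x)) \<in> X \<rightarrow> carrier (MRBL lam X)"
    unfolding MRBL_def MRBL_class_eq B.Q_simps by (auto intro: Lie_gen)
  fix A :: "('a, 'b) lie_op" and \<phi>
  assume "modified_RB_lie_algebra lam A \<and> \<phi> \<in> X \<rightarrow> carrier A"
  then have A: "modified_RB_lie_algebra lam A" and \<phi>: "\<phi> \<in> X \<rightarrow> carrier A" by auto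
  interpret A: modified_RB_lie_algebra lam A by (rule A)
  define h0 where "h0 = A.lift_hom X \<phi>"
  have h0: "h0 \<in> lie_op_hom (Lie X) A" unfolding h0_def by (rule A.lift_hom_hom[OF \<phi>])
  note H = lie_op_homD[OF h0, simplified]
  \<comment> \<open>\<open>h0\<close> is constant on cosets since it kills the ideal, so any
    representative gives the induced map.\<close>
  define h where "h C = h0 (SOME f. f \<in> C)" for C
  have h_cl: "h (B.cl X lam f) = h0 f" if f: "f \<in> Lie_set X" for f
  proof -
    define g where "g = (SOME g. g \<in> B.cl X lam f)"
    have g: "g \<in> B.cl X lam f" unfolding g_def by (rule someI[of "\<lambda>g. g \<in> B.cl X lam f", OF B.cl_self])
    then have gf: "g - f \<in> Id_B lam X" by (simp add: B.cl_mem)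
    have "h0 ((g - f) + f) = h0 (g - f) \<oplus>\<^bsub>A\<^esub> h0 f"
      by (rule H(2)[OF B.D(1)[OF gf] f])
    then have "h0 g = h0 f" using A.hom_kills_Id_B[OF h0 gf] H(1)[OF f] by simp
    then show ?thesis by (simp add: h_def g_def)
  qed
  have hom: "h \<in> lie_op_hom (MRBL lam X) A"
    unfolding lie_op_hom_def MRBL_def B.Q_simps(1)
    by (auto simp: B.Q_simps B.Q_mult h_cl H Lie_set.intros)
  have gens: "\<forall>x\<in>X. h (MRBL_class lam X (pgen x)) = \<phi> x"
    unfolding MRBL_class_eq using h_cl[OF Lie_gen] A.lift_hom_gen[OF \<phi>] by (simp add: h0_def)
  have unique: "\<forall>a\<in>carrier (MRBL lam X). h' a = h a"
    if h': "h' \<in> lie_op_hom (MRBL lam X) A" and g': "\<forall>x\<in>X. h' (MRBL_class lam X (pgen x)) = \<phi> x" for h'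
  proof -
    note H' = lie_op_homD[OF h', unfolded MRBL_def B.Q_simps(1), OF imageI]
    have "h' (B.cl X lam f) = h (B.cl X lam f)" if "f \<in> Lie_set X" for f
      using that
    proof (induction rule: Lie_set.induct)
      case (Lie_gen x)
      then show ?case using g' gens by (simp add: MRBL_class_eq)
    next
      case Lie_zero
      have z: "g (B.cl X lam 0) = \<zero>\<^bsub>A\<^esub>" if "g \<in> lie_op_hom (MRBL lam X) A" for g
      proof -
        note G = lie_op_homD[OF that, unfolded MRBL_def B.Q_simps(1), OF imageI, OF Lie_set.Lie_zero]
        show ?thesis using G(3)[of 0] A.smult_0[OF G(1)] by (simp add: B.Q_simps)
      qed
      show ?case using z[OF h'] z[OF hom] by simp
    next
      case (Lie_add f g)
      then show ?case using H'(2)[OF Lie_add(1) imageI[OF Lie_add(2)]]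
        by (simp add: B.Q_simps h_cl H Lie_set.intros)
    next
      case (Lie_scale f c)
      then show ?case using H'(3)[OF Lie_scale(1), of c]
        by (simp add: B.Q_simps h_cl H Lie_set.intros)
    next
      case (Lie_comm f g)
      then show ?case using H'(4)[OF Lie_comm(1) imageI[OF Lie_comm(2)]]
        by (simp add: B.Q_mult h_cl H Lie_set.intros)
    next
      case (Lie_op f)
      then show ?case using H'(5)[OF Lie_op(1)]
        by (simp add: B.Q_simps h_cl H Lie_set.intros)
    qed
    then show ?thesis unfolding MRBL_def B.Q_simps(1) by blast
  qed
  show "\<exists>h\<in>lie_op_hom (MRBL lam X) A. (\<forall>x\<in>X. h (MRBL_class lam X (pgen x)) = \<phi> x) \<and>
      (\<forall>h'\<in>lie_op_hom (MRBL lam X) A. (\<forall>x\<in>X. h' (MRBL_class lam X (pgen x)) = \<phi> x) \<longrightarrow>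
        (\<forall>a\<in>carrier (MRBL lam X). h' a = h a))"
    using hom gens unique by blast
qed

section \<open>Reducible words\<close>

lemma star_count_lift [simp]: "star_count_prm (map_prm Some p) = 0"
proof (induction p)
  case (Op u)
  then have "sum_list (map star_count_prm (lift_word u)) = 0" by (induction u) auto
  then show ?case by simp
qed simp

lemma word_over_lift: "word_over X a \<Longrightarrow> word_over (insert None (Some ` X)) (lift_word a)"
proof -
  have "prm_over X p \<Longrightarrow> prm_over (insert None (Some ` X)) (map_prm Some p)" for p
    by (induction p) (auto simp: word_over_def)
  then show "word_over X a \<Longrightarrow> word_over (insert None (Some ` X)) (lift_word a)"
    by (auto simp: word_over_def)
qed

lemma star_words_iff: "\<pi> \<in> star_words X \<longleftrightarrow> \<pi> \<noteq> [] \<and> word_over (insert None (Some ` X)) \<pi> \<and>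
    sum_list (map star_count_prm \<pi>) = 1"
  by (auto simp: star_words_def omega_words_iff)

lemma star_words_context:
  assumes "\<pi> \<in> star_words X" "word_over X a" "word_over X b"
  shows "lift_word a @ \<pi> @ lift_word b \<in> star_words X"
    "plug (lift_word a @ \<pi> @ lift_word b) w = a @ plug \<pi> w @ b"
  using assms by (auto simp: star_words_iff word_over_lift plug_def)

lemma star_words_star: "[star] \<in> star_words X" "plug [star] w = w"
  by (auto simp: star_words_iff plug_def)

lemma star_words_Op:
  assumes "\<pi> \<in> star_words X" shows "[Op \<pi>] \<in> star_words X" "plug [Op \<pi>] w = [Op (plug \<pi> w)]"
  using assms by (auto simp: star_words_iff plug_def)

text \<open>The words \<open>u\<close>, \<open>v\<close> of a redex are arguments of P in
  \<open>w\<close>; the hypothesis on the letters of \<open>w\<close> makes them Lyndon-Shirshov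
  words over \<open>X\<close>, although the relations range over all words.\<close>

lemma rel_imp_reducible:
  "rel lam w g \<Longrightarrow> \<forall>p\<in>set w. prm_lyn X p \<Longrightarrow>
    \<exists>\<pi>\<in>star_words X. \<exists>u\<in>ALSW X. \<exists>v\<in>ALSW X. Dl_less v u \<and> w = plug \<pi> [Op u, Op v]"
  and lrel_imp_reducible:
  "lrel lam l g \<Longrightarrow> \<forall>p\<in>set l. prm_lyn X p \<Longrightarrow>
    \<exists>\<pi>\<in>star_words X. \<exists>u\<in>ALSW X. \<exists>v\<in>ALSW X. Dl_less v u \<and> l = plug \<pi> [Op u, Op v]"
proof (induction rule: rel_lrel.inducts)
  case (rel_ctx l f a b)
  then obtain \<pi> u v where p: "\<pi> \<in> star_words X" "u \<in> ALSW X" "v \<in> ALSW X" "Dl_less v u" "l = plug \<pi> [Op u, Op v]"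
    by auto
  have "word_over X a" "word_over X b"
    using rel_ctx.prems by (auto simp: word_over_def intro: prm_lyn_over)
  note c = star_words_context[OF p(1) this]
  show ?case
    by (rule bexI[OF _ c(1)], rule bexI[OF _ p(2)], rule bexI[OF _ p(3)]) (simp add: c(2) p)
next
  case (lrel_rb u v)
  then have "u \<in> ALSW X" "v \<in> ALSW X" by (simp_all add: ALSW_iff)
  then show ?case using lrel_rb(3) star_words_star by metis
next
  case (lrel_op w f)
  then have "\<forall>p\<in>set w. prm_lyn X p" by simp
  then obtain \<pi> u v where p: "\<pi> \<in> star_words X" "u \<in> ALSW X" "v \<in> ALSW X" "Dl_less v u" "w = plug \<pi> [Op u, Op v]"
    using lrel_op.IH by blast
  note c = star_words_Op[OF p(1)]
  show ?case
    by (rule bexI[OF _ c(1)], rule bexI[OF _ p(2)], rule bexI[OF _ p(3)]) (simp add: c(2) p)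
qed

text \<open>The place of the star is found by descending through letters with nonzero star count,
  and the relation at \<open>P(u)P(v)\<close> is carried back up by contexts and P.\<close>

lemma reducible_imp_rel:
  assumes "\<pi> \<in> star_words X" "u \<in> ALSW X" "v \<in> ALSW X" "Dl_less v u"
  shows "\<exists>g. rel lam (plug \<pi> [Op u, Op v]) g"
proof -
  let ?\<tau> = "case_option [Op u, Op v] gen_word"
  have word: "\<exists>g. rel lam (subst_word ?\<tau> \<pi>) g"
    if h: "\<And>p. p \<in> set \<pi> \<Longrightarrow> star_count_prm p \<ge> 1 \<Longrightarrow> \<exists>g. rel lam (subst_prm ?\<tau> p) g"
      and s: "sum_list (map star_count_prm \<pi>) \<ge> 1" for \<pi>
  proof -
    obtain p where p: "p \<in> set \<pi>" "star_count_prm p \<ge> 1"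
      using s by (induction \<pi>) (auto simp: Suc_le_eq)
    obtain a b where ab: "\<pi> = a @ p # b" using split_list[OF p(1)] by blast
    obtain g where "rel lam (subst_prm ?\<tau> p) g" using h[OF p] by blast
    from rel_in_ctx[OF this, of "subst_word ?\<tau> a" "subst_word ?\<tau> b"] show ?thesis
      unfolding ab by auto
  qed
  have prm: "star_count_prm p \<ge> 1 \<Longrightarrow> \<exists>g. rel lam (subst_prm ?\<tau> p) g" for p
  proof (induction p)
    case (Gen y)
    then have "y = None" by (auto split: if_splits)
    then show ?case
      using lrel_rel[OF lrel_rb[OF ALSW_omega_UNIV[OF assms(2)] ALSW_omega_UNIV[OF assms(3)] assms(4)]] by auto
  next
    case (Op w)
    then have "\<exists>g. rel lam (subst_word ?\<tau> w) g" by (intro word) simp_all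
    then show ?case using rel_pop by auto
  qed
  show ?thesis
    unfolding plug_def by (rule word[OF prm]) (use assms(1) in \<open>simp_all add: star_words_iff\<close>)
qed

section \<open>From relations of the envelope to elements of the Lie ideal\<close>

lemma lie_ideal_left_normed:
  assumes "lie_ideal X I" "f \<in> I" "set ds \<subseteq> ALSW X"
  shows "foldl pcomm f (map (\<lambda>d. lie_poly (bracket d)) ds) \<in> I"
  using assms(2,3)
  by (induction ds arbitrary: f) (auto intro: lie_idealD[OF assms(1)] lie_poly_in_Lie_set)

text \<open>
  If \<open>pq\<close> with \<open>p \<succ> q\<close> is cut by the standard bracketing at some node, then the left factor at this node
  is \<open>p\<close>, since otherwise the right factor could be extended by \<open>p\<close>.
\<close>

lemma ideal_lead_tree:
  assumes I: "lie_ideal X I" and k: "k \<in> I" "has_lead k l"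
    and l: "l = [p] \<or> (\<exists>q. l = [p, q] \<and> prm_less q p)"
  shows "is_nlsw prm_gt {p. prm_over UNIV p} t \<Longrightarrow> underlying t \<in> ALSW X \<Longrightarrow> underlying t = a @ l @ b \<Longrightarrow>
    \<exists>h\<in>I. has_lead h (underlying t)"
proof (induction t arbitrary: a b)
  case (Letter z)
  then have "l = [z]" using l by (auto simp: Cons_eq_append_conv)
  then show ?case using k by auto
next
  case (Br s t)
  let ?s = "underlying s" and ?t = "underlying t"
  have ne: "?s \<noteq> []" "?t \<noteq> []" by (rule PO.underlying_not_Nil)+
  have n: "is_nlsw prm_gt {p. prm_over UNIV p} s" "is_nlsw prm_gt {p. prm_over UNIV p} t"
    using Br.prems(1) by auto
  have sub: "?s \<in> ALSW X" "?t \<in> ALSW X"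
    using ALSW_letters[OF _ _ Br.prems(2)] PO.is_nlsw_lyndon[OF n(1)] PO.is_nlsw_lyndon[OF n(2)] by auto
  have rot: "Dl_less (?t @ ?s) (?s @ ?t)"
    using Dl_less_rotation[OF _ ne] ALSW_lyndon[OF Br.prems(2)] by simp
  \<comment> \<open>If \<open>l\<close> lies inside one factor, the commutator of the element found
    there with the bracketing of the other factor has leading word \<open>st\<close>.\<close>
  have left: ?case if ex: "\<exists>h\<in>I. has_lead h ?s"
  proof -
    obtain h where h: "h \<in> I" "has_lead h ?s" using ex by blast
    have "pcomm h (lie_poly (bracket ?t)) \<in> I"
      by (rule lie_idealD(7)[OF I lie_poly_in_Lie_set[OF sub(2)] h(1)])
    moreover have "has_lead (pcomm h (lie_poly (bracket ?t))) (?s @ ?t)"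
      by (rule has_lead_pcomm[OF h(2) has_lead_lie_poly[OF sub(2)] rot])
    ultimately show ?thesis by auto
  qed
  have right: ?case if ex: "\<exists>h\<in>I. has_lead h ?t"
  proof -
    obtain h where h: "h \<in> I" "has_lead h ?t" using ex by blast
    have "pcomm (lie_poly (bracket ?s)) h \<in> I"
      by (rule lie_idealD(5)[OF I lie_poly_in_Lie_set[OF sub(1)] h(1)])
    moreover have "has_lead (pcomm (lie_poly (bracket ?s)) h) (?s @ ?t)"
      by (rule has_lead_pcomm[OF has_lead_lie_poly[OF sub(1)] h(2) rot])
    ultimately show ?thesis by auto
  qed
  have eq: "?s @ ?t = a @ (l @ b)" using Br.prems(3) by simp
  from append_eq_append_cases[OF eq] show ?case
  proof (elim disjE exE conjE)
    fix c assume "?t = c @ l @ b"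
    then show ?thesis by (rule right[OF Br.IH(2)[OF n(2) sub(2)]])
  next
    fix c assume c: "c \<noteq> []" "?s = a @ c" "l @ b = c @ ?t"
    from append_eq_append_cases[OF c(3)] show ?thesis
    proof (elim disjE exE conjE)
      fix d assume "c = l @ d"
      then show ?thesis using left[OF Br.IH(1)[OF n(1) sub(1), of a d]] c(2) by simp
    next
      fix d assume d: "d \<noteq> []" "l = c @ d" "?t = d @ b"
      have "length l \<noteq> 1" using d(1,2) c(1) by (cases c; cases d) simp_all
      then obtain q where q0: "l = [p, q]" "prm_less q p" using l by auto
      have cd: "c = [p]" "d = [q]" using d(1,2) c(1) q0(1) by (cases c; cases "tl c"; simp)+
      note q = q0 cd
      have "a = []"
      proof (rule ccontr)
        assume a: "a \<noteq> []"
        have m: "PO.max_suffix ?t (?s @ ?t)" using PO.nlsw_max_suffix[OF Br.prems(1)] by simp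
        have "PO.proper_suffix (p # ?t) (?s @ ?t)"
          unfolding PO.proper_suffix_def using a c(2) q(3) by (auto intro!: exI[of _ a])
        then have "lex_le prm_gt (p # ?t) ?t" using m unfolding PO.max_suffix_def by blast
        then have "\<not> lex_gt prm_gt (p # ?t) ?t" by (rule PO.lex_le_imp_not_gt)
        moreover have "lex_gt prm_gt (p # ?t) ?t" unfolding d(3) using q by simp
        ultimately show False by blast
      qed
      then have w: "underlying (Br s t) = [p, q] @ b" using c(2) d(3) q by simp
      have "lyndon prm_gt ([p] @ [q])" by (rule PO.lyndon_append) (use q in simp_all)
      moreover have "set [p, q] \<subseteq> set (underlying (Br s t))" unfolding w by simp
      ultimately have pq: "[p, q] \<in> ALSW X" using ALSW_letters[OF _ _ Br.prems(2)] by simp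
      have wA: "[p, q] @ b \<in> ALSW X" using Br.prems(2) w by simp
      \<comment> \<open>The word now begins with \<open>l\<close>, so the letters after it are
        attached through their Lyndon factors, as in a special normal word.\<close>
      let ?h = "foldl pcomm k (map (\<lambda>d. lie_poly (bracket d)) (lyndon_factors X b))"
      have "has_lead ?h ([p, q] @ b)"
        by (rule has_lead_left_normed[OF _ pq wA]) (use k(2) q in simp)
      moreover have "\<forall>p\<in>set b. prm_lyn X p" using wA by (auto simp: ALSW_iff)
      then have "?h \<in> I" by (intro lie_ideal_left_normed[OF I k(1)] lyndon_factors_spec)
      ultimately show ?thesis unfolding w by blast
    qed
  qed
qed

lemma deg_bound_pcomm:
  "has_lead f u \<Longrightarrow> has_lead g v \<Longrightarrow> \<forall>x\<in>supp (pcomm f g). deg x \<le> deg u + deg v"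
  by (rule supp_deg_le) (auto dest: has_leadD Dl_less_deg_le)

text \<open>The lower terms are controlled by degree alone: those below P have breadth 1 and at most
  the degree of \<open>P(u)P(v)\<close>, and the words of \<open>pcomm f g\<close> have at least two
  degrees less.\<close>

lemma has_lead_rb_rel_poly:
  assumes f: "has_lead f u" and g: "has_lead g v" and vu: "Dl_less v u"
  shows "has_lead (rb_rel lam f g) [Op u, Op v]"
proof -
  have "has_lead (pcomm (pop f) (pop g)) ([Op u] @ [Op v])"
    using Dl_less_pair[OF vu, of u v] by (intro has_lead_pcomm has_lead_pop f g) simp
  moreover have "below (pop (rb_circ f g)) [Op u, Op v]"
    unfolding below_def
  proof
    fix x assume "x \<in> supp (pop (rb_circ f g))"
    then obtain y where y: "x = [Op y]" "y \<in> supp (rb_circ f g)" using supp_pop[of "rb_circ f g"] by blast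
    then have "y \<in> supp (pcomm (pop f) g) \<or> y \<in> supp (pcomm f (pop g))"
      using keys_add[of "pcomm (pop f) g" "pcomm f (pop g)"] unfolding rb_circ_def by blast
    then have "deg y \<le> Suc (deg u + deg v)"
      using deg_bound_pcomm[OF has_lead_pop[OF f] g] deg_bound_pcomm[OF f has_lead_pop[OF g]] by auto
    then show "Dl_less x [Op u, Op v]" unfolding y(1) by (auto simp: Dl_less_iff)
  qed
  moreover have "below (pcomm f g) [Op u, Op v]"
    using deg_bound_pcomm[OF f g] by (auto simp: below_def Dl_less_iff)
  ultimately show ?thesis
    unfolding rb_rel_def rb_rhs_def by (auto intro!: has_lead_diff_below below_add below_pscale)
qed

lemma has_lead_f_B:
  "u \<in> ALSW X \<Longrightarrow> v \<in> ALSW X \<Longrightarrow> Dl_less v u \<Longrightarrow> has_lead (f_B lam u v) [Op u, Op v]"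
  unfolding f_B_eq by (intro has_lead_rb_rel_poly has_lead_lie_poly)

text \<open>By induction on the relation: an element of \<open>S_B\<close> at a redex,
  \<open>pop\<close> for an argument, and \<open>ideal_lead_tree\<close> for the associative
  context, which has no direct meaning in a Lie algebra. The shape of \<open>l\<close> is recorded
  because that lemma relies on it.\<close>

lemma rel_imp_ideal_lead:
  "rel lam w g \<Longrightarrow> w \<in> ALSW X \<Longrightarrow> \<exists>h\<in>Id_B lam X. has_lead h w"
  and lrel_imp_ideal_lead:
  "lrel lam l g \<Longrightarrow> \<forall>p\<in>set l. prm_lyn X p \<Longrightarrow> (\<exists>h\<in>Id_B lam X. has_lead h l) \<and>
    (\<exists>p. l = [p] \<or> (\<exists>q. l = [p, q] \<and> prm_less q p))"
proof (induction rule: rel_lrel.inducts)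
  case (rel_ctx l f a b)
  have "\<forall>p\<in>set l. prm_lyn X p" using rel_ctx.prems by (auto simp: ALSW_iff)
  then obtain k p where k: "k \<in> Id_B lam X" "has_lead k l" "l = [p] \<or> (\<exists>q. l = [p, q] \<and> prm_less q p)"
    using rel_ctx.IH by blast
  let ?w = "a @ l @ b"
  have n: "is_nlsw prm_gt {p. prm_over UNIV p} (std_bracket prm_gt ?w)"
    by (rule PO.std_bracket_nlsw[OF ALSW_lyndon[OF rel_ctx.prems] ALSW_set[OF rel_ctx.prems]])
  have u: "underlying (std_bracket prm_gt ?w) = ?w"
    by (rule PO.std_bracket_spec(2)[OF ALSW_lyndon[OF rel_ctx.prems] ALSW_set[OF rel_ctx.prems]])
  show ?case
    using ideal_lead_tree[OF lie_ideal_Id_B k n, of a b] rel_ctx.prems unfolding u by simp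
next
  case (lrel_rb u v)
  then have uv: "u \<in> ALSW X" "v \<in> ALSW X" by (simp_all add: ALSW_iff)
  have "f_B lam u v \<in> Id_B lam X" using S_B_Id_B[of lam X] uv lrel_rb(3) unfolding S_B_def by blast
  moreover have "prm_less (Op v) (Op u)"
    using lrel_rb(3) Dl_less_deg_le[OF lrel_rb(3)] by (auto simp: prm_less_iff)
  ultimately show ?case using has_lead_f_B[OF uv lrel_rb(3), of lam] by blast
next
  case (lrel_op w f)
  then have "w \<in> ALSW X" by (simp add: ALSW_iff)
  then obtain h where h: "h \<in> Id_B lam X" "has_lead h w" using lrel_op.IH by blast
  show ?case using B.D(6)[OF h(1)] has_lead_pop[OF h(2)] by blast
qed

section \<open>Normal forms modulo the ideal\<close>

text \<open>The ideal of the envelope absorbs products with arbitrary polynomials, hence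
  commutators, and is closed under P; its intersection with \<open>Lie_set X\<close> is therefore a
  Lie ideal containing \<open>S_B\<close>.\<close>

lemma Id_B_rel_ideal: "Id_B lam X \<subseteq> rel_ideal lam"
proof -
  have over: "poly_over UNIV f" if "f \<in> Lie_set X" for f :: "('a, 'b) omega_poly"
    using Lie_set_poly_over[OF that] word_over_mono[of X _ UNIV] by (auto simp: poly_over_def)
  have "Id_B lam X \<subseteq> rel_ideal lam \<inter> Lie_set X"
  proof (rule Id_B_least)
    show "lie_ideal X (rel_ideal lam \<inter> Lie_set X)"
      unfolding lie_ideal_def
    proof (intro conjI ballI allI)
      fix a f :: "('a, 'b) omega_poly" assume "a \<in> Lie_set X" "f \<in> rel_ideal lam \<inter> Lie_set X"
      then show "pcomm a f \<in> rel_ideal lam \<inter> Lie_set X"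
        using Lie_comm[of a X f] rel_span_closed(2)[OF rel_ideal_pmul_left[of f lam a] rel_ideal_pmul_right[of f lam a]]
        unfolding pcomm_def by blast
    qed (auto intro: rel_span_closed rel_ideal_pop Lie_set.intros)
    show "S_B lam X \<subseteq> rel_ideal lam \<inter> Lie_set X"
    proof (rule Int_greatest[OF _ S_B_Lie_set])
      show "S_B lam X \<subseteq> rel_ideal lam"
        unfolding S_B_def f_B_eq
        by (auto intro!: rb_rel_in_rel_ideal over lie_poly_in_Lie_set)
    qed
  qed
  then show ?thesis by blast
qed

text \<open>Induction on the leading word, which for Lie polynomials is Lyndon-Shirshov by
  \<open>lyn_comb_lead\<close>. The hypothesis covers all Lie polynomials below \<open>m\<close>,
  zero among them.\<close>

lemma Lie_lead_induct [consumes 1, case_names zero lead]: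
  fixes f :: "('x::wellorder, 'k::field) omega_poly"
  assumes "f \<in> Lie_set X" and "P 0"
    and step: "\<And>f m. f \<in> Lie_set X \<Longrightarrow> m \<in> ALSW X \<Longrightarrow> coef f m \<noteq> 0 \<Longrightarrow>
      \<forall>v\<in>supp f. v = m \<or> Dl_less v m \<Longrightarrow> (\<And>g. g \<in> Lie_set X \<Longrightarrow> below g m \<Longrightarrow> P g) \<Longrightarrow> P f"
  shows "P f"
proof -
  have lead: "\<exists>m\<in>ALSW X. coef f m \<noteq> 0 \<and> (\<forall>v\<in>supp f. v = m \<or> Dl_less v m)"
    if f: "f \<in> Lie_set X" "f \<noteq> 0" for f :: "('x, 'k) omega_poly"
  proof -
    obtain c where c: "supp c \<subseteq> ALSW X" "f = lyn_comb c" using Lie_set_coordinates[OF f(1)] by blast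
    have "c \<noteq> 0" using f(2) c(2) by (auto simp: lin_ext_def)
    from lyn_comb_lead[OF c(1) this] obtain m where "m \<in> supp c" "coef f m = coef c m"
      "\<forall>v\<in>supp f. v = m \<or> Dl_less v m" unfolding c(2) by blast
    moreover from this have "m \<in> ALSW X" "coef c m \<noteq> 0" using c(1) by (auto simp: in_keys_iff)
    ultimately show ?thesis by metis
  qed
  have ind: "\<forall>f. f \<in> Lie_set X \<longrightarrow> below f w \<longrightarrow> P f" for w
  proof (induction w rule: wf_induct_rule[OF wf_Dl_less])
    case (1 w)
    show ?case
    proof (intro allI impI)
      fix f :: "('x, 'k) omega_poly" assume f: "f \<in> Lie_set X" "below f w"
      show "P f"
      proof (cases "f = 0")
        case False
        obtain m where m: "m \<in> ALSW X" "coef f m \<noteq> 0" "\<forall>v\<in>supp f. v = m \<or> Dl_less v m"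
          using lead[OF f(1) False] by blast
        have "Dl_less m w" using f(2) m(2) by (simp add: below_def in_keys_iff)
        then have "P g" if "g \<in> Lie_set X" "below g m" for g using 1[of m] that by simp
        then show ?thesis using step[OF f(1) m] by blast
      qed (use assms(2) in simp)
    qed
  qed
  show ?thesis
  proof (cases "f = 0")
    case False
    obtain m where m: "m \<in> ALSW X" "coef f m \<noteq> 0" "\<forall>v\<in>supp f. v = m \<or> Dl_less v m"
      using lead[OF assms(1) False] by blast
    show ?thesis using step[OF assms(1) m] ind by blast
  qed (use assms(2) in simp)
qed

definition irr_words :: "'x::wellorder set \<Rightarrow> 'x word set" where
  "irr_words X = {w \<in> ALSW X. \<forall>\<pi>\<in>star_words X. \<forall>u\<in>ALSW X. \<forall>v\<in>ALSW X. Dl_less v u \<longrightarrow> w \<noteq> plug \<pi> [Op u, Op v]}"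

lemma Irr_B_eq: "Irr_B X = bracket ` irr_words X"
  unfolding Irr_B_def irr_words_def by blast

text \<open>Whether a relation starts at a word depends on its shape and not on \<open>lam\<close>,
  so the same words are irreducible for every value.\<close>

lemma irr_words_iff: "w \<in> irr_words X \<longleftrightarrow> w \<in> ALSW X \<and> \<not> (\<exists>g. rel lam w g)"
proof
  assume w: "w \<in> irr_words X"
  then have "\<forall>p\<in>set w. prm_lyn X p" by (simp add: irr_words_def ALSW_iff)
  then show "w \<in> ALSW X \<and> \<not> (\<exists>g. rel lam w g)"
    using w rel_imp_reducible[of lam w _ X] unfolding irr_words_def by blast
next
  assume "w \<in> ALSW X \<and> \<not> (\<exists>g. rel lam w g)"
  then show "w \<in> irr_words X"
    using reducible_imp_rel[of _ X _ _ lam] unfolding irr_words_def by blast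
qed

lemma irr_words_ALSW: "irr_words X \<subseteq> ALSW X"
  by (auto simp: irr_words_def)

lemma has_lead_scaled:
  assumes "coef f m \<noteq> 0" "\<forall>v\<in>supp f. v = m \<or> Dl_less v m"
  shows "has_lead (pscale (inverse (coef f m)) f) m"
  using assms supp_pscale[of "inverse (coef f m)" f] by (auto simp: has_lead_def)

text \<open>A nonzero combination has one of its own words as leading word, whereas the leading word
  of a nonzero element of the ideal is reducible.\<close>

lemma irr_independent:
  assumes "supp c \<subseteq> irr_words X" "lyn_comb c \<in> Id_B lam X" shows "c = 0"
proof (rule ccontr)
  assume c: "c \<noteq> 0"
  have cA: "supp c \<subseteq> ALSW X" using assms(1) irr_words_ALSW by blast
  obtain m where m: "m \<in> supp c" "coef (lyn_comb c) m = coef c m" "\<forall>v\<in>supp (lyn_comb c). v = m \<or> Dl_less v m"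
    using lyn_comb_lead[OF cA c] by blast
  have "has_lead (pscale (inverse (coef (lyn_comb c) m)) (lyn_comb c)) m"
    using m by (intro has_lead_scaled) (simp_all add: in_keys_iff)
  moreover have "pscale (inverse (coef (lyn_comb c) m)) (lyn_comb c) \<in> rel_ideal lam"
    using B.D(4)[OF assms(2)] Id_B_rel_ideal by blast
  ultimately have "\<exists>g. rel lam m g" by (rule lead_reducible[rotated])
  then show False using m(1) assms(1) irr_words_iff[of m X lam] by blast
qed

text \<open>The leading term is removed by the bracketing of \<open>m\<close> if \<open>m\<close> is
  irreducible, and by an element of the ideal otherwise.\<close>

lemma irr_spanning:
  "f \<in> Lie_set X \<Longrightarrow> \<exists>c. supp c \<subseteq> irr_words X \<and> f - lyn_comb c \<in> Id_B lam X"
proof (induction rule: Lie_lead_induct)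
  case zero
  show ?case using B.D(2) by (intro exI[of _ 0]) (simp add: lin_ext_def)
next
  case (lead f m)
  show ?case
  proof (cases "m \<in> irr_words X")
    case True
    let ?g = "f - pscale (coef f m) (lie_poly (bracket m))"
    have "?g \<in> Lie_set X" by (intro Lie_diff Lie_scale lie_poly_in_Lie_set lead.hyps)
    moreover have "below ?g m" by (rule has_lead_diff_scaled[OF lead(4) has_lead_lie_poly[OF lead(2)]])
    ultimately obtain c where c: "supp c \<subseteq> irr_words X" "?g - lyn_comb c \<in> Id_B lam X" using lead.IH by blast
    then show ?thesis using True
      by (intro exI[of _ "Poly_Mapping.single m (coef f m) + c"] conjI supp_add_subset supp_single_subset)
        (simp_all add: lin_ext_add lin_ext_single diff_diff_eq)
  next
    case False
    then obtain r where "rel lam m r" using irr_words_iff[of m X lam] lead(2) by blast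
    then obtain h where h: "h \<in> Id_B lam X" "has_lead h m" using rel_imp_ideal_lead lead(2) by blast
    let ?g = "f - pscale (coef f m) h"
    have "?g \<in> Lie_set X" by (intro Lie_diff Lie_scale B.D(1)[OF h(1)] lead.hyps)
    moreover have "below ?g m" by (rule has_lead_diff_scaled[OF lead(4) h(2)])
    ultimately obtain c where c: "supp c \<subseteq> irr_words X" "?g - lyn_comb c \<in> Id_B lam X" using lead.IH by blast
    have "(?g - lyn_comb c) + pscale (coef f m) h \<in> Id_B lam X"
      by (rule B.D(3)[OF c(2) B.D(4)[OF h(1)]])
    then show ?thesis using c(1) by (intro exI[of _ c]) (simp add: algebra_simps)
  qed
qed

lemma (in lie_ideal_quot) finsum_cl:
  assumes "finite F" "\<And>j. j \<in> F \<Longrightarrow> b j \<in> Lie_set X"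
  shows "(\<Oplus>\<^bsub>Q\<^esub>j\<in>F. c j \<odot>\<^bsub>Q\<^esub> cl (b j)) = cl (\<Sum>j\<in>F. pscale (c j) (b j))"
proof -
  interpret Q: lie_op_algebra Q by (rule lie_op_algebra_Q)
  show ?thesis
    using assms
  proof (induction rule: finite_induct)
    case empty
    show ?case by (simp add: Q_simps)
  next
    case (insert j F)
    have car: "c i \<odot>\<^bsub>Q\<^esub> cl (b i) \<in> carrier Q" if "i \<in> insert j F" for i
      unfolding Q_simps using insert.prems[OF that] by (auto intro: Lie_scale)
    have "(\<Oplus>\<^bsub>Q\<^esub>i\<in>insert j F. c i \<odot>\<^bsub>Q\<^esub> cl (b i))
        = c j \<odot>\<^bsub>Q\<^esub> cl (b j) \<oplus>\<^bsub>Q\<^esub> (\<Oplus>\<^bsub>Q\<^esub>i\<in>F. c i \<odot>\<^bsub>Q\<^esub> cl (b i))"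
      by (rule Q.M.add.finprod_insert) (use insert.hyps car in auto)
    then show ?case using insert by (simp add: Q_simps)
  qed
qed

theorem linear_basis_MRBL:
  "linear_basis (MRBL lam X) (Irr_B X) (\<lambda>t. MRBL_class lam X (lie_poly t))"
proof -
  have inj: "erase (bracket w) = w" if "w \<in> irr_words X" for w
    using erase_bracket[of w X] irr_words_ALSW that by blast
  have br: "bracket (erase t) = t" "erase t \<in> irr_words X" if "t \<in> Irr_B X" for t
    using that inj unfolding Irr_B_eq by auto
  have lie: "lie_poly t \<in> Lie_set X" if "t \<in> Irr_B X" for t
    using that irr_words_ALSW lie_poly_in_Lie_set unfolding Irr_B_eq by blast
  have sum: "(\<Oplus>\<^bsub>MRBL lam X\<^esub>j\<in>F. c j \<odot>\<^bsub>MRBL lam X\<^esub> MRBL_class lam X (lie_poly j))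
      = B.cl X lam (\<Sum>j\<in>F. pscale (c j) (lie_poly j))" if "finite F" "F \<subseteq> Irr_B X" for F c
    unfolding MRBL_def MRBL_class_eq by (rule B.finsum_cl) (use that lie in auto)
  show ?thesis
    unfolding linear_basis_def
  proof (intro conjI allI impI ballI)
    show "(\<lambda>t. MRBL_class lam X (lie_poly t)) \<in> Irr_B X \<rightarrow> carrier (MRBL lam X)"
      unfolding MRBL_def MRBL_class_eq B.Q_simps using lie by auto
  next
    fix F c j
    assume a: "finite F \<and> F \<subseteq> Irr_B X \<and>
      (\<Oplus>\<^bsub>MRBL lam X\<^esub>j\<in>F. c j \<odot>\<^bsub>MRBL lam X\<^esub> MRBL_class lam X (lie_poly j)) = \<zero>\<^bsub>MRBL lam X\<^esub>"
      and j: "j \<in> F"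
    then have "B.cl X lam (\<Sum>j\<in>F. pscale (c j) (lie_poly j)) = B.cl X lam 0"
      using sum[of F c] by (simp add: MRBL_def B.Q_simps)
    then have Id: "(\<Sum>j\<in>F. pscale (c j) (lie_poly j)) \<in> Id_B lam X" unfolding B.cl_eq by simp
    \<comment> \<open>The coefficients are moved from bracketings to words; \<open>erase\<close> is
      injective on \<open>Irr_B X\<close>, so none of them merge.\<close>
    define d where "d = (\<Sum>j\<in>F. Poly_Mapping.single (erase j) (c j))"
    have "supp d \<subseteq> erase ` F"
      unfolding d_def using keys_sum[of "\<lambda>j. Poly_Mapping.single (erase j) (c j)" F]
      by (auto split: if_splits)
    then have d: "supp d \<subseteq> irr_words X" using br(2) a by blast
    have add: "additive (lyn_comb :: ('a, 'b) omega_poly \<Rightarrow> _)" by (simp add: additive_def lin_ext_add)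
    have "lyn_comb d = (\<Sum>j\<in>F. pscale (c j) (lie_poly j))"
      unfolding d_def additive.sum[OF add] lin_ext_single
      by (intro sum.cong refl) (use br(1) a in auto)
    then have "d = 0" using irr_independent[OF d] Id by simp
    then have "0 = coef d (erase j)" by simp
    also have "\<dots> = (\<Sum>i\<in>F. if i = j then c i else 0)"
      unfolding d_def lookup_sum
    proof (intro sum.cong refl)
      fix i assume i: "i \<in> F"
      have "i \<in> Irr_B X" "j \<in> Irr_B X" using i j a by blast+
      then have "erase i = erase j \<longleftrightarrow> i = j" using br(1) by metis
      then show "coef (Poly_Mapping.single (erase i) (c i)) (erase j) = (if i = j then c i else 0)"
        by (simp add: lookup_single when_def)
    qed
    also have "\<dots> = c j" using a j by simp
    finally show "c j = 0" by simp
  next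
    fix x assume "x \<in> carrier (MRBL lam X)"
    then obtain f where f: "x = B.cl X lam f" "f \<in> Lie_set X" unfolding MRBL_def by (auto simp: B.Q_simps)
    obtain d where d: "supp d \<subseteq> irr_words X" "f - lyn_comb d \<in> Id_B lam X" using irr_spanning[OF f(2)] by blast
    let ?F = "bracket ` supp d" and ?c = "\<lambda>t. coef d (erase t)"
    have F: "finite ?F" "?F \<subseteq> Irr_B X" using d(1) unfolding Irr_B_eq by auto
    have "inj_on bracket (supp d)" by (rule inj_on_inverseI[of _ erase]) (use inj d(1) in blast)
    then have "(\<Sum>j\<in>?F. pscale (?c j) (lie_poly j)) = (\<Sum>w\<in>supp d. pscale (coef d (erase (bracket w))) (lie_poly (bracket w)))"
      by (simp add: sum.reindex)
    also have "\<dots> = lyn_comb d"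
      unfolding lin_ext_def by (intro sum.cong refl) (use inj d(1) in auto)
    finally have "x = (\<Oplus>\<^bsub>MRBL lam X\<^esub>j\<in>?F. ?c j \<odot>\<^bsub>MRBL lam X\<^esub> MRBL_class lam X (lie_poly j))"
      using d(2) unfolding sum[OF F] f(1) by (simp add: B.cl_eq)
    then show "\<exists>F c. finite F \<and> F \<subseteq> Irr_B X \<and>
        x = (\<Oplus>\<^bsub>MRBL lam X\<^esub>j\<in>F. c j \<odot>\<^bsub>MRBL lam X\<^esub> MRBL_class lam X (lie_poly j))"
      using F by (intro exI[of _ ?F] exI[of _ ?c] conjI)
  qed
qed

section \<open>Triviality of the compositions\<close>

text \<open>An element of the ideal put at the star stays in the ideal through brackets and P. A
  lower bound on the number of stars suffices for absorption and passes directly to one of two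
  factors.\<close>

lemma star_eval_prm:
  assumes I: "lie_ideal X I" and g: "g \<in> I"
  shows "prm_over (insert None (Some ` X)) (erase_prm p) \<Longrightarrow>
    eval_prm (case_option g pgen) p \<in> Lie_set X \<and>
    (star_count_prm (erase_prm p) \<ge> 1 \<longrightarrow> eval_prm (case_option g pgen) p \<in> I)"
  and star_eval:
  "word_over (insert None (Some ` X)) (erase t) \<Longrightarrow>
    nword_eval (case_option g pgen) t \<in> Lie_set X \<and>
    (sum_list (map star_count_prm (erase t)) \<ge> 1 \<longrightarrow> nword_eval (case_option g pgen) t \<in> I)"
proof -
  let ?\<sigma> = "case_option g pgen" and ?Y = "insert None (Some ` X)"
  have tree: "nword_eval ?\<sigma> t \<in> Lie_set X \<and>
      (sum_list (map star_count_prm (erase t)) \<ge> 1 \<longrightarrow> nword_eval ?\<sigma> t \<in> I)"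
    if h: "\<And>p. p \<in> set_bword t \<Longrightarrow> prm_over ?Y (erase_prm p) \<Longrightarrow> eval_prm ?\<sigma> p \<in> Lie_set X \<and>
      (star_count_prm (erase_prm p) \<ge> 1 \<longrightarrow> eval_prm ?\<sigma> p \<in> I)"
    and o: "word_over ?Y (erase t)" for t
    using h o
  proof (induction t)
    case (Letter p)
    then show ?case by auto
  next
    case (Br s t)
    have s: "nword_eval ?\<sigma> s \<in> Lie_set X \<and>
      (sum_list (map star_count_prm (erase s)) \<ge> 1 \<longrightarrow> nword_eval ?\<sigma> s \<in> I)"
      by (rule Br.IH(1)) (use Br.prems in auto)
    have t: "nword_eval ?\<sigma> t \<in> Lie_set X \<and>
      (sum_list (map star_count_prm (erase t)) \<ge> 1 \<longrightarrow> nword_eval ?\<sigma> t \<in> I)"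
      by (rule Br.IH(2)) (use Br.prems in auto)
    have "pcomm (nword_eval ?\<sigma> s) (nword_eval ?\<sigma> t) \<in> I"
      if c: "sum_list (map star_count_prm (erase (Br s t))) \<ge> 1"
    proof (cases "sum_list (map star_count_prm (erase s)) \<ge> 1")
      case True
      then show ?thesis using lie_idealD(7)[OF I] s t by blast
    next
      case False
      then have "sum_list (map star_count_prm (erase t)) \<ge> 1" using c by simp
      then show ?thesis using lie_idealD(5)[OF I] s t by blast
    qed
    then show ?case using s t by (simp add: Lie_comm)
  qed
  show prm: "prm_over ?Y (erase_prm p) \<Longrightarrow> eval_prm ?\<sigma> p \<in> Lie_set X \<and>
    (star_count_prm (erase_prm p) \<ge> 1 \<longrightarrow> eval_prm ?\<sigma> p \<in> I)" for p
  proof (induction p)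
    case (BGen y)
    then show ?case using g lie_idealD(1)[OF I g] by (cases y) (auto intro: Lie_gen)
  next
    case (BOp t)
    have "nword_eval ?\<sigma> t \<in> Lie_set X \<and>
      (sum_list (map star_count_prm (erase t)) \<ge> 1 \<longrightarrow> nword_eval ?\<sigma> t \<in> I)"
      by (rule tree) (use BOp in auto)
    then show ?case using lie_idealD(6)[OF I] by (auto intro: Lie_op)
  qed
  show "word_over ?Y (erase t) \<Longrightarrow> nword_eval ?\<sigma> t \<in> Lie_set X \<and>
    (sum_list (map star_count_prm (erase t)) \<ge> 1 \<longrightarrow> nword_eval ?\<sigma> t \<in> I)"
    by (rule tree[OF prm])
qed

lemma special_normal_in_ideal:
  assumes ch: "valid_choice X ch" and \<pi>: "\<pi> \<in> star_words X" and f: "has_lead f v"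
    and v: "v \<in> ALSW X" and p: "plug \<pi> v \<in> ALSW X" and I: "lie_ideal X I" "f \<in> I"
  shows "special_normal X ch \<pi> f \<in> I"
proof -
  obtain T c where Tc: "ch \<pi> v = (T, c)" by (cases "ch \<pi> v")
  have T: "erase T \<in> star_words X" and vc: "v @ c \<in> ALSW X"
    using ch \<pi> v p Tc unfolding valid_choice_def by fastforce+
  let ?g = "foldl pcomm f (map (\<lambda>d. lie_poly (bracket d)) (lyndon_factors X c))"
  have "\<forall>p\<in>set c. prm_lyn X p" using vc by (auto simp: ALSW_iff)
  then have "?g \<in> I" by (intro lie_ideal_left_normed[OF I] lyndon_factors_spec)
  then have "nword_eval (case_option ?g pgen) T \<in> I"
    using star_eval[OF I(1), of ?g T] T by (auto simp: star_words_iff)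
  then show ?thesis unfolding special_normal_def has_lead_lead[OF f] Tc by simp
qed

section \<open>Reduction by special normal words of \<open>S_B\<close>\<close>

context
  fixes X :: "'x::wellorder set" and lam :: "'k::field" and ch :: "'x normal_choice"
  assumes ch: "valid_choice X ch"
begin

lemma S_B_cases:
  assumes "s \<in> S_B lam X"
  obtains u v where "s = f_B lam u v" "u \<in> ALSW X" "v \<in> ALSW X" "Dl_less v u"
    "has_lead s [Op u, Op v]" "[Op u, Op v] \<in> ALSW X"
proof -
  obtain u v where s: "s = f_B lam u v" "u \<in> ALSW X" "v \<in> ALSW X" "Dl_less v u"
    using assms unfolding S_B_def by blast
  have less: "prm_less (Op v) (Op u)"
    using s(4) Dl_less_deg_le[OF s(4)] by (auto simp: prm_less_iff)
  have "lyndon prm_gt ([Op u] @ [Op v])" by (rule PO.lyndon_append) (use less in simp_all)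
  then have "[Op u, Op v] \<in> ALSW X" using s(2,3) by (simp add: ALSW_iff)
  then show thesis using that s has_lead_f_B[OF s(2-4), of lam] by blast
qed

lemma special_normal_S_B:
  assumes s: "s \<in> S_B lam X" "has_lead s l" and \<pi>: "\<pi> \<in> star_words X" and p: "plug \<pi> l \<in> ALSW X"
  shows "special_normal X ch \<pi> s \<in> Id_B lam X" "has_lead (special_normal X ch \<pi> s) (plug \<pi> l)"
proof -
  obtain u v where uv: "has_lead s [Op u, Op v]" "[Op u, Op v] \<in> ALSW X"
    using S_B_cases[OF s(1)] by blast
  have l: "l = [Op u, Op v]" using has_lead_lead[OF uv(1)] has_lead_lead[OF s(2)] by simp
  have "s \<in> Id_B lam X" using S_B_Id_B s(1) by blast
  then show "special_normal X ch \<pi> s \<in> Id_B lam X"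
    using special_normal_in_ideal[OF ch \<pi> s(2) _ p lie_ideal_Id_B] uv(2) l by simp
  show "has_lead (special_normal X ch \<pi> s) (plug \<pi> l)"
    using has_lead_special_normal[OF ch \<pi> s(2) _ p] uv(2) l by simp
qed

text \<open>Two bounds are involved: the earlier summands have leading words below \<open>m\<close>,
  and the new one has \<open>m\<close> itself, which is below \<open>w\<close>.\<close>

lemma trivial_modulo_add:
  assumes h: "trivial_modulo X ch (S_B lam X) m h" and "Dl_less m w"
    and s: "s \<in> S_B lam X" and \<pi>: "\<pi> \<in> star_words X" and p: "plug \<pi> (lead s) = m" "m \<in> ALSW X"
  shows "trivial_modulo X ch (S_B lam X) w (h + pscale a (special_normal X ch \<pi> s))"
proof -
  obtain n :: nat and \<alpha> P t where t: "\<forall>i<n. t i \<in> S_B lam X \<and> P i \<in> star_words X \<and>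
      plug (P i) (lead (t i)) \<in> ALSW X \<and> Dl_less (plug (P i) (lead (t i))) m"
    "h = (\<Sum>i<n. pscale (\<alpha> i) (special_normal X ch (P i) (t i)))"
    using h unfolding trivial_modulo_def by blast
  let ?t = "t(n := s)" and ?P = "P(n := \<pi>)" and ?\<alpha> = "\<alpha>(n := a)"
  have "?t i \<in> S_B lam X \<and> ?P i \<in> star_words X \<and>
      plug (?P i) (lead (?t i)) \<in> ALSW X \<and> Dl_less (plug (?P i) (lead (?t i))) w" if "i < Suc n" for i
  proof (cases "i = n")
    case True
    then show ?thesis using s \<pi> p assms(2) by simp
  next
    case False
    then have "i < n" using that by simp
    then show ?thesis using t(1) False Dl_less_trans[OF _ assms(2), of "plug (P i) (lead (t i))"] by simp
  qed
  moreover have "h + pscale a (special_normal X ch \<pi> s)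
      = (\<Sum>i<Suc n. pscale (?\<alpha> i) (special_normal X ch (?P i) (?t i)))"
    using t(2) by simp
  ultimately show ?thesis unfolding trivial_modulo_def by blast
qed

lemma Id_B_trivial:
  assumes "h \<in> Id_B lam X" "below h w"
  shows "trivial_modulo X ch (S_B lam X) w h"
proof -
  have "h \<in> Lie_set X" by (rule B.D(1)[OF assms(1)])
  then show ?thesis using assms
  proof (induction arbitrary: w rule: Lie_lead_induct)
    case zero
    show ?case unfolding trivial_modulo_def by (intro exI[of _ 0]) simp
  next
    case (lead f m)
    have mw: "Dl_less m w" using lead.prems(2) lead.hyps(3) by (simp add: below_def in_keys_iff)
    have "has_lead (pscale (inverse (coef f m)) f) m" by (rule has_lead_scaled[OF lead.hyps(3,4)])
    moreover have "pscale (inverse (coef f m)) f \<in> rel_ideal lam"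
      using B.D(4)[OF lead.prems(1)] Id_B_rel_ideal by blast
    ultimately obtain g where "rel lam m g" using lead_reducible by blast
    moreover have "\<forall>p\<in>set m. prm_lyn X p" using lead.hyps(2) by (simp add: ALSW_iff)
    ultimately obtain \<pi> u v where \<pi>: "\<pi> \<in> star_words X" "u \<in> ALSW X" "v \<in> ALSW X" "Dl_less v u"
      "m = plug \<pi> [Op u, Op v]"
      using rel_imp_reducible by blast
    let ?s = "f_B lam u v"
    have s: "?s \<in> S_B lam X" "has_lead ?s [Op u, Op v]"
      using \<pi> has_lead_f_B unfolding S_B_def by blast+
    note sp = special_normal_S_B[OF s \<pi>(1), folded \<pi>(5), OF lead.hyps(2)]
    let ?h = "f - pscale (coef f m) (special_normal X ch \<pi> ?s)"
    have hI: "?h \<in> Id_B lam X" by (rule B.D(8)[OF lead.prems(1) B.D(4)[OF sp(1)]])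
    have hb: "below ?h m" by (rule has_lead_diff_scaled[OF lead.hyps(4) sp(2)])
    \<comment> \<open>The bound drops from \<open>w\<close> to \<open>m\<close>, so the summands
      found recursively are smaller than the one just subtracted.\<close>
    have "trivial_modulo X ch (S_B lam X) m ?h" by (rule lead.IH[OF B.D(1)[OF hI] hb hI hb])
    from trivial_modulo_add[OF this mw s(1) \<pi>(1) _ lead.hyps(2), of "coef f m"]
    show ?case using has_lead_lead[OF s(2)] \<pi>(5) by simp
  qed
qed

theorem GS_basis_S_B: "GS_basis X ch (S_B lam X)"
  unfolding GS_basis_def
proof (intro conjI ballI allI impI)
  show "S_B lam X \<subseteq> Lie_set X" by (rule S_B_Lie_set)
  show "monic f" if "f \<in> S_B lam X" for f
    using S_B_cases[OF that] has_lead_monic by metis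
  fix f g w h
  assume f: "f \<in> S_B lam X" and g: "g \<in> S_B lam X" and comp: "is_composition X ch f g w h"
  obtain u v where uv: "u \<in> ALSW X" "v \<in> ALSW X" "Dl_less v u" "has_lead f [Op u, Op v]" "[Op u, Op v] \<in> ALSW X"
    using S_B_cases[OF f] by metis
  obtain u' v' where uv': "u' \<in> ALSW X" "v' \<in> ALSW X" "Dl_less v' u'" "has_lead g [Op u', Op v']" "[Op u', Op v'] \<in> ALSW X"
    using S_B_cases[OF g] by metis
  note lf = has_lead_lead[OF uv(4)] and lg = has_lead_lead[OF uv'(4)]
  have "h \<in> Id_B lam X \<and> below h w"
    using comp
  proof cases
    case (intersection a b)
    have a: "a \<noteq> []" "word_over X a" and b: "b \<noteq> []" "word_over X b"
      using intersection(2,3) by (simp_all add: omega_words_iff)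
    have w: "w = [Op u, Op v] @ a" "w = b @ [Op u', Op v']" "length w < 4"
      using intersection(4-6) lf lg by simp_all
    \<comment> \<open>Leading words have breadth 2, so the breadth of \<open>w\<close> is less than
      4; as \<open>a\<close> and \<open>b\<close> are nonempty it is 3, and the two leading words
      share one letter.\<close>
    have "length a = 1" "length b = 1"
      using w a(1) b(1) arg_cong[OF w(1), of length] arg_cong[OF w(2), of length]
      by (cases a; cases b; simp)+
    then obtain y z where yz: "a = [y]" "b = [z]" by (auto simp: length_Suc_conv)
    then have e: "z = Op u" "u' = v" "y = Op v'" using w(1,2) by auto
    \<comment> \<open>The letters of \<open>w\<close> decrease, which makes \<open>w\<close>
      Lyndon-Shirshov, as special normal words require.\<close>
    have "lex_gt prm_gt [Op u] [Op u', Op v']"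
      using uv(3) Dl_less_deg_le[OF uv(3)] e by (auto simp: prm_less_iff)
    then have "lyndon prm_gt ([Op u] @ [Op u', Op v'])"
      by (intro PO.lyndon_append) (use ALSW_lyndon[OF uv'(5)] in simp_all)
    then have wA: "w \<in> ALSW X" using uv(1) uv'(1,2) w(2) yz e by (simp add: ALSW_iff)
    have p1: "star # lift_word a \<in> star_words X" "plug (star # lift_word a) [Op u, Op v] = w"
      using star_words_context(1)[OF star_words_star(1)[of X], of "[]" a]
        star_words_context(2)[OF star_words_star(1)[of X], of "[]" a "[Op u, Op v]"] a(2) w(1)
      by (simp_all add: star_words_star)
    have p2: "lift_word b @ [star] \<in> star_words X" "plug (lift_word b @ [star]) [Op u', Op v'] = w"
      using star_words_context(1)[OF star_words_star(1)[of X], of b "[]"]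
        star_words_context(2)[OF star_words_star(1)[of X], of b "[]" "[Op u', Op v']"] b(2) w(2)
      by (simp_all add: star_words_star)
    note s1 = special_normal_S_B[OF f uv(4) p1(1), unfolded p1(2), OF wA]
    note s2 = special_normal_S_B[OF g uv'(4) p2(1), unfolded p2(2), OF wA]
    \<comment> \<open>Both special normal words are monic with leading word \<open>w\<close>, so
      \<open>w\<close> cancels in their difference.\<close>
    show ?thesis unfolding intersection(1) using B.D(8)[OF s1(1) s2(1)] has_lead_diff[OF s1(2) s2(2)] by simp
  next
    case (inclusion \<pi>)
    have w: "w = [Op u, Op v]" "plug \<pi> [Op u', Op v'] = w" using inclusion lf lg by simp_all
    have wA: "w \<in> ALSW X" using uv(5) w(1) by simp
    note s = special_normal_S_B[OF g uv'(4) inclusion(2), unfolded w(2), OF wA]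
    have "f \<in> Id_B lam X" using S_B_Id_B f by blast
    then show ?thesis
      unfolding inclusion(1) using B.D(8)[OF _ s(1)] has_lead_diff[OF uv(4)[folded w(1)] s(2)] by blast
  qed
  then show "trivial_modulo X ch (S_B lam X) w h" using Id_B_trivial by blast
qed

end

theorem theorem4p2:
  fixes X :: "'x::wellorder set" and lam :: "'k::field"
  shows "(\<forall>ch. valid_choice X ch \<longrightarrow> GS_basis X ch (S_B lam X)) \<and>
    free_modified_RB TYPE('b) lam X (\<lambda>x. MRBL_class lam X (pgen x)) (MRBL lam X) \<and>
    linear_basis (MRBL lam X) (Irr_B X) (\<lambda>t. MRBL_class lam X (lie_poly t))"
  by (intro conjI allI impI GS_basis_S_B free_MRBL linear_basis_MRBL)

end
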